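(* Let $k\ge1$ and $Q_h=X^k_{h,0}(\Gamma)$, with meshes $\mathcal{T}^\Omega_h$ and $\mathcal{T}^\Lambda_h$ conforming to $\Gamma$. There exists a positive constant $\beta_{h,1}$ such that $$\inf_{0\ne\mu_h\in Q_h}\ \sup_{\substack{v_h\in X^k_{h,0}(\Omega),\ v_{\odot h}\in X^k_{h,0}(\Lambda)\\ [v_h,v_{\odot h}]\neq 0}}\frac{\langle\mathcal{T}_\Gamma v_h-\mathcal{E}_\Gamma v_{\odot h},\mu_h\rangle_\Gamma}{|||[v_h,v_{\odot h}]|||\;\|\mu_h\|_{H^{-1/2}(\Gamma)}}\ \ge\ \beta_{h,1}.$$
   Context: Geometry. $\Omega\subset\mathbb{R}^3$ is a bounded convex domain, $\Lambda\subset\Omega$ is a curve parametrized by arclength $s\in(0,S)$, assumed piecewise linear, and $\Omega_\ominus\subset\Omega$ is a generalized cylinder with centerline $\Lambda$, i.e. it is swept by planar cross-sections $\mathcal{D}(s)$, $s\in(0,S)$. Its lateral surface is $\Gamma=\bigcup_{s}\partial\mathcal{D}(s)$; $\Omega_\ominus$ crosses $\Omega$ from side to side and its upper and lower faces lie on $\partial\Omega$. $|\mathcal{D}(s)|$ and $|\partial\mathcal{D}(s)|$ (Lebesgue measures) are strictly positive and bounded. Meshes (conforming case). $\mathcal{T}^\Omega_h$ is a shape-regular triangulation of $\Omega$ into tetrahedra and $\mathcal{T}^\Lambda_h$ an admissible partition of $\Lambda$ such that: the intersection of $\mathcal{T}^\Omega_h$ with $\Gamma$ is made of entire faces of elements $K\in\mathcal{T}^\Omega_h$;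 and the intersection of $\Gamma$ with any plane orthogonal to $\Lambda$ that crosses $\Lambda$ at an internal node of $\mathcal{T}^\Lambda_h$ consists of entire edges of $\mathcal{T}^\Omega_h$. Discrete spaces. $X^k_{h,0}(\Omega)\subset H^1_0(\Omega)$: continuous piecewise polynomials of degree $k$ on $\mathcal{T}^\Omega_h$ vanishing on $\partial\Omega$. $X^k_{h,0}(\Lambda)\subset H^1_0(\Lambda)$: continuous piecewise polynomials of degree $k$ on $\mathcal{T}^\Lambda_h$ vanishing on $\Lambda\cap\partial\Omega$ (the endpoints). $X^k_{h,0}(\Gamma)\subset H^{1/2}_{00}(\Gamma)$: the trace space of $X^k_{h,0}(\Omega)$ on $\Gamma$, i.e. continuous piecewise polynomials of degree $k$ on the induced mesh of $\Gamma$ vanishing on $\partial\Omega$. Operators and norms. $\mathcal{T}_\Gamma$ is the trace operator onto $\Gamma$; $(\mathcal{E}_\Gamma v_\odot)(x)=v_\odot(s)$ for $x\in\partial\mathcal{D}(s)$. $H^{1/2}_{00}(\Gamma)=\mathcal{T}_\Gamma H^1_0(\Omega)$ (functions of $H^{1/2}(\Gamma)$ with continuous extension by zero), $H^{-1/2}(\Gamma)=(H^{1/2}_{00}(\Gamma))^*$ with the dual norm, and $\langle\cdot,\cdot\rangle_\Gamma$ is the duality pairing. $|||[v,v_\odot]|||^2=\|v\|^2_{H^1(\Omega)}+\|v_\odot\|^2_{H^1(\Lambda),|\mathcal{D}|}$ with $\|v_\odot\|^2_{H^1(\Lambda),|\mathcal{D}|}=\int_\Lambda|\mathcal{D}|(v_\odot^2+(d_sv_\odot)^2)\,ds$.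 *)

theory Defs
  imports "HOL-Analysis.Analysis"
begin

section \<open>Sobolev spaces\<close>

text \<open>Compactly supported \<open>C\<^sup>1\<close> functions are used as test functions, both for weak derivatives and
  for the definition of \<open>H\<^sup>1\<^sub>0\<close> as a closure (the convention of Brezis, Functional Analysis, Sobolev
  Spaces and PDE, Chapters 8 and 9).  Everything is stated for an arbitrary Euclidean space, so
  that it covers both \<open>\<Omega>\<close> in three-space and the parameter interval of the centerline.\<close>

definition test_function :: "'a::euclidean_space set \<Rightarrow> ('a \<Rightarrow> real) \<Rightarrow> bool" where
  "test_function U \<phi> \<longleftrightarrow>
     (\<forall>x. \<phi> differentiable (at x)) \<and>
     (\<forall>e. continuous_on UNIV (\<lambda>x. frechet_derivative \<phi> (at x) e)) \<and>
     compact (closure {x. \<phi> x \<noteq> 0}) \<and> closure {x. \<phi> x \<noteq> 0} \<subseteq> U"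

definition square_integrable_on ::
    "'a::euclidean_space set \<Rightarrow> ('a \<Rightarrow> 'b::euclidean_space) \<Rightarrow> bool" where
  "square_integrable_on U f \<longleftrightarrow>
     set_borel_measurable lborel U f \<and> set_integrable lborel U (\<lambda>x. (norm (f x))\<^sup>2)"

definition is_weak_gradient ::
    "'a::euclidean_space set \<Rightarrow> ('a \<Rightarrow> real) \<Rightarrow> ('a \<Rightarrow> 'a) \<Rightarrow> bool" where
  "is_weak_gradient U v g \<longleftrightarrow> square_integrable_on U g \<and>
     (\<forall>\<phi>. test_function U \<phi> \<longrightarrow> (\<forall>e\<in>Basis.
        (LINT x:U|lborel. v x * frechet_derivative \<phi> (at x) e)
          = - (LINT x:U|lborel. (g x \<bullet> e) * \<phi> x)))"

text \<open>Unique up to null sets whenever it exists.\<close>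

definition weak_gradient ::
    "'a::euclidean_space set \<Rightarrow> ('a \<Rightarrow> real) \<Rightarrow> 'a \<Rightarrow> 'a" where
  "weak_gradient U v = (SOME g. is_weak_gradient U v g)"

definition H1 :: "'a::euclidean_space set \<Rightarrow> ('a \<Rightarrow> real) set" where
  "H1 U = {v. square_integrable_on U v \<and> (\<exists>g. is_weak_gradient U v g)}"

definition H1_norm :: "'a::euclidean_space set \<Rightarrow> ('a \<Rightarrow> real) \<Rightarrow> real" where
  "H1_norm U v = sqrt (LINT x:U|lborel. (v x)\<^sup>2 + (norm (weak_gradient U v x))\<^sup>2)"

definition H1_0 :: "'a::euclidean_space set \<Rightarrow> ('a \<Rightarrow> real) set" where
  "H1_0 U = {v \<in> H1 U. \<exists>\<phi>. (\<forall>n. test_function U (\<phi> n)) \<and>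
                 (\<lambda>n::nat. H1_norm U (\<lambda>x. \<phi> n x - v x)) \<longlonglongrightarrow> 0}"


section \<open>Area and length\<close>

text \<open>For a subset of a plane with at least three non-collinear points the unit normal is
  determined up to sign.  The area of a planar set is the volume of the right prism of height one
  erected on it; the choice of sign only translates the prism.\<close>

definition unit_normal :: "(real^3) set \<Rightarrow> real^3" where
  "unit_normal A = (SOME n. norm n = 1 \<and> (\<forall>x\<in>A. \<forall>y\<in>A. (x - y) \<bullet> n = 0))"

definition right_prism :: "real^3 \<Rightarrow> (real^3) set \<Rightarrow> (real^3) set" where
  "right_prism n A = {x + t *\<^sub>R n |x t. x \<in> A \<and> 0 \<le> t \<and> t \<le> 1}"

definition planar_area :: "(real^3) set \<Rightarrow> real" where
  "planar_area A = measure lborel (right_prism (unit_normal A) A)"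

text \<open>Surface measure of a polyhedral surface given by its (non-overlapping) flat pieces, as a
  Borel measure on three-space concentrated on that surface.\<close>

definition polyhedral_surface_measure :: "(real^3) set set \<Rightarrow> (real^3) measure" where
  "polyhedral_surface_measure \<F> =
     measure_of UNIV (sets borel)
       (\<lambda>A. \<Sum>F\<in>\<F>. emeasure lborel (right_prism (unit_normal F) (A \<inter> F)))"

text \<open>One-dimensional Hausdorff measure.\<close>

definition hausdorff_length :: "'a::metric_space set \<Rightarrow> ennreal" where
  "hausdorff_length A =
     (SUP \<delta>\<in>{0::real<..}.
        INF C\<in>{C :: nat \<Rightarrow> 'a set. A \<subseteq> (\<Union>i. C i) \<and> (\<forall>i. bounded (C i) \<and> diameter (C i) \<le> \<delta>)}.
          \<Sum>i. ennreal (diameter (C i)))"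


section \<open>Trace space on the surface and its dual\<close>

text \<open>\<open>M\<close> is the surface measure of \<open>\<Gamma>\<close>.  The trace operator is the continuous extension to
  \<open>H\<^sup>1\<^sub>0\<close> of the restriction of test functions to \<open>\<Gamma>\<close>; traces are determined \<open>M\<close>-almost everywhere.\<close>

definition has_trace ::
    "(real^3) set \<Rightarrow> (real^3) measure \<Rightarrow> (real^3 \<Rightarrow> real) \<Rightarrow> (real^3 \<Rightarrow> real) \<Rightarrow> bool" where
  "has_trace U M v g \<longleftrightarrow> g \<in> borel_measurable M \<and>
     (\<exists>\<phi>. (\<forall>n. test_function U (\<phi> n)) \<and>
          (\<lambda>n::nat. H1_norm U (\<lambda>x. \<phi> n x - v x)) \<longlonglongrightarrow> 0 \<and>
          (\<lambda>n. \<integral>\<^sup>+x. ennreal ((\<phi> n x - g x)\<^sup>2) \<partial>M) \<longlonglongrightarrow> 0)"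

definition trace_op ::
    "(real^3) set \<Rightarrow> (real^3) measure \<Rightarrow> (real^3 \<Rightarrow> real) \<Rightarrow> real^3 \<Rightarrow> real" where
  "trace_op U M v = (SOME g. has_trace U M v g)"

text \<open>\<open>H\<^sup>1\<^sup>/\<^sup>2\<^sub>0\<^sub>0(\<Gamma>)\<close> is the range of the trace operator on \<open>H\<^sup>1\<^sub>0\<close>, with the quotient norm.\<close>

definition H_half_00 :: "(real^3) set \<Rightarrow> (real^3) measure \<Rightarrow> (real^3 \<Rightarrow> real) set" where
  "H_half_00 U M = {q. \<exists>v\<in>H1_0 U. has_trace U M v q}"

definition H_half_00_norm ::
    "(real^3) set \<Rightarrow> (real^3) measure \<Rightarrow> (real^3 \<Rightarrow> real) \<Rightarrow> real" where
  "H_half_00_norm U M q = Inf {H1_norm U v |v. v \<in> H1_0 U \<and> has_trace U M v q}"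

text \<open>Dual norm of a functional on \<open>H\<^sup>1\<^sup>/\<^sup>2\<^sub>0\<^sub>0(\<Gamma>)\<close>; it is \<open>\<infinity>\<close> for unbounded functionals.\<close>

definition H_minus_half_norm ::
    "(real^3) set \<Rightarrow> (real^3) measure \<Rightarrow> ((real^3 \<Rightarrow> real) \<Rightarrow> real) \<Rightarrow> ereal" where
  "H_minus_half_norm U M l =
     (SUP q\<in>{q \<in> H_half_00 U M. \<not> (AE x in M. q x = 0)}. ereal (\<bar>l q\<bar> / H_half_00_norm U M q))"

text \<open>The element of \<open>H\<^sup>-\<^sup>1\<^sup>/\<^sup>2(\<Gamma>)\<close> represented by a function, with \<open>L\<^sup>2(\<Gamma>)\<close> as pivot space: the
  duality pairing of \<open>q\<close> with \<open>\<mu>\<close> is the value of this functional at \<open>q\<close>.\<close>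

definition pivot_functional ::
    "(real^3) measure \<Rightarrow> (real^3 \<Rightarrow> real) \<Rightarrow> (real^3 \<Rightarrow> real) \<Rightarrow> real" where
  "pivot_functional M \<mu> = (\<lambda>q. LINT x|M. q x * \<mu> x)"


section \<open>Geometry\<close>

text \<open>A partition of the interval from \<open>0\<close> to \<open>S\<close> is given by its finite set of nodes.\<close>

definition is_partition :: "real \<Rightarrow> real set \<Rightarrow> bool" where
  "is_partition S N \<longleftrightarrow> finite N \<and> 0 \<in> N \<and> S \<in> N \<and> N \<subseteq> {0..S}"

definition elements :: "real set \<Rightarrow> real set set" where
  "elements N = {{a..b} |a b. a \<in> N \<and> b \<in> N \<and> a < b \<and> {a<..<b} \<inter> N = {}}"

definition piecewise_linear_arclength_curve :: "real \<Rightarrow> (real \<Rightarrow> real^3) \<Rightarrow> bool" where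
  "piecewise_linear_arclength_curve S \<gamma> \<longleftrightarrow> 0 < S \<and> inj_on \<gamma> {0..S} \<and>
     (\<exists>N. is_partition S N \<and>
        (\<forall>I\<in>elements N. \<exists>a d. norm d = 1 \<and> (\<forall>s\<in>I. \<gamma> s = a + s *\<^sub>R d)))"

text \<open>\<open>D s\<close> is a relatively open piece of a plane, so that its \<open>rel_frontier\<close> is its boundary
  within that plane.\<close>

definition lateral_surface :: "real \<Rightarrow> (real \<Rightarrow> (real^3) set) \<Rightarrow> (real^3) set" where
  "lateral_surface S D = (\<Union>s\<in>{0<..<S}. rel_frontier (D s))"

definition swept_region :: "real \<Rightarrow> (real \<Rightarrow> (real^3) set) \<Rightarrow> (real^3) set" where
  "swept_region S D = (\<Union>s\<in>{0<..<S}. D s)"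

text \<open>The sections \<open>D 0\<close> and \<open>D S\<close> are the lower and upper faces, which lie on the boundary of
  \<open>\<Omega>\<close>.  The planes of the sections are not required to be orthogonal to the centerline, since this
  would force neighbouring sections to intersect at the kinks of a piecewise linear centerline.
  The function \<open>c\<close> expresses that the arclength parameter is a (well-defined and continuous)
  coordinate on the lateral surface, without which a function of \<open>s\<close> cannot be extended to it.\<close>

definition generalized_cylinder ::
    "(real^3) set \<Rightarrow> real \<Rightarrow> (real \<Rightarrow> real^3) \<Rightarrow> (real \<Rightarrow> (real^3) set) \<Rightarrow> bool" where
  "generalized_cylinder \<Omega> S \<gamma> D \<longleftrightarrow>
     (\<forall>s\<in>{0..S}. bounded (D s) \<and> aff_dim (D s) = 2 \<and>
        openin (top_of_set (affine hull D s)) (D s) \<and> \<gamma> s \<in> affine hull D s) \<and>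
     swept_region S D \<subseteq> \<Omega> \<and>
     D 0 \<subseteq> frontier \<Omega> \<and> D S \<subseteq> frontier \<Omega> \<and>
     frontier (swept_region S D) = lateral_surface S D \<union> closure (D 0) \<union> closure (D S) \<and>
     (\<exists>c. continuous_on (lateral_surface S D) c \<and>
        (\<forall>s\<in>{0<..<S}. \<forall>x\<in>rel_frontier (D s). c x = s)) \<and>
     set_borel_measurable lborel {0<..<S} (\<lambda>s. planar_area (D s)) \<and>
     (\<exists>B::real. \<forall>s\<in>{0<..<S}.
        0 < planar_area (D s) \<and> planar_area (D s) \<le> B \<and>
        0 < hausdorff_length (rel_frontier (D s)) \<and>
        hausdorff_length (rel_frontier (D s)) \<le> ennreal B)"

definition extension_op :: "real \<Rightarrow> (real \<Rightarrow> (real^3) set) \<Rightarrow> (real \<Rightarrow> real) \<Rightarrow> real^3 \<Rightarrow> real" where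
  "extension_op S D w x = w (THE s. s \<in> {0<..<S} \<and> x \<in> rel_frontier (D s))"


section \<open>Meshes\<close>

definition tetrahedral_mesh :: "(real^3) set \<Rightarrow> (real^3) set set \<Rightarrow> bool" where
  "tetrahedral_mesh \<Omega> \<T> \<longleftrightarrow>
     triangulation \<T> \<and> (\<forall>K\<in>\<T>. 3 simplex K) \<and> \<Union>\<T> = closure \<Omega>"

definition shape_regular :: "real \<Rightarrow> (real^3) set set \<Rightarrow> bool" where
  "shape_regular \<sigma> \<T> \<longleftrightarrow>
     (\<forall>K\<in>\<T>. diameter K \<le> \<sigma> * Sup {2 * r |x r. 0 \<le> r \<and> cball x r \<subseteq> K})"

text \<open>The lateral surface is parametrized over the open interval; its closure adds the two
  boundary curves on the boundary of \<open>\<Omega>\<close>.\<close>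

definition surface_faces :: "(real^3) set set \<Rightarrow> (real^3) set \<Rightarrow> (real^3) set set" where
  "surface_faces \<T> \<Gamma> = {F. \<exists>K\<in>\<T>. F facet_of K \<and> F \<subseteq> closure \<Gamma>}"

definition surface_measure :: "(real^3) set set \<Rightarrow> (real^3) set \<Rightarrow> (real^3) measure" where
  "surface_measure \<T> \<Gamma> = polyhedral_surface_measure (surface_faces \<T> \<Gamma>)"

text \<open>At a kink both one-sided tangents are taken into account.\<close>

definition tangents :: "real \<Rightarrow> (real \<Rightarrow> real^3) \<Rightarrow> real \<Rightarrow> (real^3) set" where
  "tangents S \<gamma> s = {d. (\<gamma> has_vector_derivative d) (at s within {s..S}) \<or>
                        (\<gamma> has_vector_derivative d) (at s within {0..s})}"

definition conforming ::
    "real \<Rightarrow> (real \<Rightarrow> real^3) \<Rightarrow> (real^3) set \<Rightarrow> (real^3) set set \<Rightarrow> real set \<Rightarrow> bool" where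
  "conforming S \<gamma> \<Gamma> \<T> N \<longleftrightarrow>
     closure \<Gamma> = \<Union>(surface_faces \<T> \<Gamma>) \<and>
     (\<forall>s\<in>N - {0, S}. \<forall>d\<in>tangents S \<gamma> s.
        let P = {x. (x - \<gamma> s) \<bullet> d = 0}
        in closure \<Gamma> \<inter> P = \<Union>{E. \<exists>K\<in>\<T>. E edge_of K \<and> E \<subseteq> closure \<Gamma> \<inter> P})"


section \<open>Discrete spaces\<close>

definition polynomial3 :: "nat \<Rightarrow> (real^3 \<Rightarrow> real) \<Rightarrow> bool" where
  "polynomial3 k p \<longleftrightarrow> (\<exists>c. \<forall>x. p x =
     (\<Sum>(i, j, l)\<in>{(i, j, l). i + j + l \<le> k}. c i j l * (x$1)^i * (x$2)^j * (x$3)^l))"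

text \<open>Functions vanishing on the boundary are represented by their extension by zero, so that
  equality in the discrete spaces is equality of functions.\<close>

definition fe_space :: "nat \<Rightarrow> (real^3) set \<Rightarrow> (real^3) set set \<Rightarrow> (real^3 \<Rightarrow> real) set" where
  "fe_space k \<Omega> \<T> = {v. continuous_on UNIV v \<and> (\<forall>x. x \<notin> \<Omega> \<longrightarrow> v x = 0) \<and>
     (\<forall>K\<in>\<T>. \<exists>p. polynomial3 k p \<and> (\<forall>x\<in>K. v x = p x))}"

text \<open>Functions on the centerline are functions of arclength.\<close>

definition fe_space_line :: "nat \<Rightarrow> real \<Rightarrow> real set \<Rightarrow> (real \<Rightarrow> real) set" where
  "fe_space_line k S N = {w. continuous_on UNIV w \<and> (\<forall>s. s \<notin> {0<..<S} \<longrightarrow> w s = 0) \<and>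
     (\<forall>I\<in>elements N. \<exists>p. degree p \<le> k \<and> (\<forall>s\<in>I. w s = poly p s))}"

definition fe_space_surface ::
    "nat \<Rightarrow> (real^3) set \<Rightarrow> (real^3) set set \<Rightarrow> (real^3) set \<Rightarrow> (real^3 \<Rightarrow> real) set" where
  "fe_space_surface k \<Omega> \<T> \<Gamma> = trace_op \<Omega> (surface_measure \<T> \<Gamma>) ` fe_space k \<Omega> \<T>"

definition weighted_H1_norm_line ::
    "real \<Rightarrow> (real \<Rightarrow> (real^3) set) \<Rightarrow> (real \<Rightarrow> real) \<Rightarrow> real" where
  "weighted_H1_norm_line S D w = sqrt (LINT s:{0<..<S}|lborel.
     planar_area (D s) * ((w s)\<^sup>2 + (weak_gradient {0<..<S} w s)\<^sup>2))"

definition pair_norm ::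
    "(real^3) set \<Rightarrow> real \<Rightarrow> (real \<Rightarrow> (real^3) set) \<Rightarrow> (real^3 \<Rightarrow> real) \<Rightarrow> (real \<Rightarrow> real) \<Rightarrow> real" where
  "pair_norm \<Omega> S D v w = sqrt ((H1_norm \<Omega> v)\<^sup>2 + (weighted_H1_norm_line S D w)\<^sup>2)"

end

theory Submission
  imports Defs
begin

text \<open>The constant may depend on the meshes. Taking \<open>v\<^sub>\<odot> = 0\<close> and a discrete \<open>v\<close> with trace \<open>\<mu>\<close>, the
  numerator is \<open>\<parallel>\<mu>\<parallel>\<^sup>2\<close> in \<open>L\<^sup>2(\<Gamma>)\<close>. The dual norm of \<open>\<mu>\<close> is at most a multiple of \<open>\<parallel>\<mu>\<parallel>\<close> because
  traces are bounded from \<open>H\<^sup>1\<^sub>0(\<Omega>)\<close> to \<open>L\<^sup>2(\<Gamma>)\<close>, face by face. Expanding \<open>\<mu>\<close> in a finite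
  \<open>L\<^sup>2(\<Gamma>)\<close>-orthonormal system of discrete functions yields a \<open>v\<close> whose \<open>H\<^sup>1\<close> norm is at most a multiple
  of \<open>\<parallel>\<mu>\<parallel>\<close> as well. That discrete functions have their own restrictions as traces is shown by
  mollifying them after a dilation of the convex domain.\<close>

section \<open>Continuously differentiable functions and mollification\<close>

text \<open>\<open>weak_gradient\<close> and \<open>trace_op\<close> are choices by
  \<open>SOME\<close>, so no norm can be evaluated before uniqueness is known: for weak gradients
  through the fundamental lemma, for traces through the trace inequality applied to a difference.
  The L^2(\<Gamma>) product is degenerate on the discrete space, since functions vanishing on
  \<Gamma> are null vectors. This is the obstacle to bounding the H^1 norm of a lift by its surface
  norm: an arbitrary lift may carry a large part that is invisible on \<Gamma>. Projecting onto the
  orthonormal system discards that part, and Cauchy-Schwarz bounds the coefficients that remain, so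
  the H^1 norm is at most \<open>c\<close> times the surface norm, with \<open>c\<close> depending
  only on the finite system. Mollification alone would push supports across the boundary; the
  dilation about an interior point opens a margin first. Gradients of the mollified functions
  converge off the boundaries of the tetrahedra and stay below twice the Lipschitz constant, so
  dominated convergence suffices. The final constant is \<open>1 / (c * K)\<close> with
  \<open>K\<close> from the trace bound.\<close>

definition has_cont_grad :: "('a::euclidean_space \<Rightarrow> real) \<Rightarrow> ('a \<Rightarrow> 'a) \<Rightarrow> bool" where
  "has_cont_grad f G \<longleftrightarrow> continuous_on UNIV G \<and> (\<forall>x. (f has_derivative (\<lambda>e. G x \<bullet> e)) (at x))"

text \<open>The Riesz vector of the Frechet derivative, assembled coordinatewise. It gives every
  test function a canonical gradient field, later shown to be its weak gradient.\<close>

definition grad :: "('a::euclidean_space \<Rightarrow> real) \<Rightarrow> 'a \<Rightarrow> 'a" where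
  "grad f x = (\<Sum>b\<in>Basis. frechet_derivative f (at x) b *\<^sub>R b)"

lemma has_cont_grad_continuous: "has_cont_grad f G \<Longrightarrow> continuous_on UNIV f"
  unfolding has_cont_grad_def
  by (meson continuous_at_imp_continuous_on has_derivative_continuous)

lemma has_cont_grad_frechet:
  assumes "has_cont_grad f G"
  shows "frechet_derivative f (at x) e = G x \<bullet> e"
  using assms frechet_derivative_at[of f "\<lambda>e. G x \<bullet> e" x] unfolding has_cont_grad_def by metis

lemma has_cont_grad_grad:
  assumes "has_cont_grad f G"
  shows "grad f = G"
proof
  fix x show "grad f x = G x"
    unfolding grad_def has_cont_grad_frechet[OF assms] by (simp add: euclidean_representation)
qed

lemma grad_inner:
  assumes "f differentiable (at x)"
  shows "frechet_derivative f (at x) e = grad f x \<bullet> e"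
proof -
  interpret bounded_linear "frechet_derivative f (at x)"
    using assms frechet_derivative_works has_derivative_bounded_linear by blast
  have "frechet_derivative f (at x) e = frechet_derivative f (at x) (\<Sum>b\<in>Basis. (e \<bullet> b) *\<^sub>R b)"
    by (simp add: euclidean_representation)
  also have "\<dots> = grad f x \<bullet> e"
    by (simp add: sum scaleR grad_def inner_sum_left inner_commute[of e] mult.commute)
  finally show ?thesis .
qed

text \<open>Continuity of all directional derivatives amounts to continuity of the gradient field, a
  finite combination of derivatives along the basis. Later arguments can then compute with
  \<open>grad\<close>.\<close>

lemma test_function_iff:
  "test_function U f \<longleftrightarrow> has_cont_grad f (grad f) \<and>
     compact (closure {x. f x \<noteq> 0}) \<and> closure {x. f x \<noteq> 0} \<subseteq> U"
proof
  assume t: "test_function U f"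
  have 1: "frechet_derivative f (at x) e = grad f x \<bullet> e" for x e
    using t grad_inner unfolding test_function_def by blast
  have "continuous_on UNIV (grad f)"
    unfolding grad_def using t unfolding test_function_def by (intro continuous_intros) auto
  moreover have "(f has_derivative (\<lambda>e. grad f x \<bullet> e)) (at x)" for x
    using t 1 frechet_derivative_works[of f "at x"] unfolding test_function_def by presburger
  ultimately show "has_cont_grad f (grad f) \<and>
     compact (closure {x. f x \<noteq> 0}) \<and> closure {x. f x \<noteq> 0} \<subseteq> U"
    using t unfolding has_cont_grad_def test_function_def by auto
next
  assume a: "has_cont_grad f (grad f) \<and>
     compact (closure {x. f x \<noteq> 0}) \<and> closure {x. f x \<noteq> 0} \<subseteq> U"
  show "test_function U f"
    unfolding test_function_def has_cont_grad_frechet[OF a[THEN conjunct1]]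
    using a unfolding has_cont_grad_def differentiable_def
    by (auto intro!: continuous_intros)
qed

lemma test_functionI:
  assumes "has_cont_grad f G" "compact (closure {x. f x \<noteq> 0})" "closure {x. f x \<noteq> 0} \<subseteq> U"
  shows "test_function U f"
  using assms has_cont_grad_grad test_function_iff by metis

lemma test_functionI_compact:
  assumes "has_cont_grad f G" "{x. f x \<noteq> 0} \<subseteq> K" "compact K" "K \<subseteq> U"
  shows "test_function U f"
proof (rule test_functionI[OF assms(1)])
  have cl: "closure {x. f x \<noteq> 0} \<subseteq> K" using closure_minimal[OF assms(2) compact_imp_closed[OF assms(3)]] .
  then show "closure {x. f x \<noteq> 0} \<subseteq> U" using assms(4) by blast
  show "compact (closure {x. f x \<noteq> 0})"
    using bounded_subset[OF compact_imp_bounded[OF assms(3)] cl] by (simp add: compact_eq_bounded_closed)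
qed

lemma has_cont_grad_mult:
  assumes "has_cont_grad f F" "has_cont_grad g G"
  shows "has_cont_grad (\<lambda>x. f x * g x) (\<lambda>x. f x *\<^sub>R G x + g x *\<^sub>R F x)"
  unfolding has_cont_grad_def
proof (intro conjI allI)
  show "continuous_on UNIV (\<lambda>x. f x *\<^sub>R G x + g x *\<^sub>R F x)"
    using assms has_cont_grad_continuous[OF assms(1)] has_cont_grad_continuous[OF assms(2)]
    unfolding has_cont_grad_def by (intro continuous_intros) auto
  show "((\<lambda>x. f x * g x) has_derivative (\<bullet>) (f x *\<^sub>R G x + g x *\<^sub>R F x)) (at x)" for x
    using assms unfolding has_cont_grad_def
    by (auto intro!: derivative_eq_intros simp: fun_eq_iff inner_add_left algebra_simps)
qed

lemma has_cont_grad_diff: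
  assumes "has_cont_grad f F" "has_cont_grad g G"
  shows "has_cont_grad (\<lambda>x. f x - g x) (\<lambda>x. F x - G x)"
  using assms unfolding has_cont_grad_def
    by (auto intro!: derivative_eq_intros continuous_intros simp: fun_eq_iff inner_diff_left)

lemma has_cont_grad_dilation:
  assumes "has_cont_grad f F"
  shows "has_cont_grad (\<lambda>x. f (a + c *\<^sub>R x)) (\<lambda>x. c *\<^sub>R F (a + c *\<^sub>R x))"
  unfolding has_cont_grad_def
proof (intro conjI allI)
  show "continuous_on UNIV (\<lambda>x. c *\<^sub>R F (a + c *\<^sub>R x))"
    using assms unfolding has_cont_grad_def
    by (elim conjE, intro continuous_on_scaleR continuous_on_const, elim continuous_on_compose2)
      (intro continuous_intros, auto)
  fix x
  have "((\<lambda>x. f (a + c *\<^sub>R x)) has_derivative (\<lambda>e. F (a + c *\<^sub>R x) \<bullet> (c *\<^sub>R e))) (at x)"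
  proof (rule has_derivative_compose[where f="\<lambda>x. a + c *\<^sub>R x" and f'="\<lambda>e. c *\<^sub>R e"])
    show "((\<lambda>x. a + c *\<^sub>R x) has_derivative (*\<^sub>R) c) (at x)"
      by (auto intro!: derivative_eq_intros)
    show "(f has_derivative (\<bullet>) (F (a + c *\<^sub>R x))) (at (a + c *\<^sub>R x))"
      using assms unfolding has_cont_grad_def by blast
  qed
  then show "((\<lambda>x. f (a + c *\<^sub>R x)) has_derivative (\<bullet>) (c *\<^sub>R F (a + c *\<^sub>R x))) (at x)"
    by (rule has_derivative_eq_rhs) (auto simp: fun_eq_iff)
qed

text \<open>Squaring removes the kink of the positive part: at zero the difference quotient is at
  most \<open>\<bar>h\<bar>\<close>.\<close>

lemma has_derivative_pos_part_square:
  "((\<lambda>t::real. (max 0 t)\<^sup>2) has_derivative (\<lambda>h. 2 * max 0 t * h)) (at t)"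
proof -
  consider "t < 0" | "t > 0" | "t = 0" by linarith
  then show ?thesis
  proof cases
    case 1
    have "((\<lambda>t::real. 0) has_derivative (\<lambda>h. 2 * max 0 t * h)) (at t)" using 1 by simp
    then show ?thesis
      by (rule has_derivative_transform_within_open[where s="{..<0}"]) (use 1 in auto)
  next
    case 2
    have "((\<lambda>t::real. t\<^sup>2) has_derivative (\<lambda>h. 2 * max 0 t * h)) (at t)"
      using 2 by (auto intro!: derivative_eq_intros)
    then show ?thesis
      by (rule has_derivative_transform_within_open[where s="{0<..}"]) (use 2 in auto)
  next
    case 3
    have "((\<lambda>t::real. (max 0 t)\<^sup>2) has_derivative (\<lambda>h. 0)) (at 0)"
      unfolding has_derivative_at
    proof (intro conjI)
      show "(\<lambda>h::real. norm ((max 0 (0 + h))\<^sup>2 - (max 0 0)\<^sup>2 - 0) / norm h) \<midarrow>0\<rightarrow> 0"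
      proof (rule Lim_null_comparison)
        show "\<forall>\<^sub>F h::real in at 0. norm (norm ((max 0 (0 + h))\<^sup>2 - (max 0 0)\<^sup>2 - 0) / norm h) \<le> \<bar>h\<bar>"
          by (rule always_eventually) (auto simp: max_def power2_eq_square)
        show "((\<lambda>h::real. \<bar>h\<bar>) \<longlongrightarrow> 0) (at 0)" by (auto intro!: tendsto_eq_intros)
      qed
    qed simp
    then show ?thesis using 3 by simp
  qed
qed

section \<open>Mollifiers and mollification\<close>

definition bump :: "real \<Rightarrow> 'a::euclidean_space \<Rightarrow> real" where
  "bump \<epsilon> z = (max 0 (\<epsilon>\<^sup>2 - z \<bullet> z))\<^sup>2"

lemma bump_nonneg: "0 \<le> bump \<epsilon> z" by (simp add: bump_def)

lemma bump_nonzero: "0 < \<epsilon> \<Longrightarrow> bump \<epsilon> z \<noteq> 0 \<longleftrightarrow> norm z < \<epsilon>"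
  unfolding bump_def max_def by (auto simp: norm_lt_square)

text \<open>Test functions need only be continuously differentiable, so a truncated polynomial
  serves as kernel in place of the usual exponential bump. The gradient is the chain rule through
  the squared positive part.\<close>

lemma has_cont_grad_bump:
  "has_cont_grad (bump \<epsilon>) (\<lambda>z::'a::euclidean_space. (- 4 * max 0 (\<epsilon>\<^sup>2 - z \<bullet> z)) *\<^sub>R z)"
  unfolding has_cont_grad_def
proof (intro conjI allI)
  fix z :: 'a
  have "((\<lambda>z. \<epsilon>\<^sup>2 - z \<bullet> z) has_derivative (\<lambda>e. - 2 * (z \<bullet> e))) (at z)"
    by (auto intro!: derivative_eq_intros simp: inner_commute)
  from has_derivative_compose[OF this has_derivative_pos_part_square]
  show "(bump \<epsilon> has_derivative (\<bullet>) ((- 4 * max 0 (\<epsilon>\<^sup>2 - z \<bullet> z)) *\<^sub>R z)) (at z)"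
    unfolding bump_def[abs_def] by (rule has_derivative_eq_rhs) (auto simp: fun_eq_iff)
qed (intro continuous_intros)

lemma integrable_compact_support:
  fixes f :: "'a::euclidean_space \<Rightarrow> 'b::euclidean_space"
  assumes "continuous_on UNIV f" "bounded {x. f x \<noteq> 0}"
  shows "integrable lborel f"
proof -
  obtain R where R: "{x. f x \<noteq> 0} \<subseteq> cbox (-R) R"
    using bounded_subset_cbox_symmetric[OF assms(2)] by auto
  have "set_integrable lborel (cbox (-R) R) f"
    using borel_integrable_compact[OF compact_cbox continuous_on_subset[OF assms(1) subset_UNIV]]
    by (simp add: set_integrable_def indicator_scaleR_eq_if)
  moreover have "(\<lambda>x. indicator (cbox (-R) R) x *\<^sub>R f x) = f"
    using R by (auto simp: indicator_def fun_eq_iff)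
  ultimately show ?thesis unfolding set_integrable_def by simp
qed

definition mollifier :: "real \<Rightarrow> 'a::euclidean_space \<Rightarrow> real" where
  "mollifier \<epsilon> z = bump \<epsilon> z / (LINT y|lborel. bump \<epsilon> (y::'a))"

lemma bump_continuous: "continuous_on UNIV (bump \<epsilon> :: 'a::euclidean_space \<Rightarrow> real)"
  using has_cont_grad_bump has_cont_grad_continuous by blast

lemma bump_integrable: "0 < \<epsilon> \<Longrightarrow> integrable lborel (bump \<epsilon> :: 'a::euclidean_space \<Rightarrow> real)"
  by (rule integrable_compact_support[OF bump_continuous])
    (auto simp: bump_nonzero bounded_iff intro!: exI[of _ \<epsilon>])

text \<open>A nonnegative function with zero integral vanishes almost everywhere, which would make
  the ball of radius \<epsilon> negligible. Positivity is what permits normalising the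
  kernel.\<close>

lemma bump_integral_pos:
  assumes "0 < \<epsilon>"
  shows "0 < (LINT y|lborel. bump \<epsilon> (y::'a::euclidean_space))"
proof -
  have "(LINT y|lborel. bump \<epsilon> (y::'a)) \<noteq> 0"
  proof
    assume "(LINT y|lborel. bump \<epsilon> (y::'a)) = 0"
    then have "AE y in lborel. bump \<epsilon> (y::'a) = 0"
      using integral_nonneg_eq_0_iff_AE[OF bump_integrable[OF assms]] bump_nonneg by auto
    then have "AE y in lborel. (y::'a) \<notin> ball 0 \<epsilon>"
      by eventually_elim (use bump_nonzero[OF assms] in auto)
    then have "ball (0::'a) \<epsilon> \<in> null_sets lborel"
      by (subst AE_iff_null_sets) auto
    then have "negligible (ball (0::'a) \<epsilon>)"
      unfolding negligible_iff_null_sets by (rule null_sets_completionI)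
    then show False
      using assms open_not_negligible[of "ball (0::'a) \<epsilon>"] by auto
  qed
  moreover have "0 \<le> (LINT y|lborel. bump \<epsilon> (y::'a))" by (simp add: bump_nonneg)
  ultimately show ?thesis by linarith
qed

lemma mollifier_nonneg: "0 < \<epsilon> \<Longrightarrow> 0 \<le> mollifier \<epsilon> z"
  unfolding mollifier_def using bump_integral_pos[of \<epsilon>] bump_nonneg
  by (metis divide_nonneg_pos)

lemma mollifier_nonzero: "0 < \<epsilon> \<Longrightarrow> mollifier \<epsilon> z \<noteq> 0 \<Longrightarrow> norm z < \<epsilon>"
  unfolding mollifier_def using bump_nonzero by auto

lemma mollifier_integral: "0 < \<epsilon> \<Longrightarrow> (LINT z|lborel. mollifier \<epsilon> (z::'a::euclidean_space)) = 1"
  unfolding mollifier_def using bump_integral_pos[of \<epsilon>, where ?'a='a] by simp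

lemma mollifier_continuous: "continuous_on UNIV (mollifier \<epsilon> :: 'a::euclidean_space \<Rightarrow> real)"
  unfolding mollifier_def[abs_def] divide_inverse by (intro continuous_intros bump_continuous)

lemma mollifier_integrable: "0 < \<epsilon> \<Longrightarrow> integrable lborel (mollifier \<epsilon> :: 'a::euclidean_space \<Rightarrow> real)"
  unfolding mollifier_def[abs_def] using bump_integrable by auto

lemma has_cont_grad_mollifier: "\<exists>G. has_cont_grad (mollifier \<epsilon> :: 'a::euclidean_space \<Rightarrow> real) G"
proof -
  obtain G where G: "has_cont_grad (bump \<epsilon> :: 'a \<Rightarrow> real) G" using has_cont_grad_bump by blast
  define c where "c = (LINT y|lborel. bump \<epsilon> (y::'a))"
  have "has_cont_grad (mollifier \<epsilon>) (\<lambda>x. (inverse c) *\<^sub>R G x)"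
    using G unfolding mollifier_def[abs_def] has_cont_grad_def c_def[symmetric]
    by (auto intro!: continuous_intros derivative_eq_intros simp: divide_inverse)
  then show ?thesis by blast
qed

text \<open>Convolution with the kernel in the integration variable: the value at \<open>x\<close>
  is a weighted mean of translates of \<open>v\<close>, so estimates on \<open>v\<close> pass to it
  at once. Differentiation uses the substituted form, with the kernel centred at
  \<open>x\<close>.\<close>

definition mollify :: "real \<Rightarrow> ('a::euclidean_space \<Rightarrow> real) \<Rightarrow> 'a \<Rightarrow> real" where
  "mollify \<epsilon> v x = (LINT w|lborel. mollifier \<epsilon> w * v (x - w))"

lemma mollifier_mult_integrable:
  fixes h :: "'a::euclidean_space \<Rightarrow> real"
  assumes "0 < \<epsilon>" "continuous_on UNIV h"
  shows "integrable lborel (\<lambda>w. mollifier \<epsilon> w * h w)"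
proof (rule integrable_compact_support)
  show "continuous_on UNIV (\<lambda>w. mollifier \<epsilon> w * h w)"
    using assms mollifier_continuous by (intro continuous_intros) auto
  have "{w. mollifier \<epsilon> w * h w \<noteq> 0} \<subseteq> ball 0 \<epsilon>" using mollifier_nonzero[OF assms(1)] by auto
  then show "bounded {w. mollifier \<epsilon> w * h w \<noteq> 0}" using bounded_ball bounded_subset by blast
qed

text \<open>The kernel is a probability density supported in the ball of radius \<epsilon>, so only
  the values of \<open>h\<close> there count. Both mollification estimates below are
  instances.\<close>

lemma mollifier_average_bound:
  fixes h :: "'a::euclidean_space \<Rightarrow> real"
  assumes "0 < \<epsilon>" "continuous_on UNIV h" "\<And>w. norm w < \<epsilon> \<Longrightarrow> \<bar>h w\<bar> \<le> \<eta>"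
  shows "\<bar>LINT w|lborel. mollifier \<epsilon> w * h w\<bar> \<le> \<eta>"
proof -
  have "norm (LINT w|lborel. mollifier \<epsilon> w * h w) \<le> (LINT w|lborel. mollifier \<epsilon> (w::'a) * \<eta>)"
  proof (rule Bochner_Integration.integral_norm_bound_integral)
    show "integrable lborel (\<lambda>w. mollifier \<epsilon> (w::'a) * \<eta>)"
      using mollifier_integrable[OF assms(1), where ?'a='a] by simp
    show "norm (mollifier \<epsilon> w * h w) \<le> mollifier \<epsilon> w * \<eta>" for w
      using mollifier_nonzero[OF assms(1), of w] mollifier_nonneg[OF assms(1), of w] assms(3)[of w]
      by (cases "mollifier \<epsilon> w = 0") (auto simp: abs_mult intro!: mult_left_mono)
  qed (rule mollifier_mult_integrable[OF assms(1,2)])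
  then show ?thesis using mollifier_integral[OF assms(1), where ?'a='a] by simp
qed

lemma continuous_reflect:
  "continuous_on UNIV v \<Longrightarrow> continuous_on UNIV (\<lambda>w::'a::real_normed_vector. v (x - w))"
  by (elim continuous_on_compose2) (intro continuous_intros, auto)

lemma lborel_distr_reflect: "distr lborel borel (\<lambda>w. x - w) = (lborel :: 'a::euclidean_space measure)"
  using lborel_affine[of "-1" x] by (simp add: density_1)

lemma mollify_close:
  assumes "0 < \<epsilon>" "continuous_on UNIV v" "\<And>y. dist y x < \<epsilon> \<Longrightarrow> \<bar>v y - a\<bar> \<le> \<eta>"
  shows "\<bar>mollify \<epsilon> v x - a\<bar> \<le> \<eta>"
proof -
  have "mollify \<epsilon> v x - a = mollify \<epsilon> v x - (LINT w|lborel. mollifier \<epsilon> (w::'a) * a)"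
    using mollifier_integral[OF assms(1), where ?'a='a] by simp
  also have "\<dots> = (LINT w|lborel. mollifier \<epsilon> w * v (x - w) - mollifier \<epsilon> w * a)"
    unfolding mollify_def
    by (rule Bochner_Integration.integral_diff[symmetric])
     (use assms mollifier_integrable in
       \<open>auto intro!: mollifier_mult_integrable continuous_reflect\<close>)
  also have "\<dots> = (LINT w|lborel. mollifier \<epsilon> w * (v (x - w) - a))" by (simp add: algebra_simps)
  finally show ?thesis
    using mollifier_average_bound[OF assms(1), of "\<lambda>w. v (x - w) - a" \<eta>]
      assms(3)[of "x - w" for w]
    by (simp add: continuous_reflect[OF assms(2)] continuous_on_diff continuous_on_const dist_norm)
qed

text \<open>Mollification commutes with translation, so an increment of the mean is the mean of the
  increments, and a common linear part \<open>a\<close> survives unchanged. This is what transfers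
  strict differentiability.\<close>

lemma mollify_increment:
  assumes "0 < \<epsilon>" "continuous_on UNIV v"
    and "\<And>w. norm w < \<epsilon> \<Longrightarrow> \<bar>v (y - w) - v (x - w) - a\<bar> \<le> \<eta>"
  shows "\<bar>mollify \<epsilon> v y - mollify \<epsilon> v x - a\<bar> \<le> \<eta>"
proof -
  note int = mollifier_mult_integrable[OF assms(1) continuous_reflect[OF assms(2)]]
  have "mollify \<epsilon> v y - mollify \<epsilon> v x - a
      = mollify \<epsilon> v y - mollify \<epsilon> v x - (LINT w|lborel. mollifier \<epsilon> (w::'a) * a)"
    using mollifier_integral[OF assms(1), where ?'a='a] by simp
  also have "\<dots> = (LINT w|lborel. mollifier \<epsilon> w * v (y - w) - mollifier \<epsilon> w * v (x - w) - mollifier \<epsilon> w * a)"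
    unfolding mollify_def
    using int[of y] int[of x] mollifier_integrable[OF assms(1), where ?'a='a] by simp
  also have "\<dots> = (LINT w|lborel. mollifier \<epsilon> w * (v (y - w) - v (x - w) - a))"
    by (simp add: algebra_simps)
  finally show ?thesis
    using mollifier_average_bound[OF assms(1), of "\<lambda>w. v (y - w) - v (x - w) - a" \<eta>, OF _ assms(3)]
    by (simp add: continuous_reflect[OF assms(2)] continuous_on_diff continuous_on_const)
qed

lemma mollify_nonzero:
  assumes "0 < \<epsilon>" "mollify \<epsilon> v x \<noteq> 0"
  shows "\<exists>y. dist x y < \<epsilon> \<and> v y \<noteq> 0"
proof (rule ccontr)
  assume "\<not> ?thesis"
  then have "(\<lambda>w. mollifier \<epsilon> w * v (x - w)) = (\<lambda>w. 0)"
    using mollifier_nonzero[OF assms(1)] by (force simp: fun_eq_iff dist_norm)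
  then show False using assms(2) unfolding mollify_def by simp
qed

text \<open>The derivative falls on the kernel. After substitution the integral runs over a fixed
  box containing the support of \<open>v\<close>, where the Leibniz rule applies.\<close>

lemma mollify_has_cont_grad:
  fixes v :: "'a::euclidean_space \<Rightarrow> real"
  assumes "0 < \<epsilon>" "continuous_on UNIV v" "bounded {x. v x \<noteq> 0}"
  shows "\<exists>G. has_cont_grad (mollify \<epsilon> v) G"
proof -
  obtain R where R: "{x. v x \<noteq> 0} \<subseteq> cbox (-R) R"
    using bounded_subset_cbox_symmetric[OF assms(3)] by auto
  obtain G where G: "has_cont_grad (mollifier \<epsilon> :: 'a \<Rightarrow> real) G" using has_cont_grad_mollifier by blast
  let ?f = "\<lambda>x y. mollifier \<epsilon> (x - y) * v y"
  have cf: "continuous_on UNIV (?f x)" for x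
    by (intro continuous_on_mult continuous_reflect[OF mollifier_continuous] assms(2))
  have eq: "mollify \<epsilon> v x = integral (cbox (-R) R) (?f x)" for x
  proof -
    \<comment> \<open>Substitution \<open>y = x - w\<close>; Lebesgue measure is invariant under
      this reflection.\<close>
    have "mollify \<epsilon> v x = (LINT y|lborel. ?f x y)"
    proof -
      have "continuous_on UNIV (\<lambda>w. mollifier \<epsilon> w * v (x - w))"
        by (intro continuous_on_mult mollifier_continuous continuous_reflect assms(2))
      then have m: "(\<lambda>w. mollifier \<epsilon> w * v (x - w)) \<in> borel_measurable borel"
        by (rule borel_measurable_continuous_onI)
      have "(LINT w|distr lborel borel (\<lambda>w. x - w). mollifier \<epsilon> w * v (x - w))
          = (LINT y|lborel. mollifier \<epsilon> (x - y) * v (x - (x - y)))"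
        by (rule integral_distr[OF _ m]) simp
      then show ?thesis unfolding lborel_distr_reflect mollify_def by simp
    qed
    also have "\<dots> = (LINT y:cbox (-R) R|lborel. ?f x y)"
      unfolding set_lebesgue_integral_def using R
      by (intro Bochner_Integration.integral_cong) (auto simp: indicator_def)
    also have "\<dots> = integral (cbox (-R) R) (?f x)"
      by (rule set_borel_integral_eq_integral)
        (use borel_integrable_compact[OF compact_cbox continuous_on_subset[OF cf subset_UNIV]] in
          \<open>simp add: set_integrable_def indicator_scaleR_eq_if\<close>)
    finally show ?thesis .
  qed
  define F where "F x y = v y *\<^sub>R blinfun_inner_right (G (x - y))" for x y
  have cG: "continuous_on UNIV (\<lambda>z::'a\<times>'a. G (fst z - snd z))"
    using G unfolding has_cont_grad_def
    by (elim conjE continuous_on_compose2) (intro continuous_intros, auto)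
  have cv: "continuous_on UNIV (\<lambda>z::'a\<times>'a. v (snd z))"
    by (rule continuous_on_compose2[OF assms(2) continuous_on_snd[OF continuous_on_id]]) auto
  have cF: "continuous_on UNIV (\<lambda>(x, y). F x y)"
    unfolding F_def split_beta
    by (rule continuous_on_scaleR[OF cv bounded_linear.continuous_on[OF bounded_linear_blinfun_inner_right cG]])
  have D: "((\<lambda>x. integral (cbox (-R) R) (?f x)) has_derivative integral (cbox (-R) R) (F x)) (at x within UNIV)" for x
  proof (rule leibniz_rule)
    fix x t
    have "((\<lambda>x. mollifier \<epsilon> (x - t)) has_derivative (\<lambda>e. G (x - t) \<bullet> e)) (at x)"
    proof (rule has_derivative_compose[where f="\<lambda>x. x - t" and f'="\<lambda>e. e"])
      show "((\<lambda>x. x - t) has_derivative (\<lambda>e. e)) (at x)"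
        by (auto intro!: derivative_eq_intros)
      show "(mollifier \<epsilon> has_derivative (\<bullet>) (G (x - t))) (at (x - t))"
        using G unfolding has_cont_grad_def by blast
    qed
    from has_derivative_mult_left[OF this, of "v t"]
    show "((\<lambda>x. ?f x t) has_derivative blinfun_apply (F x t)) (at x within UNIV)"
      unfolding F_def by (rule has_derivative_eq_rhs) (auto simp: blinfun.scaleR_left fun_eq_iff)
    show "?f x integrable_on cbox (-R) R"
      using cf continuous_on_subset integrable_continuous by blast
    show "continuous_on (UNIV \<times> cbox (- R) R) (\<lambda>(x, y). F x y)"
      using cF continuous_on_subset by blast
  qed simp_all
  have cI: "continuous_on UNIV (\<lambda>x. integral (cbox (-R) R) (F x))"
    by (rule integral_continuous_on_param, rule continuous_on_subset[OF cF]) auto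
  \<comment> \<open>The integrated derivative is a bounded linear functional; its values on the
    basis are the coordinates of the gradient.\<close>
  define H where "H x = (\<Sum>b\<in>Basis. blinfun_apply (integral (cbox (-R) R) (F x)) b *\<^sub>R b)" for x
  have H: "blinfun_apply (integral (cbox (-R) R) (F x)) e = H x \<bullet> e" for x e
  proof -
    have "blinfun_apply (integral (cbox (-R) R) (F x)) (\<Sum>b\<in>Basis. (e \<bullet> b) *\<^sub>R b) = H x \<bullet> e"
      unfolding H_def
      by (simp add: blinfun.sum_right blinfun.scaleR_right inner_sum_left inner_commute[of e] mult.commute
          del: euclidean_representation)
    then show ?thesis by (simp add: euclidean_representation)
  qed
  have "has_cont_grad (mollify \<epsilon> v) H"
    unfolding has_cont_grad_def
  proof (intro conjI allI)
    show "continuous_on UNIV H" unfolding H_def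
      by (intro continuous_intros cI)
    show "(mollify \<epsilon> v has_derivative (\<bullet>) (H x)) (at x)" for x
      using D[of x] unfolding eq[abs_def] H[abs_def] .
  qed
  then show ?thesis by blast
qed

section \<open>Weak gradients\<close>

text \<open>Smooth inner approximations of the indicator of an open set, obtained by truncating the
  distance to the complement and mollifying at a matching scale.\<close>

lemma cutoff_sequence:
  fixes A :: "'a::euclidean_space set"
  assumes "open A" "bounded A"
  obtains \<psi> :: "nat \<Rightarrow> 'a \<Rightarrow> real"
  where "\<And>n. test_function A (\<psi> n)" "\<And>n x. 0 \<le> \<psi> n x \<and> \<psi> n x \<le> 1"
    "\<And>x. (\<lambda>n. \<psi> n x) \<longlonglongrightarrow> indicator A x"
proof -
  define d where "d x = infdist x (- A)" for x
  \<comment> \<open>Distances are measured in units of \<open>1 / (n + 1)\<close>: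
    \<open>f n\<close> is 0 up to distance 2 and 1 from distance 3 on. Mollification over one unit
    shifts distances by less than 1, so the support keeps distance at least 1, and the value is 1
    where the distance exceeds 4.\<close>
  define f where "f n x = min 1 (max 0 (real (Suc n) * d x - 2))" for n x
  define \<psi> where "\<psi> n = mollify (1 / real (Suc n)) (f n)" for n
  have d_lip: "d y \<le> d x + dist x y" for x y
    unfolding d_def by (metis add.commute dist_commute infdist_triangle)
  have d_out: "d x = 0" if "x \<notin> A" for x using that unfolding d_def by simp
  \<comment> \<open>\<open>infdist\<close> to the empty set is 0 by convention, which would make
    \<open>d\<close> vanish everywhere; a bounded set has a nonempty complement.\<close>
  have ne: "- A \<noteq> {}" using assms(2) not_bounded_UNIV by (metis Compl_empty_eq double_compl)
  have d_in: "d x > 0" if "x \<in> A" for x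
    unfolding d_def using infdist_pos_not_in_closed[of "- A" x] assms(1) ne that by auto
  have cd: "continuous_on UNIV d" unfolding d_def by (intro continuous_intros)
  have cf: "continuous_on UNIV (f n)" for n unfolding f_def by (intro continuous_intros cd)
  have fA: "{x. f n x \<noteq> 0} \<subseteq> A" for n using d_out unfolding f_def by force
  have bf: "bounded {x. f n x \<noteq> 0}" for n using fA assms(2) bounded_subset by blast
  have e: "0 < 1 / real (Suc n)" for n by simp
  have supp: "1 / real (Suc n) \<le> d x" if "\<psi> n x \<noteq> 0" for n x
  proof -
    obtain y where y: "dist x y < 1 / real (Suc n)" "f n y \<noteq> 0"
      using mollify_nonzero[OF e] \<open>\<psi> n x \<noteq> 0\<close> unfolding \<psi>_def by blast
    then have "real (Suc n) * d y > 2" unfolding f_def by (auto simp: max_def min_def split: if_splits)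
    then have "d y > 2 / real (Suc n)" by (simp add: field_simps)
    moreover have "2 / real (Suc n) = 1 / real (Suc n) + 1 / real (Suc n)" by simp
    ultimately show ?thesis using d_lip[of y x] y(1) by linarith
  qed
  have "test_function A (\<psi> n)" for n
  proof -
    have sub: "{x. 1 / real (Suc n) \<le> d x} \<subseteq> A" using d_out e[of n] by force
    have "closed {x. 1 / real (Suc n) \<le> d x}" by (rule closed_Collect_le[OF continuous_on_const cd])
    then have "compact {x. 1 / real (Suc n) \<le> d x}"
      using bounded_subset[OF assms(2) sub] by (simp add: compact_eq_bounded_closed)
    moreover obtain G where "has_cont_grad (\<psi> n) G"
      using mollify_has_cont_grad[OF e cf bf] unfolding \<psi>_def by blast
    ultimately show ?thesis using supp sub by (intro test_functionI_compact) auto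
  qed
  moreover have "0 \<le> \<psi> n x \<and> \<psi> n x \<le> 1" for n x
  proof -
    \<comment> \<open>A single closeness estimate around the midpoint yields both bounds.\<close>
    have "\<bar>\<psi> n x - 1/2\<bar> \<le> 1/2" unfolding \<psi>_def
      by (rule mollify_close[OF e cf]) (auto simp: f_def abs_if min_def max_def)
    then show ?thesis by linarith
  qed
  moreover have "(\<lambda>n. \<psi> n x) \<longlonglongrightarrow> indicator A x" for x
  proof (cases "x \<in> A")
    case False
    then have "\<psi> n x = 0" for n using supp[of n x] d_out e[of n] by (metis linorder_not_less)
    then show ?thesis using False by simp
  next
    case True
    obtain m :: nat where m: "4 / d x < real m" using reals_Archimedean2 by blast
    have "\<psi> n x = 1" if "n \<ge> m" for n
    proof -
      have "4 < real m * d x" using m d_in[OF True] by (simp add: field_simps)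
      also have "\<dots> \<le> real (Suc n) * d x" using that d_in[OF True] by (intro mult_right_mono) auto
      finally have big: "4 < real (Suc n) * d x" .
      have "f n y = 1" if "dist y x < 1 / real (Suc n)" for y
      proof -
        have "real (Suc n) * d x \<le> real (Suc n) * (d y + dist y x)"
          using d_lip[of x y] by (intro mult_left_mono) auto
        also have "\<dots> = real (Suc n) * d y + real (Suc n) * dist y x" by (simp only: distrib_left)
        finally show ?thesis using big that
          unfolding f_def by (simp add: field_simps del: of_nat_Suc)
      qed
      then have "\<bar>\<psi> n x - 1\<bar> \<le> 0" unfolding \<psi>_def by (intro mollify_close[OF e cf]) auto
      then show ?thesis by simp
    qed
    then have "\<forall>\<^sub>F n in sequentially. \<psi> n x = 1" using eventually_sequentially by auto
    then show ?thesis using True by (simp add: tendsto_eventually)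
  qed
  ultimately show thesis using that by blast
qed

lemma test_function_continuous: "test_function U f \<Longrightarrow> continuous_on UNIV f"
  using has_cont_grad_continuous test_function_iff by blast

lemma test_function_bounded_support: "test_function U f \<Longrightarrow> bounded {x. f x \<noteq> 0}"
  unfolding test_function_def using bounded_subset closure_subset compact_imp_bounded by metis

lemma test_function_outside: "test_function U f \<Longrightarrow> x \<notin> U \<Longrightarrow> f x = 0"
  unfolding test_function_def using closure_subset[of "{x. f x \<noteq> 0}"] by auto

lemma test_function_mono: "test_function U f \<Longrightarrow> U \<subseteq> V \<Longrightarrow> test_function V f"
  unfolding test_function_def by blast

text \<open>Testing against cutoffs of \<open>A \<inter> U\<close> and passing to the limit gives
  zero integral over every open \<open>A\<close>. Open sets are stable under intersection and
  generate the Borel sets, so the integral vanishes over every Borel set.\<close>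

lemma fundamental_lemma:
  fixes g :: "'a::euclidean_space \<Rightarrow> real"
  assumes U: "open U" "bounded U" and g: "integrable lborel g" "\<And>x. x \<notin> U \<Longrightarrow> g x = 0"
    and 0: "\<And>\<psi>. test_function U \<psi> \<Longrightarrow> (LINT x|lborel. g x * \<psi> x) = 0"
  shows "AE x in lborel. g x = 0"
proof -
  have gm[measurable]: "g \<in> borel_measurable borel" using g(1) by auto
  have open0: "set_lebesgue_integral lborel A g = 0" if "open A" for A
  proof -
    have o: "open (A \<inter> U)" "bounded (A \<inter> U)" using that U by (auto intro: bounded_subset)
    obtain \<psi> where \<psi>: "\<And>n. test_function (A \<inter> U) (\<psi> n)" "\<And>n x. 0 \<le> \<psi> n x \<and> \<psi> n x \<le> 1"
      "\<And>x. (\<lambda>n. \<psi> n x) \<longlonglongrightarrow> indicator (A \<inter> U) x" using cutoff_sequence[OF o] by metis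
    have "(\<lambda>n. LINT x|lborel. g x * \<psi> n x) \<longlonglongrightarrow> (LINT x|lborel. g x * indicator (A \<inter> U) x)"
    proof (rule integral_dominated_convergence[where w="\<lambda>x. norm (g x)"])
      show "(\<lambda>x. g x * indicat_real (A \<inter> U) x) \<in> borel_measurable lborel"
        using o(1) by (intro borel_measurable_times borel_measurable_indicator) (use gm in auto)
      show "(\<lambda>x. g x * \<psi> n x) \<in> borel_measurable lborel" for n
        using borel_measurable_continuous_onI[OF test_function_continuous[OF \<psi>(1)]] by measurable
      show "AE x in lborel. (\<lambda>n. g x * \<psi> n x) \<longlonglongrightarrow> g x * indicator (A \<inter> U) x"
        using \<psi>(3) by (auto intro!: tendsto_mult)
      show "AE x in lborel. norm (g x * \<psi> n x) \<le> norm (g x)" for n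
        using \<psi>(2)[of n] by (auto simp: abs_mult intro!: mult_left_le)
    qed (use g in auto)
    moreover have "(LINT x|lborel. g x * \<psi> n x) = 0" for n
      using 0 test_function_mono[OF \<psi>(1)] by blast
    ultimately have "(LINT x|lborel. g x * indicator (A \<inter> U) x) = 0"
      using LIMSEQ_unique[OF _ tendsto_const] by simp
    moreover have "g x * indicator (A \<inter> U) x = indicator A x *\<^sub>R g x" for x
      using g(2) by (auto simp: indicator_def)
    ultimately show ?thesis unfolding set_lebesgue_integral_def by simp
  qed
  show ?thesis
  proof (rule sigma_finite_measure.density_zero[OF sigma_finite_lborel g(1)])
    fix A :: "'a set" assume "A \<in> sets lborel"
    then have A: "A \<in> sigma_sets UNIV {S. open S}" by (simp add: borel_def)
    have "A \<in> sets borel \<and> set_lebesgue_integral lborel A g = 0"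
    proof (rule sigma_sets_induct_disjoint[OF _ _ A])
      show "Int_stable {S::'a set. open S}" by (auto simp: Int_stable_def)
      show "B \<in> sets borel \<and> set_lebesgue_integral lborel B g = 0" if "B \<in> {S. open S}" for B
        using that open0 by auto
      show "UNIV - B \<in> sets borel \<and> set_lebesgue_integral lborel (UNIV - B) g = 0"
        if "B \<in> sets borel \<and> set_lebesgue_integral lborel B g = 0" for B
      proof -
        have B: "B \<in> sets lborel" using that by simp
        have i: "integrable lborel (\<lambda>x. indicator B x *\<^sub>R g x)"
          by (rule integrable_mult_indicator[OF B g(1)])
        have "(LINT x|lborel. indicator (UNIV - B) x *\<^sub>R g x) = (LINT x|lborel. g x - indicator B x *\<^sub>R g x)"
          by (intro Bochner_Integration.integral_cong) (auto simp: indicator_def)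
        also have "\<dots> = (LINT x|lborel. g x) - (LINT x|lborel. indicator B x *\<^sub>R g x)"
          using g(1) i by (rule Bochner_Integration.integral_diff)
        finally show ?thesis using that open0[of UNIV] unfolding set_lebesgue_integral_def by auto
      qed
      fix B :: "nat \<Rightarrow> 'a set"
      assume d: "disjoint_family B"
        and B: "\<And>i. B i \<in> sets borel \<and> set_lebesgue_integral lborel (B i) g = 0"
      have "(\<Union>i. B i) \<in> sets lborel" using B by auto
      then have "set_integrable lborel (\<Union>i. B i) g"
        unfolding set_integrable_def using g(1) by (rule integrable_mult_indicator)
      then have "set_lebesgue_integral lborel (\<Union>i. B i) g = (\<Sum>i. set_lebesgue_integral lborel (B i) g)"
        using B d by (intro lebesgue_integral_countable_add) (auto simp: disjoint_family_on_def)
      then show "(\<Union>i. B i) \<in> sets borel \<and> set_lebesgue_integral lborel (\<Union>i. B i) g = 0"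
        using B by auto
    qed (auto simp: set_lebesgue_integral_def)
    then show "set_lebesgue_integral lborel A g = 0" by blast
  qed
qed

section \<open>Mean value inequality and integration by parts\<close>

lemma has_cont_grad_outside:
  assumes "has_cont_grad f F" "x \<notin> closure {x. f x \<noteq> 0}"
  shows "F x = 0"
proof -
  have "((\<lambda>x. 0) has_derivative (\<lambda>e. 0)) (at x)" by simp
  then have "(f has_derivative (\<lambda>e. 0)) (at x)"
    by (rule has_derivative_transform_within_open[where s="- closure {x. f x \<noteq> 0}"])
      (use assms(2) closure_subset[of "{x. f x \<noteq> 0}"] in \<open>auto simp: open_Compl\<close>)
  moreover have "(f has_derivative (\<lambda>e. F x \<bullet> e)) (at x)" using assms(1) unfolding has_cont_grad_def by blast
  ultimately have "(\<lambda>e. F x \<bullet> e) = (\<lambda>e. 0)" using has_derivative_unique by blast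
  then show ?thesis by (metis inner_eq_zero_iff)
qed

text \<open>Mean value inequality for \<open>f\<close> minus a linear function. With
  \<open>g = 0\<close> it yields Lipschitz bounds, with \<open>g = F x\<close> strict
  differentiability.\<close>

lemma increment_bound_of_grad_bound:
  fixes f :: "'a::euclidean_space \<Rightarrow> real"
  assumes f: "has_cont_grad f F" and K: "convex K" and B: "\<And>x. x \<in> K \<Longrightarrow> norm (F x - g) \<le> B"
    and xy: "x \<in> K" "y \<in> K"
  shows "\<bar>f x - f y - g \<bullet> (x - y)\<bar> \<le> B * norm (x - y)"
proof -
  have "norm ((f x - g \<bullet> x) - (f y - g \<bullet> y)) \<le> B * norm (x - y)"
  proof (rule differentiable_bound[OF K _ _ xy, where f'="\<lambda>x e. (F x - g) \<bullet> e"])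
    show "((\<lambda>x. f x - g \<bullet> x) has_derivative (\<bullet>) (F z - g)) (at z within K)" for z
    proof -
      have "(f has_derivative (\<lambda>e. F z \<bullet> e)) (at z within K)"
        using f unfolding has_cont_grad_def by (blast intro: has_derivative_at_withinI)
      then show ?thesis by (auto intro!: derivative_eq_intros simp: inner_diff_left fun_eq_iff)
    qed
    show "onorm ((\<bullet>) (F z - g)) \<le> B" if "z \<in> K" for z
    proof (rule onorm_le)
      show "norm ((F z - g) \<bullet> e) \<le> B * norm e" for e
        using Cauchy_Schwarz_ineq2[of "F z - g" e] mult_right_mono[OF B[OF that] norm_ge_zero[of e]] by simp
    qed
  qed
  then show ?thesis by (simp add: inner_diff_right algebra_simps)
qed

lemma has_cont_grad_line:
  assumes "has_cont_grad f F"
  shows "((\<lambda>t. f (x + t *\<^sub>R e)) has_real_derivative (F (x + t *\<^sub>R e) \<bullet> e)) (at t within A)"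
proof -
  have "((\<lambda>t. f (x + t *\<^sub>R e)) has_derivative (\<lambda>h. F (x + t *\<^sub>R e) \<bullet> (h *\<^sub>R e))) (at t within A)"
  proof (rule has_derivative_compose[where f="\<lambda>t. x + t *\<^sub>R e" and f'="\<lambda>h. h *\<^sub>R e"])
    show "((\<lambda>t. x + t *\<^sub>R e) has_derivative (\<lambda>h. h *\<^sub>R e)) (at t within A)"
      by (auto intro!: derivative_eq_intros)
    show "(f has_derivative (\<bullet>) (F (x + t *\<^sub>R e))) (at (x + t *\<^sub>R e))"
      using assms unfolding has_cont_grad_def by blast
  qed
  then show ?thesis
    unfolding has_field_derivative_def by (rule has_derivative_eq_rhs) (auto simp: fun_eq_iff)
qed

lemma has_cont_grad_directional:
  assumes "has_cont_grad f F"
  shows "((\<lambda>t. (f (x + t *\<^sub>R e) - f x) / t) \<longlongrightarrow> F x \<bullet> e) (at 0)"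
  using has_cont_grad_line[OF assms, of x e 0 UNIV] unfolding DERIV_def by simp

lemma integral_translate:
  fixes f :: "'a::euclidean_space \<Rightarrow> real"
  assumes "continuous_on UNIV f"
  shows "(LINT x|lborel. f (a + x)) = (LINT x|lborel. f x)"
proof -
  have "(LINT x|distr lborel borel ((+) a). f x) = (LINT x|lborel. f (a + x))"
    by (rule integral_distr) (auto intro: borel_measurable_continuous_onI[OF assms])
  then show ?thesis by (simp add: lborel_distr_plus)
qed

text \<open>The integral of a difference quotient vanishes by translation invariance of Lebesgue
  measure, and the quotients converge to the directional derivative under a common dominating
  function.\<close>

lemma has_cont_grad_integral_zero:
  fixes f :: "'a::euclidean_space \<Rightarrow> real"
  assumes f: "has_cont_grad f F" and b: "bounded {x. f x \<noteq> 0}"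
  shows "(LINT x|lborel. F x \<bullet> e) = 0"
proof -
  have cf: "continuous_on UNIV f" using has_cont_grad_continuous[OF f] .
  have cF: "continuous_on UNIV F" using f unfolding has_cont_grad_def by blast
  obtain R where R: "\<And>x. f x \<noteq> 0 \<Longrightarrow> norm x \<le> R" using b unfolding bounded_iff by auto
  have supp: "closure {x. f x \<noteq> 0} \<subseteq> cball 0 R" by (rule closure_minimal) (use R in auto)
  have "compact (F ` cball 0 R)"
    by (intro compact_continuous_image continuous_on_subset[OF cF]) auto
  then have "bounded (F ` cball 0 R)" by (rule compact_imp_bounded)
  then obtain B0 where B0: "\<And>x. x \<in> cball 0 R \<Longrightarrow> norm (F x) \<le> B0"
    unfolding bounded_iff by blast
  define B where "B = max B0 0"
  have B: "norm (F x) \<le> B" for x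
  proof (cases "x \<in> cball 0 R")
    case False
    then have "F x = 0" using has_cont_grad_outside[OF f] supp by blast
    then show ?thesis unfolding B_def by simp
  qed (use B0[of x] in \<open>auto simp: B_def\<close>)
  have B_nn: "0 \<le> B" unfolding B_def by simp
  define h where "h n = inverse (real (Suc n))" for n
  have h: "0 < h n" "h n \<le> 1" for n unfolding h_def by (auto simp: field_simps)
  define q where "q n x = (f (h n *\<^sub>R e + x) - f x) / h n" for n x
  have cq: "continuous_on UNIV (\<lambda>x. f (h n *\<^sub>R e + x))" for n
    using cf by (elim continuous_on_compose2) (intro continuous_intros, auto)
  have if0: "integrable lborel f" by (rule integrable_compact_support[OF cf b])
  have iq: "integrable lborel (\<lambda>x. f (h n *\<^sub>R e + x))" for n
  proof (rule integrable_compact_support[OF cq])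
    have "{x. f (h n *\<^sub>R e + x) \<noteq> 0} \<subseteq> (\<lambda>x. x - h n *\<^sub>R e) ` {x. f x \<noteq> 0}"
    proof
      fix x assume "x \<in> {x. f (h n *\<^sub>R e + x) \<noteq> 0}"
      then show "x \<in> (\<lambda>x. x - h n *\<^sub>R e) ` {x. f x \<noteq> 0}"
        by (intro image_eqI[of _ _ "h n *\<^sub>R e + x"]) auto
    qed
    then show "bounded {x. f (h n *\<^sub>R e + x) \<noteq> 0}"
      using bounded_translation_minus[OF b] bounded_subset by blast
  qed
  have q0: "(LINT x|lborel. q n x) = 0" for n
    unfolding q_def using integral_translate[OF cf, of "h n *\<^sub>R e"] if0 iq[of n] by simp
  have "(\<lambda>n. LINT x|lborel. q n x) \<longlonglongrightarrow> (LINT x|lborel. F x \<bullet> e)"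
  \<comment> \<open>The mean value bound limits the quotient by \<open>B * norm e\<close>. As
    \<open>h n \<le> 1\<close>, the shift moves the support by at most
    \<open>norm e\<close>.\<close>
  proof (rule integral_dominated_convergence[where w="\<lambda>x. B * norm e * indicator (cball 0 (R + norm e)) x"])
    have "continuous_on UNIV (\<lambda>x. F x \<bullet> e)" by (intro continuous_intros cF)
    then show "(\<lambda>x. F x \<bullet> e) \<in> borel_measurable lborel" by (simp add: borel_measurable_continuous_onI)
    have "continuous_on UNIV (q n)" for n
      unfolding q_def using h(1)[of n] by (intro continuous_intros cq cf) auto
    then show "q n \<in> borel_measurable lborel" for n by (simp add: borel_measurable_continuous_onI)
    show "integrable lborel (\<lambda>x. B * norm e * indicator (cball 0 (R + norm e)) x)"
      by (intro integrable_mult_right integrable_real_indicator) (use emeasure_bounded_finite[OF bounded_cball] in auto)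
    show "AE x in lborel. norm (q n x) \<le> B * norm e * indicator (cball 0 (R + norm e)) x" for n
    proof (rule AE_I2)
      fix x
      show "norm (q n x) \<le> B * norm e * indicator (cball 0 (R + norm e)) x"
      proof (cases "x \<in> cball 0 (R + norm e)")
        case True
        have "\<bar>f (h n *\<^sub>R e + x) - f x\<bar> \<le> B * (h n * norm e)"
          using increment_bound_of_grad_bound[OF f convex_UNIV, of 0 B "h n *\<^sub>R e + x" x] B h(1)[of n] by simp
        then show ?thesis using True h(1)[of n] unfolding q_def by (simp add: abs_divide field_simps)
      next
        case False
        then have x: "norm x > R + norm e" by simp
        have "norm (h n *\<^sub>R e) \<le> norm e" using h[of n] by (simp add: mult_left_le_one_le)
        then have "norm (h n *\<^sub>R e + x) > R" using x norm_diff_ineq[of x "h n *\<^sub>R e"] by (simp add: add.commute)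
        then have "f (h n *\<^sub>R e + x) = 0" "f x = 0" 
          using R[of "h n *\<^sub>R e + x"] R[of x] x norm_ge_zero[of e] by linarith+
        then show ?thesis using False unfolding q_def by simp
      qed
    qed
    show "AE x in lborel. (\<lambda>n. q n x) \<longlonglongrightarrow> F x \<bullet> e"
    proof (rule AE_I2)
      fix x
      have "filterlim h (at 0) sequentially"
        unfolding filterlim_at using h LIMSEQ_inverse_real_of_nat
        by (auto simp: h_def[abs_def])
      from filterlim_compose[OF has_cont_grad_directional[OF f] this] show "(\<lambda>n. q n x) \<longlonglongrightarrow> F x \<bullet> e"
        unfolding q_def by (simp add: add.commute)
    qed
  qed
  then show ?thesis unfolding q0 using LIMSEQ_unique tendsto_const by blast
qed

section \<open>Square-integrable functions and weak gradients\<close>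

lemma square_integrable_on_iff:
  "square_integrable_on U f \<longleftrightarrow>
    (\<lambda>x. indicator U x *\<^sub>R f x) \<in> borel_measurable lborel \<and>
    integrable lborel (\<lambda>x. (norm (indicator U x *\<^sub>R f x))\<^sup>2)"
proof -
  have "(\<lambda>x. indicat_real U x *\<^sub>R (norm (f x))\<^sup>2) = (\<lambda>x. (norm (indicat_real U x *\<^sub>R f x))\<^sup>2)"
    by (auto simp: indicator_def)
  then show ?thesis
    unfolding square_integrable_on_def set_borel_measurable_def set_integrable_def by simp
qed

text \<open>A quadratic substitute for the triangle inequality, from
  \<open>2 * a * b \<le> a^2 + b^2\<close>. It can be integrated pointwise; the numerical factors of
  later constants come from such estimates.\<close>

lemma norm_lincomb_square_le:
  fixes x y :: "'a::real_normed_vector"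
  shows "(norm (a *\<^sub>R x + b *\<^sub>R y))\<^sup>2 \<le> 2 * a\<^sup>2 * (norm x)\<^sup>2 + 2 * b\<^sup>2 * (norm y)\<^sup>2"
proof -
  have "(norm (a *\<^sub>R x + b *\<^sub>R y))\<^sup>2 \<le> (norm (a *\<^sub>R x) + norm (b *\<^sub>R y))\<^sup>2"
    by (intro power_mono norm_triangle_ineq) auto
  also have "\<dots> \<le> 2 * (norm (a *\<^sub>R x))\<^sup>2 + 2 * (norm (b *\<^sub>R y))\<^sup>2"
    using sum_squares_bound[of "norm (a *\<^sub>R x)" "norm (b *\<^sub>R y)"] by (simp add: power2_sum)
  finally show ?thesis by (simp add: power_mult_distrib)
qed

lemma square_integrable_on_lincomb:
  assumes "square_integrable_on U f" "square_integrable_on U g"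
  shows "square_integrable_on U (\<lambda>x. a *\<^sub>R f x + b *\<^sub>R g x)"
proof -
  let ?F = "\<lambda>x. indicator U x *\<^sub>R f x" and ?G = "\<lambda>x. indicator U x *\<^sub>R g x"
  have eq: "indicat_real U x *\<^sub>R (a *\<^sub>R f x + b *\<^sub>R g x) = a *\<^sub>R ?F x + b *\<^sub>R ?G x" for x
    by (simp add: scaleR_add_right mult.commute)
  have m[measurable]: "?F \<in> borel_measurable lborel" "?G \<in> borel_measurable lborel"
    and i: "integrable lborel (\<lambda>x. (norm (?F x))\<^sup>2)" "integrable lborel (\<lambda>x. (norm (?G x))\<^sup>2)"
    using assms unfolding square_integrable_on_iff by blast+
  show ?thesis
    unfolding square_integrable_on_iff eq
  proof
    show "integrable lborel (\<lambda>x. (norm (a *\<^sub>R ?F x + b *\<^sub>R ?G x))\<^sup>2)"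
    proof (rule Bochner_Integration.integrable_bound)
      show "integrable lborel (\<lambda>x. 2 * a\<^sup>2 * (norm (?F x))\<^sup>2 + 2 * b\<^sup>2 * (norm (?G x))\<^sup>2)"
        by (intro Bochner_Integration.integrable_add integrable_mult_right i)
      show "AE x in lborel. norm ((norm (a *\<^sub>R ?F x + b *\<^sub>R ?G x))\<^sup>2)
          \<le> norm (2 * a\<^sup>2 * (norm (?F x))\<^sup>2 + 2 * b\<^sup>2 * (norm (?G x))\<^sup>2)"
        unfolding real_norm_def abs_power2
        by (rule AE_I2, rule order_trans[OF norm_lincomb_square_le abs_ge_self])
    qed measurable
  qed measurable
qed

definition L2_functions :: "'a measure \<Rightarrow> ('a \<Rightarrow> real) set" where
  "L2_functions M = {q \<in> borel_measurable M. integrable M (\<lambda>x. (q x)\<^sup>2)}"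

lemma L2_mult_integrable:
  assumes "u \<in> L2_functions M" "v \<in> L2_functions M"
  shows "integrable M (\<lambda>x. u x * v x)"
proof (rule Bochner_Integration.integrable_bound)
  have m[measurable]: "u \<in> borel_measurable M" "v \<in> borel_measurable M"
    and i: "integrable M (\<lambda>x. (u x)\<^sup>2)" "integrable M (\<lambda>x. (v x)\<^sup>2)"
    using assms unfolding L2_functions_def by auto
  show "integrable M (\<lambda>x. (u x)\<^sup>2 + (v x)\<^sup>2)" using i by simp
  show "(\<lambda>x. u x * v x) \<in> borel_measurable M" by measurable
  show "AE x in M. norm (u x * v x) \<le> norm ((u x)\<^sup>2 + (v x)\<^sup>2)"
  proof (rule AE_I2)
    fix x
    have "2 * \<bar>u x\<bar> * \<bar>v x\<bar> \<le> \<bar>u x\<bar>\<^sup>2 + \<bar>v x\<bar>\<^sup>2" by (rule sum_squares_bound)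
    moreover have "0 \<le> \<bar>u x\<bar> * \<bar>v x\<bar>" by simp
    ultimately have "\<bar>u x\<bar> * \<bar>v x\<bar> \<le> \<bar>u x\<bar>\<^sup>2 + \<bar>v x\<bar>\<^sup>2" by linarith
    then show "norm (u x * v x) \<le> norm ((u x)\<^sup>2 + (v x)\<^sup>2)" by (simp add: abs_mult)
  qed
qed

lemma square_integrable_on_mult:
  fixes f g :: "'a::euclidean_space \<Rightarrow> real"
  assumes "square_integrable_on U f" "square_integrable_on U g"
  shows "set_integrable lborel U (\<lambda>x. f x * g x)"
proof -
  have "(\<lambda>x. indicator U x *\<^sub>R f x) \<in> L2_functions lborel" "(\<lambda>x. indicator U x *\<^sub>R g x) \<in> L2_functions lborel"
    using assms unfolding square_integrable_on_iff L2_functions_def by auto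
  from L2_mult_integrable[OF this] show ?thesis
    unfolding set_integrable_def by (rule Bochner_Integration.integrable_cong[THEN iffD1, rotated 2])
      (auto simp: indicator_def)
qed

lemma square_integrable_on_inner:
  assumes "square_integrable_on U g"
  shows "square_integrable_on U (\<lambda>x. g x \<bullet> e)"
proof -
  let ?G = "\<lambda>x. indicator U x *\<^sub>R g x"
  have eq: "indicat_real U x *\<^sub>R (g x \<bullet> e) = ?G x \<bullet> e" for x by simp
  have m[measurable]: "?G \<in> borel_measurable lborel" and i: "integrable lborel (\<lambda>x. (norm (?G x))\<^sup>2)"
    using assms unfolding square_integrable_on_iff by blast+
  show ?thesis
    unfolding square_integrable_on_iff eq
  proof
    show "integrable lborel (\<lambda>x. (norm (?G x \<bullet> e))\<^sup>2)"
    proof (rule Bochner_Integration.integrable_bound)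
      show "integrable lborel (\<lambda>x. (norm e)\<^sup>2 * (norm (?G x))\<^sup>2)" by (intro integrable_mult_right i)
      have "(norm (?G x \<bullet> e))\<^sup>2 \<le> (norm e)\<^sup>2 * (norm (?G x))\<^sup>2" for x
        using power_mono[OF Cauchy_Schwarz_ineq2[of "?G x" e], of 2] by (simp add: power_mult_distrib mult.commute)
      then show "AE x in lborel. norm ((norm (?G x \<bullet> e))\<^sup>2) \<le> norm ((norm e)\<^sup>2 * (norm (?G x))\<^sup>2)"
        by (intro AE_I2) (metis abs_of_nonneg mult_nonneg_nonneg real_norm_def zero_le_power2)
    qed measurable
  qed measurable
qed

lemma square_integrable_on_continuous:
  fixes f :: "'a::euclidean_space \<Rightarrow> 'b::euclidean_space"
  assumes "open U" "continuous_on UNIV f" "bounded {x. f x \<noteq> 0}"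
  shows "square_integrable_on U f"
proof -
  have m[measurable]: "f \<in> borel_measurable borel" "U \<in> sets borel"
    using assms by (auto intro: borel_measurable_continuous_onI)
  have "integrable lborel (\<lambda>x. (norm (f x))\<^sup>2)"
    by (rule integrable_compact_support) (use assms in \<open>auto intro!: continuous_intros\<close>)
  from integrable_mult_indicator[OF _ this, of U]
  show ?thesis unfolding square_integrable_on_def set_borel_measurable_def set_integrable_def
    by simp
qed

lemma grad_bounded_support:
  assumes "test_function U f"
  shows "bounded {x. grad f x \<noteq> 0}"
proof -
  have f: "has_cont_grad f (grad f)" "compact (closure {x. f x \<noteq> 0})" using assms test_function_iff by blast+
  have "{x. grad f x \<noteq> 0} \<subseteq> closure {x. f x \<noteq> 0}" using has_cont_grad_outside[OF f(1)] by blast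
  then show ?thesis using compact_imp_bounded[OF f(2)] bounded_subset by blast
qed

lemma grad_outside: "test_function U f \<Longrightarrow> x \<notin> U \<Longrightarrow> grad f x = 0"
  using has_cont_grad_outside test_function_iff by blast

lemma grad_continuous: "test_function U f \<Longrightarrow> continuous_on UNIV (grad f)"
  unfolding test_function_iff has_cont_grad_def by blast

lemma test_function_frechet: "test_function U f \<Longrightarrow> frechet_derivative f (at x) e = grad f x \<bullet> e"
  unfolding test_function_iff using has_cont_grad_frechet by blast

lemma test_function_square_integrable:
  assumes "open U" "test_function V f"
  shows "square_integrable_on U f" "square_integrable_on U (grad f)"
  using square_integrable_on_continuous[OF assms(1)] assms(2) test_function_continuous
    test_function_bounded_support grad_continuous grad_bounded_support by blast+

text \<open>The product of the two test functions has bounded support, so each of its directional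
  derivatives integrates to zero; the product rule splits that integral into the two sides of the
  weak identity.\<close>

lemma is_weak_gradient_test_function:
  assumes "open U" and \<phi>: "test_function U \<phi>"
  shows "is_weak_gradient U \<phi> (grad \<phi>)"
  unfolding is_weak_gradient_def
proof (intro conjI allI impI ballI)
  show "square_integrable_on U (grad \<phi>)" using test_function_square_integrable assms by blast
  fix \<psi> e assume \<psi>: "test_function U \<psi>"
  have c: "has_cont_grad (\<lambda>x. \<phi> x * \<psi> x) (\<lambda>x. \<phi> x *\<^sub>R grad \<psi> x + \<psi> x *\<^sub>R grad \<phi> x)"
    using \<phi> \<psi> has_cont_grad_mult test_function_iff by blast
  have "{x. \<phi> x * \<psi> x \<noteq> 0} \<subseteq> {x. \<phi> x \<noteq> 0}" by auto
  then have b: "bounded {x. \<phi> x * \<psi> x \<noteq> 0}"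
    using test_function_bounded_support[OF \<phi>] bounded_subset by blast
  note cont = test_function_continuous[OF \<phi>] test_function_continuous[OF \<psi>]
    grad_continuous[OF \<phi>] grad_continuous[OF \<psi>]
  have i1: "integrable lborel (\<lambda>x. \<phi> x * (grad \<psi> x \<bullet> e))"
    by (rule integrable_compact_support)
      (use test_function_bounded_support[OF \<phi>] in \<open>auto intro!: continuous_intros cont elim!: bounded_subset\<close>)
  have i2: "integrable lborel (\<lambda>x. (grad \<phi> x \<bullet> e) * \<psi> x)"
    by (rule integrable_compact_support)
      (use test_function_bounded_support[OF \<psi>] in \<open>auto intro!: continuous_intros cont elim!: bounded_subset\<close>)
  have "0 = (LINT x|lborel. (\<phi> x *\<^sub>R grad \<psi> x + \<psi> x *\<^sub>R grad \<phi> x) \<bullet> e)"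
    using has_cont_grad_integral_zero[OF c b] by simp
  also have "\<dots> = (LINT x|lborel. \<phi> x * (grad \<psi> x \<bullet> e) + (grad \<phi> x \<bullet> e) * \<psi> x)"
    by (simp add: inner_add_left mult.commute)
  also have "\<dots> = (LINT x|lborel. \<phi> x * (grad \<psi> x \<bullet> e)) + (LINT x|lborel. (grad \<phi> x \<bullet> e) * \<psi> x)"
    using i1 i2 by (rule Bochner_Integration.integral_add)
  finally have z: "(LINT x|lborel. \<phi> x * (grad \<psi> x \<bullet> e)) = - (LINT x|lborel. (grad \<phi> x \<bullet> e) * \<psi> x)" by simp
  have "(\<lambda>x. indicat_real U x *\<^sub>R (\<phi> x * frechet_derivative \<psi> (at x) e)) = (\<lambda>x. \<phi> x * (grad \<psi> x \<bullet> e))"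
    using test_function_outside[OF \<phi>] by (auto simp: test_function_frechet[OF \<psi>] fun_eq_iff indicator_def)
  moreover have "(\<lambda>x. indicat_real U x *\<^sub>R ((grad \<phi> x \<bullet> e) * \<psi> x)) = (\<lambda>x. (grad \<phi> x \<bullet> e) * \<psi> x)"
    using test_function_outside[OF \<psi>] by (auto simp: fun_eq_iff indicator_def)
  ultimately show "(LINT x:U|lborel. \<phi> x * frechet_derivative \<psi> (at x) e) =
      - (LINT x:U|lborel. (grad \<phi> x \<bullet> e) * \<psi> x)"
    unfolding set_lebesgue_integral_def using z by simp
qed

lemma is_weak_gradient_lincomb:
  assumes "open U" "square_integrable_on U v" "square_integrable_on U w"
    and v: "is_weak_gradient U v g" and w: "is_weak_gradient U w h"
  shows "is_weak_gradient U (\<lambda>x. a * v x + b * w x) (\<lambda>x. a *\<^sub>R g x + b *\<^sub>R h x)"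
  unfolding is_weak_gradient_def
proof (intro conjI allI impI ballI)
  have sq: "square_integrable_on U g" "square_integrable_on U h"
    using v w unfolding is_weak_gradient_def by blast+
  then show "square_integrable_on U (\<lambda>x. a *\<^sub>R g x + b *\<^sub>R h x)"
    by (rule square_integrable_on_lincomb)
  fix \<psi> and e :: 'a assume \<psi>: "test_function U \<psi>" and e: "e \<in> Basis"
  have s: "square_integrable_on U \<psi>" "square_integrable_on U (\<lambda>x. grad \<psi> x \<bullet> e)"
    using test_function_square_integrable[OF assms(1) \<psi>] square_integrable_on_inner by blast+
  note i = square_integrable_on_mult[OF assms(2) s(2)] square_integrable_on_mult[OF assms(3) s(2)]
    square_integrable_on_mult[OF square_integrable_on_inner[OF sq(1)] s(1), of e]
    square_integrable_on_mult[OF square_integrable_on_inner[OF sq(2)] s(1), of e]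
  have eqs: "(LINT x:U|lborel. v x * (grad \<psi> x \<bullet> e)) = - (LINT x:U|lborel. (g x \<bullet> e) * \<psi> x)"
    "(LINT x:U|lborel. w x * (grad \<psi> x \<bullet> e)) = - (LINT x:U|lborel. (h x \<bullet> e) * \<psi> x)"
    using v w \<psi> e unfolding is_weak_gradient_def test_function_frechet[OF \<psi>, symmetric] by blast+
  have "(LINT x:U|lborel. (a * v x + b * w x) * (grad \<psi> x \<bullet> e))
      = (LINT x:U|lborel. a * (v x * (grad \<psi> x \<bullet> e)) + b * (w x * (grad \<psi> x \<bullet> e)))"
    by (simp add: algebra_simps)
  also have "\<dots> = a * (LINT x:U|lborel. v x * (grad \<psi> x \<bullet> e)) + b * (LINT x:U|lborel. w x * (grad \<psi> x \<bullet> e))"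
    using i by (subst set_integral_add) (auto intro!: set_integrable_mult_right)
  also have "\<dots> = - (a * (LINT x:U|lborel. (g x \<bullet> e) * \<psi> x) + b * (LINT x:U|lborel. (h x \<bullet> e) * \<psi> x))"
    unfolding eqs by simp
  also have "\<dots> = - (LINT x:U|lborel. a * ((g x \<bullet> e) * \<psi> x) + b * ((h x \<bullet> e) * \<psi> x))"
    using i by (subst set_integral_add) (auto intro!: set_integrable_mult_right)
  also have "\<dots> = - (LINT x:U|lborel. ((a *\<^sub>R g x + b *\<^sub>R h x) \<bullet> e) * \<psi> x)"
    by (simp add: algebra_simps inner_add_left)
  finally show "(LINT x:U|lborel. (a * v x + b * w x) * frechet_derivative \<psi> (at x) e)
      = - (LINT x:U|lborel. ((a *\<^sub>R g x + b *\<^sub>R h x) \<bullet> e) * \<psi> x)"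
    unfolding test_function_frechet[OF \<psi>] .
qed

lemma square_integrable_on_imp_set_integrable:
  fixes f :: "'a::euclidean_space \<Rightarrow> real"
  assumes "open U" "bounded U" "square_integrable_on U f"
  shows "set_integrable lborel U f"
proof -
  have "emeasure lborel U < \<infinity>" using emeasure_bounded_finite[OF assms(2)] .
  then have "integrable lborel (indicat_real U)" using assms(1) by (intro integrable_real_indicator) auto
  then have "square_integrable_on U (\<lambda>x. 1::real)"
    unfolding square_integrable_on_def set_borel_measurable_def set_integrable_def
    using assms(1) by simp
  from square_integrable_on_mult[OF assms(3) this] show ?thesis by simp
qed

text \<open>Each component of the difference, extended by zero, is orthogonal to all test functions
  on \<open>U\<close>, so the fundamental lemma applies. This makes the \<open>SOME\<close> in
  \<open>weak_gradient\<close> harmless.\<close>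

lemma weak_gradient_unique:
  assumes U: "open U" "bounded U" and g: "is_weak_gradient U v g" and h: "is_weak_gradient U v h"
  shows "AE x in lborel. x \<in> U \<longrightarrow> g x = h x"
proof -
  have sq: "square_integrable_on U g" "square_integrable_on U h"
    using g h unfolding is_weak_gradient_def by blast+
  have "AE x in lborel. indicator U x *\<^sub>R ((g x - h x) \<bullet> e) = (0::real)" if e: "e \<in> Basis" for e
  proof (rule fundamental_lemma[OF U])
    have sg: "square_integrable_on U (\<lambda>x. g x \<bullet> e)" "square_integrable_on U (\<lambda>x. h x \<bullet> e)"
      using sq square_integrable_on_inner by blast+
    from square_integrable_on_lincomb[OF this, of 1 "-1"]
    have "square_integrable_on U (\<lambda>x. (g x - h x) \<bullet> e)" by (simp add: inner_diff_left)
    from square_integrable_on_imp_set_integrable[OF U this]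
    show "integrable lborel (\<lambda>x. indicator U x *\<^sub>R ((g x - h x) \<bullet> e))" unfolding set_integrable_def .
    show "indicator U x *\<^sub>R ((g x - h x) \<bullet> e) = (0::real)" if "x \<notin> U" for x using that by simp
    fix \<psi> :: "'a \<Rightarrow> real" assume \<psi>: "test_function U \<psi>"
    have s: "square_integrable_on U \<psi>" using test_function_square_integrable[OF U(1) \<psi>] by blast
    have "(LINT x|lborel. indicator U x *\<^sub>R ((g x - h x) \<bullet> e) * \<psi> x)
        = (LINT x:U|lborel. (g x \<bullet> e) * \<psi> x - (h x \<bullet> e) * \<psi> x)"
      unfolding set_lebesgue_integral_def
      by (rule Bochner_Integration.integral_cong) (auto simp: inner_diff_left left_diff_distrib indicator_def)
    also have "\<dots> = (LINT x:U|lborel. (g x \<bullet> e) * \<psi> x) - (LINT x:U|lborel. (h x \<bullet> e) * \<psi> x)"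
      by (rule set_integral_diff(2)[OF square_integrable_on_mult[OF sg(1) s] square_integrable_on_mult[OF sg(2) s]])
    also have "\<dots> = 0"
      using g[unfolded is_weak_gradient_def, THEN conjunct2, rule_format, OF \<psi> e]
        h[unfolded is_weak_gradient_def, THEN conjunct2, rule_format, OF \<psi> e] by simp
    finally show "(LINT x|lborel. indicator U x *\<^sub>R ((g x - h x) \<bullet> e) * \<psi> x) = 0" .
  qed
  then have "AE x in lborel. \<forall>e\<in>Basis. indicator U x *\<^sub>R ((g x - h x) \<bullet> e) = (0::real)"
    by (intro AE_finite_allI) auto
  then show ?thesis
  proof eventually_elim
    case (elim x)
    show ?case
    proof
      assume "x \<in> U"
      then have "g x \<bullet> e = h x \<bullet> e" if "e \<in> Basis" for e
        using elim that by (simp add: inner_diff_left)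
      then show "g x = h x" by (rule euclidean_eqI)
    qed
  qed
qed

lemma is_weak_gradient_weak_gradient:
  "is_weak_gradient U v g \<Longrightarrow> is_weak_gradient U v (weak_gradient U v)"
  unfolding weak_gradient_def by (rule someI[where P="is_weak_gradient U v"])

text \<open>The norm may be computed with any weak gradient, because the chosen one differs from it
  only on a null set.\<close>

lemma H1_norm_eq:
  assumes U: "open U" "bounded U" and v: "square_integrable_on U v" and g: "is_weak_gradient U v g"
  shows "(H1_norm U v)\<^sup>2 = (LINT x:U|lborel. (v x)\<^sup>2 + (norm (g x))\<^sup>2)"
    "set_integrable lborel U (\<lambda>x. (v x)\<^sup>2 + (norm (g x))\<^sup>2)"
proof -
  have int: "set_integrable lborel U (\<lambda>x. (v x)\<^sup>2 + (norm (g x))\<^sup>2)" if "is_weak_gradient U v g" for g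
    using that v unfolding is_weak_gradient_def square_integrable_on_def by (auto intro!: set_integral_add(1))
  show "set_integrable lborel U (\<lambda>x. (v x)\<^sup>2 + (norm (g x))\<^sup>2)" using int[OF g] .
  let ?g = "weak_gradient U v"
  have g': "is_weak_gradient U v ?g" using is_weak_gradient_weak_gradient[OF g] .
  have "AE x in lborel. x \<in> U \<longrightarrow> ?g x = g x" by (rule weak_gradient_unique[OF U g' g])
  then have "AE x in lborel. indicat_real U x *\<^sub>R ((v x)\<^sup>2 + (norm (?g x))\<^sup>2)
      = indicator U x *\<^sub>R ((v x)\<^sup>2 + (norm (g x))\<^sup>2)"
    by eventually_elim (auto simp: indicator_def)
  then have "(LINT x:U|lborel. (v x)\<^sup>2 + (norm (?g x))\<^sup>2) = (LINT x:U|lborel. (v x)\<^sup>2 + (norm (g x))\<^sup>2)"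
    unfolding set_lebesgue_integral_def
    using int[OF g] int[OF g'] unfolding set_integrable_def by (intro integral_cong_AE) auto
  \<comment> \<open>Nonnegativity lets the square undo the root in \<open>H1_norm\<close>.\<close>
  moreover have "0 \<le> (LINT x:U|lborel. (v x)\<^sup>2 + (norm (?g x))\<^sup>2)"
    unfolding set_lebesgue_integral_def by (rule Bochner_Integration.integral_nonneg) simp
  ultimately show "(H1_norm U v)\<^sup>2 = (LINT x:U|lborel. (v x)\<^sup>2 + (norm (g x))\<^sup>2)"
    unfolding H1_norm_def by simp
qed

lemma H1_norm_nonneg: "0 \<le> H1_norm U v"
proof -
  have "0 \<le> (LINT x:U|lborel. (v x)\<^sup>2 + (norm (weak_gradient U v x))\<^sup>2)"
    unfolding set_lebesgue_integral_def by (rule Bochner_Integration.integral_nonneg) simp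
  then show ?thesis unfolding H1_norm_def by simp
qed

text \<open>The pointwise quadratic bound, integrated for values and gradients. It takes the place
  of the triangle inequality: limits equal to zero and boundedness are indifferent to the factor
  2.\<close>

lemma H1_lincomb:
  assumes U: "open U" "bounded U" and v: "v \<in> H1 U" and w: "w \<in> H1 U"
  shows "(\<lambda>x. a * v x + b * w x) \<in> H1 U"
    "(H1_norm U (\<lambda>x. a * v x + b * w x))\<^sup>2 \<le> 2 * a\<^sup>2 * (H1_norm U v)\<^sup>2 + 2 * b\<^sup>2 * (H1_norm U w)\<^sup>2"
proof -
  obtain g h where g: "is_weak_gradient U v g" and h: "is_weak_gradient U w h"
    and sv: "square_integrable_on U v" and sw: "square_integrable_on U w"
    using v w unfolding H1_def by blast
  let ?u = "\<lambda>x. a * v x + b * w x" and ?k = "\<lambda>x. a *\<^sub>R g x + b *\<^sub>R h x"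
  have su: "square_integrable_on U ?u" using square_integrable_on_lincomb[OF sv sw] by simp
  have k: "is_weak_gradient U ?u ?k" by (rule is_weak_gradient_lincomb[OF U(1) sv sw g h])
  show "?u \<in> H1 U" using su k unfolding H1_def by blast
  note i = H1_norm_eq(2)[OF U sv g] H1_norm_eq(2)[OF U sw h]
  have i': "set_integrable lborel U (\<lambda>x. 2 * a\<^sup>2 * ((v x)\<^sup>2 + (norm (g x))\<^sup>2))"
     "set_integrable lborel U (\<lambda>x. 2 * b\<^sup>2 * ((w x)\<^sup>2 + (norm (h x))\<^sup>2))"
    using i by (auto intro!: set_integrable_mult_right)
  have "(H1_norm U ?u)\<^sup>2 = (LINT x:U|lborel. (?u x)\<^sup>2 + (norm (?k x))\<^sup>2)"
    by (rule H1_norm_eq(1)[OF U su k])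
  also have "\<dots> \<le> (LINT x:U|lborel. 2 * a\<^sup>2 * ((v x)\<^sup>2 + (norm (g x))\<^sup>2) + 2 * b\<^sup>2 * ((w x)\<^sup>2 + (norm (h x))\<^sup>2))"
  proof (rule set_integral_mono)
    show "(?u x)\<^sup>2 + (norm (?k x))\<^sup>2 \<le> 2 * a\<^sup>2 * ((v x)\<^sup>2 + (norm (g x))\<^sup>2) + 2 * b\<^sup>2 * ((w x)\<^sup>2 + (norm (h x))\<^sup>2)" for x
      using norm_lincomb_square_le[of a "v x" b "w x"] norm_lincomb_square_le[of a "g x" b "h x"]
      by (simp add: algebra_simps)
  qed (use H1_norm_eq(2)[OF U su k] i' in \<open>auto intro!: set_integral_add(1)\<close>)
  also have "\<dots> = 2 * a\<^sup>2 * (H1_norm U v)\<^sup>2 + 2 * b\<^sup>2 * (H1_norm U w)\<^sup>2"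
    unfolding H1_norm_eq(1)[OF U sv g] H1_norm_eq(1)[OF U sw h]
    by (subst set_integral_add(2)[OF i']) simp
  finally show "(H1_norm U ?u)\<^sup>2 \<le> 2 * a\<^sup>2 * (H1_norm U v)\<^sup>2 + 2 * b\<^sup>2 * (H1_norm U w)\<^sup>2" .
qed

lemma test_function_H1:
  assumes "open U" "test_function U \<phi>"
  shows "\<phi> \<in> H1 U"
  unfolding H1_def
  using test_function_square_integrable[OF assms] is_weak_gradient_test_function[OF assms] by blast

text \<open>The function and its gradient vanish outside \<open>U\<close>, so the norm is an
  integral over the whole space, the form that Tonelli produces in the trace inequality.\<close>

lemma test_function_H1_norm:
  assumes "open U" "bounded U" "test_function U \<phi>"
  shows "(\<integral>\<^sup>+x. ennreal ((\<phi> x)\<^sup>2 + (norm (grad \<phi> x))\<^sup>2) \<partial>lborel) = ennreal ((H1_norm U \<phi>)\<^sup>2)"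
proof -
  have w: "square_integrable_on U \<phi>" "is_weak_gradient U \<phi> (grad \<phi>)"
    using test_function_square_integrable[OF assms(1,3)] is_weak_gradient_test_function[OF assms(1,3)] by blast+
  have e: "(\<lambda>x. indicat_real U x *\<^sub>R ((\<phi> x)\<^sup>2 + (norm (grad \<phi> x))\<^sup>2)) = (\<lambda>x. (\<phi> x)\<^sup>2 + (norm (grad \<phi> x))\<^sup>2)"
    using test_function_outside[OF assms(3)] grad_outside[OF assms(3)] by (auto simp: indicator_def fun_eq_iff)
  have "integrable lborel (\<lambda>x. (\<phi> x)\<^sup>2 + (norm (grad \<phi> x))\<^sup>2)"
    using H1_norm_eq(2)[OF assms(1,2) w] unfolding set_integrable_def e .
  then show ?thesis
    using H1_norm_eq(1)[OF assms(1,2) w] unfolding set_lebesgue_integral_def e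
    by (subst nn_integral_eq_integral) auto
qed

section \<open>Surface measure and trace inequality\<close>

text \<open>Compactness makes the face Borel and bounded. The other clauses record that the
  \<open>SOME\<close> in \<open>unit_normal\<close> had a witness, so that the chosen vector is a
  genuine unit normal.\<close>

definition flat :: "(real^3) set \<Rightarrow> bool" where
  "flat F \<longleftrightarrow> compact F \<and> norm (unit_normal F) = 1 \<and>
     (\<forall>x\<in>F. \<forall>y\<in>F. (x - y) \<bullet> unit_normal F = 0)"

text \<open>Signed distance to the plane of the face; for a flat face the choice of the base point
  is immaterial.\<close>

definition height :: "(real^3) set \<Rightarrow> real^3 \<Rightarrow> real" where
  "height F x = (x - (SOME a. a \<in> F)) \<bullet> unit_normal F"

definition plane_proj :: "(real^3) set \<Rightarrow> real^3 \<Rightarrow> real^3" where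
  "plane_proj F x = x - height F x *\<^sub>R unit_normal F"

lemma height_continuous: "continuous_on UNIV (height F)"
  unfolding height_def by (intro continuous_intros)

lemma plane_proj_continuous: "continuous_on UNIV (plane_proj F)"
  unfolding plane_proj_def by (intro continuous_intros height_continuous)

lemma height_measurable[measurable]: "height F \<in> borel_measurable borel"
  by (rule borel_measurable_continuous_onI[OF height_continuous])

lemma plane_proj_measurable[measurable]: "plane_proj F \<in> borel_measurable borel"
  by (rule borel_measurable_continuous_onI[OF plane_proj_continuous])

lemma height_add: "flat F \<Longrightarrow> height F (x + t *\<^sub>R unit_normal F) = height F x + t"
  unfolding height_def flat_def by (simp add: inner_diff_left inner_add_left dot_square_norm)

lemma height_on: "flat F \<Longrightarrow> x \<in> F \<Longrightarrow> height F x = 0"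
  unfolding height_def flat_def by (metis someI)

text \<open>The prism becomes a preimage under the continuous maps \<open>height F\<close> and
  \<open>plane_proj F\<close>. Measurability follows, and disjoint sets get disjoint prisms because
  \<open>plane_proj F\<close> is a function.\<close>

lemma right_prism_eq:
  assumes "flat F"
  shows "right_prism (unit_normal F) (A \<inter> F) =
    {x. 0 \<le> height F x \<and> height F x \<le> 1 \<and> plane_proj F x \<in> A \<inter> F}" (is "?L = ?R")
proof
  show "?L \<subseteq> ?R"
    using height_add[OF assms] height_on[OF assms]
    unfolding right_prism_def plane_proj_def by auto
  show "?R \<subseteq> ?L"
  proof
    fix x assume "x \<in> ?R"
    then show "x \<in> ?L" unfolding right_prism_def
      by (intro CollectI exI[of _ "plane_proj F x"] exI[of _ "height F x"]) (auto simp: plane_proj_def)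
  qed
qed

abbreviation prism :: "(real^3) set \<Rightarrow> (real^3) set" where
  "prism F \<equiv> right_prism (unit_normal F) F"

lemma prism_eq:
  "flat F \<Longrightarrow> prism F = {x. 0 \<le> height F x \<and> height F x \<le> 1 \<and> plane_proj F x \<in> F}"
  using right_prism_eq[of F UNIV] by simp

lemma prism_measurable[measurable]:
  assumes "flat F"
  shows "prism F \<in> sets borel"
proof -
  have [measurable]: "F \<in> sets borel" using assms unfolding flat_def by (simp add: borel_compact)
  show ?thesis unfolding prism_eq[OF assms] by measurable
qed

lemma prism_bounded:
  assumes "flat F"
  shows "bounded (prism F)"
proof -
  have "bounded F" using assms unfolding flat_def by (intro compact_imp_bounded) blast
  then obtain B where B: "\<And>x. x \<in> F \<Longrightarrow> norm x \<le> B" unfolding bounded_iff by blast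
  have n: "norm (unit_normal F) = 1" using assms unfolding flat_def by blast
  show ?thesis
    unfolding bounded_iff right_prism_def
  proof (intro exI ballI)
    fix y assume "y \<in> {x + t *\<^sub>R unit_normal F |x t. x \<in> F \<and> 0 \<le> t \<and> t \<le> 1}"
    then obtain x t where "y = x + t *\<^sub>R unit_normal F" "x \<in> F" "0 \<le> t" "t \<le> 1" by blast
    then show "norm y \<le> B + 1"
      using norm_triangle_ineq[of x "t *\<^sub>R unit_normal F"] B[of x] n by simp
  qed
qed

lemma indicator_right_prism:
  assumes "flat F"
  shows "indicator (right_prism (unit_normal F) (A \<inter> F)) x
    = (indicator (prism F) x * indicator A (plane_proj F x) :: ennreal)"
  unfolding right_prism_eq[OF assms] prism_eq[OF assms] by (auto simp: indicator_def)

section \<open>The surface measure as a sum over faces\<close>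

context
  fixes \<F> :: "(real^3) set set"
  assumes finite_faces: "finite \<F>" and flat_faces: "\<forall>F\<in>\<F>. flat F"
begin

lemma right_prism_measurable:
  assumes "F \<in> \<F>" and [measurable]: "A \<in> sets borel"
  shows "right_prism (unit_normal F) (A \<inter> F) \<in> sets borel"
proof -
  have [measurable]: "F \<in> sets borel"
    using flat_faces[rule_format, OF assms(1)] unfolding flat_def by (simp add: borel_compact)
  show ?thesis unfolding right_prism_eq[OF flat_faces[rule_format, OF assms(1)]] by measurable
qed

lemma sets_surface_measure: "sets (polyhedral_surface_measure \<F>) = sets borel"
  unfolding polyhedral_surface_measure_def by (simp add: sets.sigma_sets_eq[of borel, simplified])

text \<open>\<open>measure_of\<close> delivers the intended values once the set function is
  countably additive. This holds face by face, since prisms over disjoint sets are disjoint.\<close>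

lemma emeasure_surface_measure:
  assumes "A \<in> sets borel"
  shows "emeasure (polyhedral_surface_measure \<F>) A
    = (\<Sum>F\<in>\<F>. emeasure lborel (right_prism (unit_normal F) (A \<inter> F)))"
  unfolding polyhedral_surface_measure_def
proof (rule emeasure_measure_of_sigma[OF _ _ _ assms])
  show "sigma_algebra UNIV (sets (borel :: (real^3) measure))"
    using sets.sigma_algebra_axioms[of "borel :: (real^3) measure"] by simp
  let ?\<mu> = "\<lambda>A. \<Sum>F\<in>\<F>. emeasure lborel (right_prism (unit_normal F) (A \<inter> F))"
  show "positive (sets borel) ?\<mu>" by (simp add: positive_def right_prism_def)
  show "countably_additive (sets borel) ?\<mu>"
    unfolding countably_additive_def
  proof (intro allI impI)
    fix A :: "nat \<Rightarrow> (real^3) set"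
    assume A: "range A \<subseteq> sets borel" "disjoint_family A"
    have "(\<Sum>i. ?\<mu> (A i)) = (\<Sum>F\<in>\<F>. \<Sum>i. emeasure lborel (right_prism (unit_normal F) (A i \<inter> F)))"
      by (rule suminf_sum) simp
    also have "\<dots> = (\<Sum>F\<in>\<F>. emeasure lborel (right_prism (unit_normal F) ((\<Union>i. A i) \<inter> F)))"
    proof (rule sum.cong[OF refl])
      fix F assume F: "F \<in> \<F>"
      have "(\<Sum>i. emeasure lborel (right_prism (unit_normal F) (A i \<inter> F)))
          = emeasure lborel (\<Union>i. right_prism (unit_normal F) (A i \<inter> F))"
      proof (rule suminf_emeasure)
        show "range (\<lambda>i. right_prism (unit_normal F) (A i \<inter> F)) \<subseteq> sets lborel"
          using right_prism_measurable[OF F] A by auto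
        show "disjoint_family (\<lambda>i. right_prism (unit_normal F) (A i \<inter> F))"
          using A(2) unfolding right_prism_eq[OF flat_faces[rule_format, OF F]] disjoint_family_on_def by blast
      qed
      also have "(\<Union>i. right_prism (unit_normal F) (A i \<inter> F)) = right_prism (unit_normal F) ((\<Union>i. A i) \<inter> F)"
        unfolding right_prism_eq[OF flat_faces[rule_format, OF F]] by blast
      finally show "(\<Sum>i. emeasure lborel (right_prism (unit_normal F) (A i \<inter> F)))
          = emeasure lborel (right_prism (unit_normal F) ((\<Union>i. A i) \<inter> F))" .
    qed
    finally show "(\<Sum>i. ?\<mu> (A i)) = ?\<mu> (\<Union>i. A i)" .
  qed
qed

lemma emeasure_surface_measure_finite: "emeasure (polyhedral_surface_measure \<F>) UNIV < \<infinity>"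
proof -
  have "emeasure lborel (prism F) < top" if "F \<in> \<F>" for F
    using emeasure_bounded_finite[OF prism_bounded[OF flat_faces[rule_format, OF that]]] by simp
  then show ?thesis using finite_faces by (simp add: emeasure_surface_measure)
qed

lemma measurable_surface_measure: "borel_measurable (polyhedral_surface_measure \<F>) = borel_measurable borel"
  by (rule measurable_cong_sets[OF sets_surface_measure refl])

text \<open>A surface integral becomes a volume integral over prisms of height one, with the
  integrand constant along the normal. The proof extends the indicator case, which is the definition
  of the measure, by linearity and monotone limits.\<close>

lemma nn_integral_surface_measure:
  assumes "f \<in> borel_measurable borel"
  shows "(\<integral>\<^sup>+x. f x \<partial>polyhedral_surface_measure \<F>)
    = (\<Sum>F\<in>\<F>. \<integral>\<^sup>+x. indicator (prism F) x * f (plane_proj F x) \<partial>lborel)"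
    (is "nn_integral ?M _ = _")
  using assms
proof (induction rule: borel_measurable_induct)
  case (cong f g)
  then have "f = g" by auto
  then show ?case using cong by simp
next
  case (set A)
  then have A: "A \<in> sets ?M" by (simp add: sets_surface_measure)
  have "(\<integral>\<^sup>+x. indicator A x \<partial>?M) = emeasure ?M A"
    using A by simp
  also have "\<dots> = (\<Sum>F\<in>\<F>. \<integral>\<^sup>+x. indicator (right_prism (unit_normal F) (A \<inter> F)) x \<partial>lborel)"
    using right_prism_measurable set by (simp add: emeasure_surface_measure)
  also have "\<dots> = (\<Sum>F\<in>\<F>. \<integral>\<^sup>+x. indicator (prism F) x * indicator A (plane_proj F x) \<partial>lborel)"
    by (intro sum.cong refl) (simp add: indicator_right_prism[OF flat_faces[rule_format]])
  finally show ?case .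
next
  case (mult f c)
  have m: "f \<in> borel_measurable ?M"
    using mult by (simp add: measurable_surface_measure)
  have "(\<integral>\<^sup>+x. indicator (prism F) x * (c * f (plane_proj F x)) \<partial>lborel)
      = c * (\<integral>\<^sup>+x. indicator (prism F) x * f (plane_proj F x) \<partial>lborel)" if "F \<in> \<F>" for F
  proof -
    have [measurable]: "prism F \<in> sets borel" "f \<in> borel_measurable borel"
      using prism_measurable[OF flat_faces[rule_format, OF that]] mult by auto
    show ?thesis by (subst nn_integral_cmult[symmetric]) (auto simp: ac_simps)
  qed
  then show ?case using mult m by (simp add: nn_integral_cmult sum_distrib_left)
next
  case (add u v)
  have m: "u \<in> borel_measurable ?M" "v \<in> borel_measurable ?M"
    using add by (simp_all add: measurable_surface_measure)
  have "(\<integral>\<^sup>+x. indicator (prism F) x * (v (plane_proj F x) + u (plane_proj F x)) \<partial>lborel)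
      = (\<integral>\<^sup>+x. indicator (prism F) x * v (plane_proj F x) \<partial>lborel)
      + (\<integral>\<^sup>+x. indicator (prism F) x * u (plane_proj F x) \<partial>lborel)" if "F \<in> \<F>" for F
  proof -
    have [measurable]: "prism F \<in> sets borel" "u \<in> borel_measurable borel" "v \<in> borel_measurable borel"
      using prism_measurable[OF flat_faces[rule_format, OF that]] add by auto
    show ?thesis by (subst nn_integral_add[symmetric]) (auto simp: distrib_left)
  qed
  then show ?case using add m by (simp add: nn_integral_add sum.distrib)
next
  case (seq U)
  have mU: "U i \<in> borel_measurable ?M" for i
    using seq by (simp add: measurable_surface_measure)
  let ?g = "\<lambda>F i x. indicator (prism F) x * U i (plane_proj F x)"
  have inc: "incseq (\<lambda>i x. ?g F i x)" for F
    using seq(3) by (auto simp: incseq_def le_fun_def intro!: mult_left_mono)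
  have "(\<integral>\<^sup>+x. (SUP i. U i) x \<partial>?M) = (SUP i. \<integral>\<^sup>+x. U i x \<partial>?M)"
    using nn_integral_monotone_convergence_SUP[OF seq(3) mU] by (simp add: image_comp)
  also have "\<dots> = (SUP i. \<Sum>F\<in>\<F>. \<integral>\<^sup>+x. ?g F i x \<partial>lborel)" using seq by simp
  also have "\<dots> = (\<Sum>F\<in>\<F>. SUP i. \<integral>\<^sup>+x. ?g F i x \<partial>lborel)"
    by (rule ennreal_SUP_sum)
      (use inc in \<open>auto simp: incseq_def le_fun_def intro!: nn_integral_mono\<close>)
  also have "\<dots> = (\<Sum>F\<in>\<F>. \<integral>\<^sup>+x. indicator (prism F) x * (SUP i. U i) (plane_proj F x) \<partial>lborel)"
  proof (rule sum.cong[OF refl])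
    fix F assume F: "F \<in> \<F>"
    have m: "?g F i \<in> borel_measurable lborel" for i
    proof -
      have [measurable]: "prism F \<in> sets borel" "U i \<in> borel_measurable borel"
        using prism_measurable[OF flat_faces[rule_format, OF F]] seq by auto
      show ?thesis by measurable
    qed
    have "(SUP i. \<integral>\<^sup>+x. ?g F i x \<partial>lborel) = (\<integral>\<^sup>+x. (SUP i. ?g F i x) \<partial>lborel)"
      by (rule nn_integral_monotone_convergence_SUP[OF inc m, symmetric])
    also have "(\<lambda>x. SUP i. ?g F i x) = (\<lambda>x. indicator (prism F) x * (SUP i. U i) (plane_proj F x))"
      by (simp add: SUP_mult_left_ennreal image_comp fun_eq_iff)
    finally show "(SUP i. \<integral>\<^sup>+x. ?g F i x \<partial>lborel)
        = (\<integral>\<^sup>+x. indicator (prism F) x * (SUP i. U i) (plane_proj F x) \<partial>lborel)" .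
  qed
  finally show ?case .
qed

end

text \<open>Fundamental theorem of calculus for the square of \<phi> along the line, from the given
  point to one beyond the support. Extending the integral to the whole line makes the bound
  independent of \<open>s\<close>.\<close>

lemma square_le_line_integral:
  fixes \<phi> :: "'a::euclidean_space \<Rightarrow> real"
  assumes \<phi>: "has_cont_grad \<phi> G" and b: "bounded {x. \<phi> x \<noteq> 0}" and n: "norm n = 1"
  shows "ennreal ((\<phi> (y - s *\<^sub>R n))\<^sup>2) \<le> (\<integral>\<^sup>+t. ennreal (2 * \<bar>\<phi> (y + t *\<^sub>R n)\<bar> * \<bar>G (y + t *\<^sub>R n) \<bullet> n\<bar>) \<partial>lborel)"
proof -
  obtain R where R: "\<And>x. \<phi> x \<noteq> 0 \<Longrightarrow> norm x \<le> R" "R > 0" using b unfolding bounded_pos by auto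
  \<comment> \<open>Large enough for \<open>y + T *\<^sub>R n\<close> to lie outside the support,
    contained in the ball of radius \<open>R\<close>, and for \<open>T\<close> to be at least
    \<open>- s\<close>.\<close>
  define T where "T = \<bar>s\<bar> + R + norm y + 1"
  have "norm (T *\<^sub>R n) > R + norm y" unfolding T_def using n R(2) by simp
  then have "norm (y + T *\<^sub>R n) > R" using norm_diff_ineq[of "T *\<^sub>R n" y] by (simp add: add.commute)
  then have T0: "\<phi> (y + T *\<^sub>R n) = 0" using R(1) by (meson not_le)
  have sT: "- s \<le> T" unfolding T_def using R(2) norm_ge_zero[of y] by linarith
  let ?u = "\<lambda>t. (\<phi> (y + t *\<^sub>R n))\<^sup>2" and ?u' = "\<lambda>t. 2 * \<phi> (y + t *\<^sub>R n) * (G (y + t *\<^sub>R n) \<bullet> n)"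
  have cl: "continuous_on A (\<lambda>t. f (y + t *\<^sub>R n))" if "continuous_on UNIV f" for A and f :: "'a \<Rightarrow> 'b::topological_space"
    by (rule continuous_on_compose2[OF that]) (intro continuous_intros, auto)
  have cG: "continuous_on UNIV G" using \<phi> unfolding has_cont_grad_def by blast
  note cphi = has_cont_grad_continuous[OF \<phi>]
  have "has_bochner_integral lborel (\<lambda>t. indicator {-s..T} t *\<^sub>R ?u' t) (?u T - ?u (-s))"
  proof (rule has_bochner_integral_FTC_Icc[OF sT])
    fix t
    from DERIV_power[OF has_cont_grad_line[OF \<phi>], where n=2]
    have "(?u has_real_derivative ?u' t) (at t within {-s..T})" by (simp add: mult_ac)
    then show "(?u has_vector_derivative ?u' t) (at t within {-s..T})"
      by (simp add: has_real_derivative_iff_has_vector_derivative)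
  next
    show "continuous_on {-s..T} ?u'" by (intro continuous_intros cl cG cphi)
  qed
  then have hb: "has_bochner_integral lborel (\<lambda>t. indicator {-s..T} t *\<^sub>R ?u' t) (- (\<phi> (y - s *\<^sub>R n))\<^sup>2)"
    by (simp add: T0)
  have "ennreal ((\<phi> (y - s *\<^sub>R n))\<^sup>2) = ennreal (norm (LINT t|lborel. indicator {-s..T} t *\<^sub>R ?u' t))"
    using has_bochner_integral_integral_eq[OF hb] by simp
  also have "\<dots> \<le> (\<integral>\<^sup>+t. ennreal (norm (indicator {-s..T} t *\<^sub>R ?u' t)) \<partial>lborel)"
    by (rule integral_norm_bound_ennreal) (use hb has_bochner_integral_iff in blast)
  also have "\<dots> \<le> (\<integral>\<^sup>+t. ennreal (2 * \<bar>\<phi> (y + t *\<^sub>R n)\<bar> * \<bar>G (y + t *\<^sub>R n) \<bullet> n\<bar>) \<partial>lborel)"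
    by (intro nn_integral_mono ennreal_leI) (auto simp: indicator_def abs_mult)
  finally show ?thesis .
qed

lemma nn_integral_translate:
  fixes f :: "'a::euclidean_space \<Rightarrow> ennreal"
  assumes "f \<in> borel_measurable borel"
  shows "(\<integral>\<^sup>+x. f (x + a) \<partial>lborel) = (\<integral>\<^sup>+x. f x \<partial>lborel)"
proof -
  have "(\<integral>\<^sup>+x. f x \<partial>distr lborel borel ((+) a)) = (\<integral>\<^sup>+x. f (a + x) \<partial>lborel)"
    by (rule nn_integral_distr) (use assms in auto)
  then show ?thesis by (simp add: lborel_distr_plus add.commute)
qed

text \<open>Tonelli, after sliding the prism along its axis; a line along the axis meets the prism in
  a set of length at most one.\<close>

lemma prism_line_integral_le:
  assumes F: "flat F" and h[measurable]: "h \<in> borel_measurable borel"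
  shows "(\<integral>\<^sup>+y. indicator (prism F) y * (\<integral>\<^sup>+t. h (y + t *\<^sub>R unit_normal F) \<partial>lborel) \<partial>lborel)
    \<le> (\<integral>\<^sup>+z. h z \<partial>lborel)"
proof -
  let ?n = "unit_normal F"
  note [measurable] = prism_measurable[OF F]
  have "(\<integral>\<^sup>+y. indicator (prism F) y * (\<integral>\<^sup>+t. h (y + t *\<^sub>R ?n) \<partial>lborel) \<partial>lborel)
      = (\<integral>\<^sup>+y. (\<integral>\<^sup>+t. indicator (prism F) y * h (y + t *\<^sub>R ?n) \<partial>lborel) \<partial>lborel)"
    by (intro nn_integral_cong nn_integral_cmult[symmetric]) measurable
  also have "\<dots> = (\<integral>\<^sup>+t. (\<integral>\<^sup>+y. indicator (prism F) y * h (y + t *\<^sub>R ?n) \<partial>lborel) \<partial>lborel)"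
    by (rule lborel_pair.Fubini'[symmetric]) measurable
  also have "\<dots> = (\<integral>\<^sup>+t. (\<integral>\<^sup>+z. indicator (prism F) (z - t *\<^sub>R ?n) * h z \<partial>lborel) \<partial>lborel)"
  proof (rule nn_integral_cong)
    fix t :: real
    have m: "(\<lambda>z. indicator (prism F) (z - t *\<^sub>R ?n) * h z) \<in> borel_measurable borel" by measurable
    show "(\<integral>\<^sup>+y. indicator (prism F) y * h (y + t *\<^sub>R ?n) \<partial>lborel)
        = (\<integral>\<^sup>+z. indicator (prism F) (z - t *\<^sub>R ?n) * h z \<partial>lborel)"
      using nn_integral_translate[OF m, of "t *\<^sub>R ?n"] by simp
  qed
  also have "\<dots> = (\<integral>\<^sup>+z. (\<integral>\<^sup>+t. indicator (prism F) (z - t *\<^sub>R ?n) * h z \<partial>lborel) \<partial>lborel)"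
    by (rule lborel_pair.Fubini') measurable
  also have "\<dots> \<le> (\<integral>\<^sup>+z. h z \<partial>lborel)"
  proof (rule nn_integral_mono)
    fix z
    have "(\<integral>\<^sup>+t. indicator (prism F) (z - t *\<^sub>R ?n) * h z \<partial>lborel)
        \<le> (\<integral>\<^sup>+t. indicator {height F z - 1..height F z} t * h z \<partial>lborel)"
    proof (intro nn_integral_mono mult_right_mono)
      fix t
      have "height F (z - t *\<^sub>R ?n) = height F z - t" using height_add[OF F, of z "-t"] by simp
      then show "indicator (prism F) (z - t *\<^sub>R ?n) \<le> (indicator {height F z - 1..height F z} t :: ennreal)"
        unfolding prism_eq[OF F] by (auto simp: indicator_def)
    qed simp
    also have "\<dots> = h z" by (subst nn_integral_multc) auto
    finally show "(\<integral>\<^sup>+t. indicator (prism F) (z - t *\<^sub>R ?n) * h z \<partial>lborel) \<le> h z" .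
  qed
  finally show ?thesis .
qed

text \<open>\<open>plane_proj F\<close> moves along the normal, so the value on the face is
  controlled by an integral over the normal line. Tonelli bounds the total by the volume integral of
  \<open>2 * \<bar>\<phi>\<bar>\<close> times the normal derivative, which the squared H^1 norm
  dominates. Each face is charged the full norm, hence the factor \<open>card \<F>\<close>.\<close>

lemma trace_inequality:
  assumes "finite \<F>" "\<forall>F\<in>\<F>. flat F" and U: "open U" "bounded U" and \<phi>: "test_function U \<phi>"
  shows "(\<integral>\<^sup>+x. ennreal ((\<phi> x)\<^sup>2) \<partial>polyhedral_surface_measure \<F>) \<le> ennreal (card \<F> * (H1_norm U \<phi>)\<^sup>2)"
proof -
  have c: "has_cont_grad \<phi> (grad \<phi>)" using \<phi> test_function_iff by blast
  have [measurable]: "\<phi> \<in> borel_measurable borel" "grad \<phi> \<in> borel_measurable borel"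
    using borel_measurable_continuous_onI test_function_continuous[OF \<phi>] grad_continuous[OF \<phi>] by auto
  have "(\<integral>\<^sup>+x. indicator (prism F) x * ennreal ((\<phi> (plane_proj F x))\<^sup>2) \<partial>lborel) \<le> ennreal ((H1_norm U \<phi>)\<^sup>2)"
    if "F \<in> \<F>" for F
  proof -
    let ?n = "unit_normal F"
    have F: "flat F" using assms that by blast
    then have n: "norm ?n = 1" unfolding flat_def by blast
    let ?h = "\<lambda>z. ennreal (2 * \<bar>\<phi> z\<bar> * \<bar>grad \<phi> z \<bullet> ?n\<bar>)"
    have "(\<integral>\<^sup>+x. indicator (prism F) x * ennreal ((\<phi> (plane_proj F x))\<^sup>2) \<partial>lborel)
      \<le> (\<integral>\<^sup>+x. indicator (prism F) x * (\<integral>\<^sup>+t. ?h (x + t *\<^sub>R ?n) \<partial>lborel) \<partial>lborel)"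
      unfolding plane_proj_def
      by (intro nn_integral_mono mult_left_mono square_le_line_integral[OF c test_function_bounded_support[OF \<phi>] n]) simp
    also have "\<dots> \<le> (\<integral>\<^sup>+z. ?h z \<partial>lborel)"
      by (rule prism_line_integral_le[OF F]) measurable
    also have "\<dots> \<le> (\<integral>\<^sup>+x. ennreal ((\<phi> x)\<^sup>2 + (norm (grad \<phi> x))\<^sup>2) \<partial>lborel)"
    proof (intro nn_integral_mono ennreal_leI)
      fix z
      have "\<bar>grad \<phi> z \<bullet> ?n\<bar> \<le> norm (grad \<phi> z)" using Cauchy_Schwarz_ineq2[of "grad \<phi> z" ?n] n by simp
      then have "2 * \<bar>\<phi> z\<bar> * \<bar>grad \<phi> z \<bullet> ?n\<bar> \<le> 2 * \<bar>\<phi> z\<bar> * norm (grad \<phi> z)" by (intro mult_left_mono) auto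
      also have "\<dots> \<le> \<bar>\<phi> z\<bar>\<^sup>2 + (norm (grad \<phi> z))\<^sup>2" by (rule sum_squares_bound)
      finally show "2 * \<bar>\<phi> z\<bar> * \<bar>grad \<phi> z \<bullet> ?n\<bar> \<le> (\<phi> z)\<^sup>2 + (norm (grad \<phi> z))\<^sup>2" by simp
    qed
    also have "\<dots> = ennreal ((H1_norm U \<phi>)\<^sup>2)" by (rule test_function_H1_norm[OF U \<phi>])
    finally show ?thesis .
  qed
  then have "(\<Sum>F\<in>\<F>. \<integral>\<^sup>+x. indicator (prism F) x * ennreal ((\<phi> (plane_proj F x))\<^sup>2) \<partial>lborel)
      \<le> (\<Sum>F\<in>\<F>. ennreal ((H1_norm U \<phi>)\<^sup>2))" by (rule sum_mono)
  then show ?thesis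
    using nn_integral_surface_measure[OF assms(1,2), of "\<lambda>x. ennreal ((\<phi> x)\<^sup>2)"]
    by (simp add: ennreal_mult' ennreal_of_nat_eq_real_of_nat)
qed

section \<open>Approximation by test functions\<close>

text \<open>Induction on the number of sets. Between the first and the last point of the interval
  lying in \<open>C\<close>, the bound on \<open>C\<close> applies directly, whatever covers the
  points between them; the two outer pieces avoid \<open>C\<close> and are covered by the remaining
  sets.\<close>

lemma lipschitz_of_finite_closed_cover:
  fixes g :: "real \<Rightarrow> real"
  assumes "finite \<C>" "\<And>C. C \<in> \<C> \<Longrightarrow> closed C"
    and "\<And>C s t. C \<in> \<C> \<Longrightarrow> s \<in> C \<Longrightarrow> t \<in> C \<Longrightarrow> \<bar>g s - g t\<bar> \<le> L * \<bar>s - t\<bar>"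
    and "{a..b} \<subseteq> \<Union>\<C>" "a \<le> b"
  shows "\<bar>g b - g a\<bar> \<le> L * (b - a)"
  using assms
proof (induction \<C> arbitrary: a b rule: finite_induct)
  case empty
  then show ?case by simp
next
  case (insert C \<C>)
  have IH: "\<bar>g b' - g a'\<bar> \<le> L * (b' - a')" if "{a'..b'} \<subseteq> \<Union>\<C>" "a' \<le> b'" for a' b'
  proof (rule insert.IH[OF _ _ that])
    show "closed C'" if "C' \<in> \<C>" for C' using insert.prems(1) that by blast
    show "\<bar>g s - g t\<bar> \<le> L * \<bar>s - t\<bar>" if "C' \<in> \<C>" "s \<in> C'" "t \<in> C'" for C' s t
      using insert.prems(2) that by blast
  qed
  have cl: "closed (\<Union>\<C>)" using insert.hyps insert.prems(1) by (intro closed_Union) auto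
  show ?case
  proof (cases "C \<inter> {a..b} = {}")
    case True
    then have "{a..b} \<subseteq> \<Union>\<C>" using insert.prems(3) by auto
    then show ?thesis using IH insert.prems(4) by blast
  next
    case False
    have comp: "compact (C \<inter> {a..b})" using insert.prems(1) by (intro closed_Int_compact) auto
    obtain s where s: "s \<in> C \<inter> {a..b}" "\<And>t. t \<in> C \<inter> {a..b} \<Longrightarrow> s \<le> t"
      using compact_attains_inf[OF comp False] by blast
    obtain t where t: "t \<in> C \<inter> {a..b}" "\<And>u. u \<in> C \<inter> {a..b} \<Longrightarrow> u \<le> t"
      using compact_attains_sup[OF comp False] by blast
    have st: "s \<le> t" using s t by blast
    have 1: "\<bar>g s - g a\<bar> \<le> L * (s - a)"
    proof (cases "a < s")
      case True
      have "{a..<s} \<subseteq> \<Union>\<C>"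
      proof
        fix u assume u: "u \<in> {a..<s}"
        then have "u \<in> {a..b}" using s by auto
        moreover have "u \<notin> C" using s(2)[of u] u calculation by force
        ultimately show "u \<in> \<Union>\<C>" using insert.prems(3) by blast
      qed
      \<comment> \<open>Only the half-open interval is known to avoid \<open>C\<close>. Its endpoint
        \<open>s\<close> is recovered because the union of the remaining sets is closed.\<close>
      then have "closure {a..<s} \<subseteq> \<Union>\<C>" using cl by (rule closure_minimal)
      then show ?thesis using True IH[of a s] by simp
    qed (use s in auto)
    have 2: "\<bar>g b - g t\<bar> \<le> L * (b - t)"
    proof (cases "t < b")
      case True
      have "{t<..b} \<subseteq> \<Union>\<C>"
      proof
        fix u assume u: "u \<in> {t<..b}"
        then have "u \<in> {a..b}" using t by auto
        moreover have "u \<notin> C" using t(2)[of u] u calculation by force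
        ultimately show "u \<in> \<Union>\<C>" using insert.prems(3) by blast
      qed
      then have "closure {t<..b} \<subseteq> \<Union>\<C>" using cl by (rule closure_minimal)
      then show ?thesis using True IH[of t b] by simp
    qed (use t in auto)
    have "\<bar>g t - g s\<bar> \<le> L * \<bar>t - s\<bar>" using insert.prems(2)[of C t s] s(1) t(1) by blast
    then have "\<bar>g t - g s\<bar> \<le> L * (t - s)" using st by simp
    then show ?thesis using 1 2 by (simp add: right_diff_distrib)
  qed
qed

section \<open>Smoothness of polynomials\<close>

lemma has_cont_grad_const: "has_cont_grad (\<lambda>x. c) (\<lambda>x. 0)"
  unfolding has_cont_grad_def by (auto intro!: has_derivative_eq_rhs[OF has_derivative_const])

lemma has_cont_grad_component: "has_cont_grad (\<lambda>x::real^'n. x $ i) (\<lambda>x. axis i 1)"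
proof -
  have "(\<lambda>x::real^'n. x $ i) = (\<lambda>x. axis i 1 \<bullet> x)" by (simp add: inner_axis' fun_eq_iff)
  then show ?thesis unfolding has_cont_grad_def by (auto intro!: derivative_eq_intros)
qed

lemma has_cont_grad_sum:
  assumes "\<And>i. i \<in> I \<Longrightarrow> has_cont_grad (f i) (F i)"
  shows "has_cont_grad (\<lambda>x. \<Sum>i\<in>I. f i x) (\<lambda>x. \<Sum>i\<in>I. F i x)"
  unfolding has_cont_grad_def
proof (intro conjI allI)
  show "continuous_on UNIV (\<lambda>x. \<Sum>i\<in>I. F i x)"
    using assms unfolding has_cont_grad_def by (intro continuous_intros) blast
  have "((\<lambda>x. \<Sum>i\<in>I. f i x) has_derivative (\<lambda>e. \<Sum>i\<in>I. F i x \<bullet> e)) (at x)" for x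
    using assms unfolding has_cont_grad_def by (intro has_derivative_sum) blast
  then show "((\<lambda>x. \<Sum>i\<in>I. f i x) has_derivative (\<bullet>) (\<Sum>i\<in>I. F i x)) (at x)" for x
    by (rule has_derivative_eq_rhs) (auto simp: inner_sum_left)
qed

lemma has_cont_grad_power: "has_cont_grad f F \<Longrightarrow> \<exists>G. has_cont_grad (\<lambda>x. f x ^ n) G"
proof (induction n)
  case 0
  then show ?case using has_cont_grad_const[of 1] by auto
next
  case (Suc n)
  then obtain G where "has_cont_grad (\<lambda>x. f x ^ n) G" by blast
  from has_cont_grad_mult[OF Suc.prems this] show ?case by auto
qed

lemma polynomial3_has_cont_grad:
  assumes "polynomial3 k p"
  shows "\<exists>G. has_cont_grad p G"
proof -
  obtain c where c: "\<And>x. p x = (\<Sum>(i, j, l)\<in>{(i, j, l). i + j + l \<le> k}. c i j l * (x$1)^i * (x$2)^j * (x$3)^l)"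
    using assms unfolding polynomial3_def by blast
  have ex: "\<exists>G. has_cont_grad (\<lambda>x::real^3. c i j l * (x$1)^i * (x$2)^j * (x$3)^l) G" for i j l
  proof -
    obtain A where A: "has_cont_grad (\<lambda>x::real^3. (x$1)^i) A"
      using has_cont_grad_power[OF has_cont_grad_component] by blast
    obtain B where B: "has_cont_grad (\<lambda>x::real^3. (x$2)^j) B"
      using has_cont_grad_power[OF has_cont_grad_component] by blast
    obtain C where C: "has_cont_grad (\<lambda>x::real^3. (x$3)^l) C"
      using has_cont_grad_power[OF has_cont_grad_component] by blast
    from has_cont_grad_mult[OF has_cont_grad_mult[OF has_cont_grad_mult[OF has_cont_grad_const A] B] C]
    show ?thesis by blast
  qed
  define h where "h t x = (case t of (i, j, l) \<Rightarrow> c i j l * (x$1)^i * (x$2)^j * (x$3)^l)" for t and x :: "real^3"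
  have "\<exists>G. has_cont_grad (h t) G" for t
    using ex[of "fst t" "fst (snd t)" "snd (snd t)"] unfolding h_def[abs_def] by (simp add: split_beta)
  then have "has_cont_grad (h t) (SOME G. has_cont_grad (h t) G)" for t by (rule someI_ex)
  then have "\<exists>G. has_cont_grad (\<lambda>x. \<Sum>t\<in>{(i, j, l). i + j + l \<le> k}. h t x) G"
    using has_cont_grad_sum[where f=h and F="\<lambda>t. SOME G. has_cont_grad (h t) G"] by blast
  moreover have "p = (\<lambda>x. \<Sum>t\<in>{(i, j, l). i + j + l \<le> k}. h t x)"
    using c unfolding h_def by (intro ext) simp
  ultimately show ?thesis by simp
qed

lemma lipschitz_on_compact_convex:
  fixes f :: "'a::euclidean_space \<Rightarrow> real"
  assumes f: "has_cont_grad f F" and K: "convex K" "compact K"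
  obtains L where "\<And>x y. x \<in> K \<Longrightarrow> y \<in> K \<Longrightarrow> \<bar>f x - f y\<bar> \<le> L * norm (x - y)"
proof -
  have "continuous_on K F" using f continuous_on_subset unfolding has_cont_grad_def by blast
  then have "bounded (F ` K)" using K(2) compact_continuous_image compact_imp_bounded by blast
  then obtain B where "\<And>x. x \<in> K \<Longrightarrow> norm (F x) \<le> B" unfolding bounded_iff by blast
  then have "\<bar>f x - f y\<bar> \<le> B * norm (x - y)" if "x \<in> K" "y \<in> K" for x y
    using increment_bound_of_grad_bound[OF f K(1), of 0 B x y] that by simp
  then show thesis using that by blast
qed

text \<open>Strict differentiability, which is what survives mollification.\<close>

definition strict_grad :: "('a::euclidean_space \<Rightarrow> real) \<Rightarrow> 'a \<Rightarrow> 'a \<Rightarrow> bool" where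
  "strict_grad v x g \<longleftrightarrow> (\<forall>\<eta>>0. \<exists>r>0. \<forall>y\<in>ball x r. \<forall>z\<in>ball x r.
     \<bar>v y - v z - g \<bullet> (y - z)\<bar> \<le> \<eta> * norm (y - z))"

text \<open>Agreement with a smooth function is asked only near \<open>x\<close>, as a discrete
  function is known to be smooth only inside a tetrahedron or off the closed domain. On a small ball
  the gradient is nearly constant and the mean value inequality applies.\<close>

lemma strict_grad_of_has_cont_grad:
  assumes f: "has_cont_grad f F" and "open V" "x \<in> V" and eq: "\<And>y. y \<in> V \<Longrightarrow> v y = f y"
  shows "strict_grad v x (F x)"
  unfolding strict_grad_def
proof (intro allI impI)
  fix \<eta> :: real assume \<eta>: "\<eta> > 0"
  have "continuous (at x) F" using f unfolding has_cont_grad_def by (simp add: continuous_on_eq_continuous_at)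
  then obtain d where d: "d > 0" "\<And>y. dist y x < d \<Longrightarrow> dist (F y) (F x) < \<eta>"
    using \<eta> unfolding continuous_at_eps_delta by blast
  obtain e where e: "e > 0" "ball x e \<subseteq> V" using assms open_contains_ball by blast
  have "\<bar>v y - v z - F x \<bullet> (y - z)\<bar> \<le> \<eta> * norm (y - z)"
    if "y \<in> ball x (min d e)" "z \<in> ball x (min d e)" for y z
  proof -
    have "\<bar>f y - f z - F x \<bullet> (y - z)\<bar> \<le> \<eta> * norm (y - z)"
    proof (rule increment_bound_of_grad_bound[OF f convex_ball _ that])
      show "norm (F w - F x) \<le> \<eta>" if "w \<in> ball x (min d e)" for w
        using d(2)[of w] that by (simp add: dist_norm norm_minus_commute)
    qed
    moreover have "v y = f y" "v z = f z" using that e(2) by (auto intro!: eq)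
    ultimately show ?thesis by simp
  qed
  then show "\<exists>r>0. \<forall>y\<in>ball x r. \<forall>z\<in>ball x r. \<bar>v y - v z - F x \<bullet> (y - z)\<bar> \<le> \<eta> * norm (y - z)"
    using d(1) e(1) by (intro exI[of _ "min d e"]) auto
qed

text \<open>A converse of the mean value bound, obtained from difference quotients in one
  well-chosen direction.\<close>

lemma grad_bound_of_increment_bound:
  assumes f: "has_cont_grad f F" and r: "r > 0" and \<eta>: "0 \<le> \<eta>"
    and b: "\<And>y. y \<in> ball x r \<Longrightarrow> \<bar>f y - f x - g \<bullet> (y - x)\<bar> \<le> \<eta> * norm (y - x)"
  shows "norm (F x - g) \<le> \<eta>"
proof -
  \<comment> \<open>Testing in the direction of the error itself leads to
    \<open>norm e * norm e \<le> \<eta> * norm e\<close>.\<close>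
  define e where "e = F x - g"
  have "((\<lambda>t. \<bar>(f (x + t *\<^sub>R e) - f x) / t - g \<bullet> e\<bar>) \<longlongrightarrow> \<bar>F x \<bullet> e - g \<bullet> e\<bar>) (at 0)"
    by (intro tendsto_intros has_cont_grad_directional[OF f])
  moreover have "\<forall>\<^sub>F t in at 0. \<bar>(f (x + t *\<^sub>R e) - f x) / t - g \<bullet> e\<bar> \<le> \<eta> * norm e"
    unfolding eventually_at
  proof (intro exI[of _ "r / (norm e + 1)"] conjI ballI impI)
    show "r / (norm e + 1) > 0" using r by (simp add: add_nonneg_pos)
    fix t :: real assume t: "t \<noteq> 0 \<and> dist t 0 < r / (norm e + 1)"
    then have "\<bar>t\<bar> * (norm e + 1) < r" by (simp add: pos_less_divide_eq add_nonneg_pos)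
    then have "x + t *\<^sub>R e \<in> ball x r" by (simp add: dist_norm distrib_left)
    from b[OF this] have "\<bar>f (x + t *\<^sub>R e) - f x - t * (g \<bullet> e)\<bar> \<le> \<bar>t\<bar> * (\<eta> * norm e)"
      by (simp add: mult_ac)
    moreover have "(f (x + t *\<^sub>R e) - f x) / t - g \<bullet> e = (f (x + t *\<^sub>R e) - f x - t * (g \<bullet> e)) / t"
      using t by (simp add: diff_divide_distrib)
    ultimately show "\<bar>(f (x + t *\<^sub>R e) - f x) / t - g \<bullet> e\<bar> \<le> \<eta> * norm e"
      using t by (simp add: abs_divide pos_divide_le_eq mult.commute)
  qed
  ultimately have "\<bar>F x \<bullet> e - g \<bullet> e\<bar> \<le> \<eta> * norm e"
    by (rule tendsto_upperbound) simp
  then have "norm e * norm e \<le> \<eta> * norm e"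
    unfolding e_def by (simp add: inner_diff_left[symmetric] dot_square_norm power2_eq_square)
  then show ?thesis
    by (cases "e = 0") (use \<eta> in \<open>auto simp: e_def\<close>)
qed

text \<open>The strict estimate on the ball about \<open>x\<close> holds for all relevant translates
  of points near \<open>w\<close>, hence for mollified increments, and these bound the gradient. The
  condition on \<open>r\<close> keeps the translates inside the ball.\<close>

lemma mollify_grad_close:
  assumes "0 < \<epsilon>" "continuous_on UNIV v" "has_cont_grad (mollify \<epsilon> v) G" "0 \<le> \<eta>" "dist w x + \<epsilon> < r"
    and b: "\<And>y z. y \<in> ball x r \<Longrightarrow> z \<in> ball x r \<Longrightarrow> \<bar>v y - v z - g \<bullet> (y - z)\<bar> \<le> \<eta> * norm (y - z)"
  shows "norm (G w - g) \<le> \<eta>"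
proof (rule grad_bound_of_increment_bound[OF assms(3) _ assms(4)])
  show "0 < r - dist w x - \<epsilon>" using assms(5) by simp
  fix y assume y: "y \<in> ball w (r - dist w x - \<epsilon>)"
  show "\<bar>mollify \<epsilon> v y - mollify \<epsilon> v w - g \<bullet> (y - w)\<bar> \<le> \<eta> * norm (y - w)"
  proof (rule mollify_increment[OF assms(1,2)])
    fix u :: 'a assume u: "norm u < \<epsilon>"
    have "dist (y - u) x \<le> dist y w + dist w x + norm u"
      using norm_triangle_ineq[of "(y - w) + (w - x)" "- u"] norm_triangle_ineq[of "y - w" "w - x"]
      by (simp add: dist_norm algebra_simps)
    then have 1: "y - u \<in> ball x r" using y u by (simp add: dist_commute)
    have "dist (w - u) x \<le> dist w x + norm u"
      using norm_triangle_ineq[of "w - x" "- u"] by (simp add: dist_norm algebra_simps)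
    then have 2: "w - u \<in> ball x r" using u assms(5) by (simp add: dist_commute)
    show "\<bar>v (y - u) - v (w - u) - g \<bullet> (y - w)\<bar> \<le> \<eta> * norm (y - w)"
      using b[OF 1 2] by simp
  qed
qed

text \<open>Evaluating \<open>v\<close> at a point pushed away from \<open>x0\<close> shrinks its
  support towards \<open>x0\<close>. By convexity this leaves a margin proportional to the
  shrinking, into which mollification may spread.\<close>

lemma smooth_approximation:
  fixes v :: "'a::euclidean_space \<Rightarrow> real"
  assumes U: "open U" "convex U" "bounded U" "U \<noteq> {}"
    and L: "0 \<le> L" "\<And>x y. \<bar>v x - v y\<bar> \<le> L * norm (x - y)" and v0: "\<And>x. x \<notin> U \<Longrightarrow> v x = 0"
  obtains \<phi> C where "\<And>n. test_function U (\<phi> n)"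
    "0 \<le> C" "\<And>n x. \<bar>\<phi> n x - v x\<bar> \<le> C * inverse (real (Suc n))"
    "\<And>n x. norm (grad (\<phi> n) x) \<le> 2 * L"
    "\<And>x g. strict_grad v x g \<Longrightarrow> (\<lambda>n. grad (\<phi> n) x) \<longlonglongrightarrow> g"
proof -
  obtain x0 r where x0: "r > 0" "ball x0 r \<subseteq> U" using U(1,4) open_contains_ball by blast
  obtain B where B: "B > 0" "\<And>x. x \<in> U \<Longrightarrow> dist x0 x \<le> B"
  proof -
    obtain b where "\<And>x. x \<in> U \<Longrightarrow> dist x0 x \<le> b" using U(3) bounded_any_center[of U x0] by blast
    then have "\<And>x. x \<in> U \<Longrightarrow> dist x0 x \<le> \<bar>b\<bar> + 1" by (meson abs_ge_self le_add_same_cancel1 order_trans zero_le_one)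
    then show thesis using that[of "\<bar>b\<bar> + 1"] by (simp add: add_nonneg_pos)
  qed
  define h where "h n = inverse (real (Suc n))" for n
  have h: "0 < h n" "h n \<le> 1" for n unfolding h_def by (auto simp: field_simps)
  have h0: "h \<longlonglongrightarrow> 0" unfolding h_def[abs_def] by (rule LIMSEQ_inverse_real_of_nat)
  \<comment> \<open>The ball of radius \<open>r\<close> about \<open>x0\<close> lies in
    \<open>U\<close>. With this radius every mollification shift, divided by \<open>h n\<close>, has
    norm at most \<open>r / 2\<close>.\<close>
  define \<epsilon> where "\<epsilon> n = r * h n / 2" for n
  have \<epsilon>: "0 < \<epsilon> n" for n unfolding \<epsilon>_def using x0(1) h(1)[of n] by simp
  define w where "w n x = - h n *\<^sub>R x0 + (1 + h n) *\<^sub>R x" for n x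
  have wx: "w n x - x = h n *\<^sub>R (x - x0)" for n x unfolding w_def by (simp add: algebra_simps)
  define \<phi> where "\<phi> n x = mollify (\<epsilon> n) v (w n x)" for n x
  have cv: "continuous_on UNIV v"
  proof (rule lipschitz_on_continuous_on)
    show "L-lipschitz_on UNIV v" using L by (intro lipschitz_onI) (auto simp: dist_norm)
  qed
  have bv: "bounded {x. v x \<noteq> 0}" using U(3) v0 by (blast intro: bounded_subset)
  have "\<exists>G. has_cont_grad (mollify (\<epsilon> n) v) G" for n by (rule mollify_has_cont_grad[OF \<epsilon> cv bv])
  then obtain G where G: "\<And>n. has_cont_grad (mollify (\<epsilon> n) v) (G n)" by metis
  have c: "has_cont_grad (\<phi> n) (\<lambda>x. (1 + h n) *\<^sub>R G n (w n x))" for n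
    unfolding \<phi>_def w_def by (rule has_cont_grad_dilation[OF G])
  have gr: "grad (\<phi> n) x = (1 + h n) *\<^sub>R G n (w n x)" for n x
    using has_cont_grad_grad[OF c] by metis
  have supp: "\<exists>K. compact K \<and> K \<subseteq> U \<and> {x. \<phi> n x \<noteq> 0} \<subseteq> K" for n
  proof -
    define K where "K = (\<lambda>u. (1 / (1 + h n)) *\<^sub>R (u + h n *\<^sub>R x0)) ` {y + z |y z. y \<in> closure U \<and> z \<in> cball 0 (\<epsilon> n)}"
    have "compact {y + z |y z. y \<in> closure U \<and> z \<in> cball (0::'a) (\<epsilon> n)}"
      by (rule compact_sums) (use U(3) compact_closure in auto)
    then have "compact K" unfolding K_def
      by (rule compact_continuous_image[rotated]) (intro continuous_intros)
    moreover have "K \<subseteq> U"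
    proof
      fix x assume "x \<in> K"
      then obtain y z where yz: "y \<in> closure U" "norm z \<le> \<epsilon> n"
        and x: "x = (1 / (1 + h n)) *\<^sub>R (y + z + h n *\<^sub>R x0)" unfolding K_def by auto
      \<comment> \<open>With \<open>e = h n / (1 + h n)\<close>, the point \<open>x\<close> is the
        convex combination of \<open>y\<close> and \<open>q\<close> with weights
        \<open>1 - e\<close> and \<open>e\<close>. As \<open>q\<close> is interior and
        \<open>y\<close> lies in the closure, \<open>x\<close> lies in \<open>U\<close>.\<close>
      define q where "q = x0 + (1 / h n) *\<^sub>R z"
      define e where "e = h n / (1 + h n)"
      have e: "0 < e" "e \<le> 1" "1 - e = 1 / (1 + h n)" "e * (1 / h n) = 1 / (1 + h n)"
        unfolding e_def using h[of n] by (auto simp: field_simps)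
      have "norm ((1 / h n) *\<^sub>R z) \<le> r / 2"
        using yz(2) h(1)[of n] unfolding \<epsilon>_def by (simp add: field_simps)
      then have "norm ((1 / h n) *\<^sub>R z) < r" using x0(1) by linarith
      then have "q \<in> ball x0 r" unfolding q_def by (simp add: dist_norm del: norm_scaleR)
      then have "q \<in> interior U" using x0(2) U(1) interior_open by blast
      from mem_interior_closure_convex_shrink[OF U(2) this yz(1) e(1,2)]
      have "y - e *\<^sub>R (y - q) \<in> U" using interior_subset by blast
      moreover have "y - e *\<^sub>R (y - q) = (1 - e) *\<^sub>R y + e *\<^sub>R x0 + (e * (1 / h n)) *\<^sub>R z"
        unfolding q_def by (simp add: algebra_simps)
      moreover have "\<dots> = x" unfolding e x by (simp add: e_def scaleR_add_right)
      ultimately show "x \<in> U" by simp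
    qed
    moreover have "{x. \<phi> n x \<noteq> 0} \<subseteq> K"
    proof
      fix x assume "x \<in> {x. \<phi> n x \<noteq> 0}"
      then obtain y where y: "dist (w n x) y < \<epsilon> n" "v y \<noteq> 0"
        using mollify_nonzero[OF \<epsilon>] unfolding \<phi>_def by blast
      have "y \<in> closure U" using y(2) v0 closure_subset[of U] by blast
      moreover have "w n x = y + (w n x - y)" "w n x - y \<in> cball 0 (\<epsilon> n)"
        using y(1) by (auto simp: dist_norm norm_minus_commute)
      ultimately have "w n x \<in> {y + z |y z. y \<in> closure U \<and> z \<in> cball 0 (\<epsilon> n)}" by blast
      moreover have "x = (1 / (1 + h n)) *\<^sub>R (w n x + h n *\<^sub>R x0)"
        unfolding w_def using h(1)[of n] by simp
      ultimately show "x \<in> K" unfolding K_def by (rule rev_image_eqI)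
    qed
    ultimately show ?thesis by blast
  qed
  have tf: "test_function U (\<phi> n)" for n
  proof -
    obtain K where K: "compact K" "K \<subseteq> U" "{x. \<phi> n x \<noteq> 0} \<subseteq> K" using supp by blast
    then show ?thesis using test_functionI_compact[OF c] by blast
  qed
  \<comment> \<open>The approximation samples \<open>v\<close> within distance
    \<open>\<epsilon> n + h n * B\<close> of \<open>x\<close>, which is
    \<open>(B + r / 2) * h n\<close>.\<close>
  define C where "C = L * (B + r / 2)"
  have close: "\<bar>\<phi> n x - v x\<bar> \<le> C * inverse (real (Suc n))" for n x
  proof (cases "x \<in> U")
    case False
    then show ?thesis using test_function_outside[OF tf] v0 L(1) B(1) x0(1) unfolding C_def by simp
  next
    case True
    have "\<bar>mollify (\<epsilon> n) v (w n x) - v x\<bar> \<le> L * (\<epsilon> n + h n * B)"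
    proof (rule mollify_close[OF \<epsilon> cv])
      fix y assume y: "dist y (w n x) < \<epsilon> n"
      have "norm (w n x - x) \<le> h n * B"
        unfolding wx using B(2)[OF True] h(1)[of n] by (simp add: dist_norm norm_minus_commute)
      then have "norm (y - x) \<le> \<epsilon> n + h n * B"
        using y norm_triangle_ineq[of "y - w n x" "w n x - x"] by (simp add: dist_norm)
      then show "\<bar>v y - v x\<bar> \<le> L * (\<epsilon> n + h n * B)"
        using L(2)[of y x] mult_left_mono[OF _ L(1)] by (meson order_trans)
    qed
    also have "\<dots> = C * inverse (real (Suc n))" unfolding C_def \<epsilon>_def h_def by (simp add: algebra_simps)
    finally show ?thesis unfolding \<phi>_def .
  qed
  have bound: "norm (grad (\<phi> n) x) \<le> 2 * L" for n x
  proof -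
    \<comment> \<open>The global Lipschitz bound is the strict estimate with \<open>g = 0\<close> on
      a ball of any radius. The dilation then contributes the factor \<open>1 + h n\<close>, at most
      2.\<close>
    have "norm (G n (w n x) - 0) \<le> L"
      by (rule mollify_grad_close[OF \<epsilon> cv G L(1), where x="w n x" and r="\<epsilon> n + 1"])
        (use L(2) \<epsilon>[of n] in auto)
    then have "(1 + h n) * norm (G n (w n x)) \<le> 2 * L" using h[of n] by (intro mult_mono) auto
    then show ?thesis unfolding gr using h(1)[of n] by simp
  qed
  have lim: "(\<lambda>n. grad (\<phi> n) x) \<longlonglongrightarrow> g" if "strict_grad v x g" for x g
  proof -
    have "(\<lambda>n. G n (w n x)) \<longlonglongrightarrow> g"
      unfolding LIMSEQ_iff
    proof (intro allI impI)
      fix e :: real assume e: "0 < e"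
      then obtain \<rho> where \<rho>: "\<rho> > 0" "\<And>y z. y \<in> ball x \<rho> \<Longrightarrow> z \<in> ball x \<rho> \<Longrightarrow>
          \<bar>v y - v z - g \<bullet> (y - z)\<bar> \<le> (e / 2) * norm (y - z)"
        using \<open>strict_grad v x g\<close> unfolding strict_grad_def by (meson half_gt_zero)
      have "(\<lambda>n. h n * norm (x - x0) + r * h n / 2) \<longlonglongrightarrow> 0 * norm (x - x0) + r * 0 / 2"
        by (intro tendsto_intros h0) simp
      then have "\<forall>\<^sub>F n in sequentially. h n * norm (x - x0) + r * h n / 2 < \<rho>"
        using \<rho>(1) by (intro order_tendstoD(2)) auto
      then obtain N where N: "\<And>n. n \<ge> N \<Longrightarrow> h n * norm (x - x0) + \<epsilon> n < \<rho>"
        unfolding eventually_sequentially \<epsilon>_def by blast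
      have "norm (G n (w n x) - g) < e" if "n \<ge> Suc N" for n
      proof -
        have "norm (G n (w n x) - g) \<le> e / 2"
        proof (rule mollify_grad_close[OF \<epsilon> cv G])
          show "dist (w n x) x + \<epsilon> n < \<rho>" using N[of n] that h(1)[of n] by (simp add: dist_norm wx)
        qed (use e \<rho>(2) in auto)
        then show ?thesis using e by simp
      qed
      then show "\<exists>no. \<forall>n\<ge>no. norm (G n (w n x) - g) < e" by blast
    qed
    moreover have "(\<lambda>n. 1 + h n) \<longlonglongrightarrow> 1 + 0" by (intro tendsto_intros h0)
    ultimately have "(\<lambda>n. (1 + h n) *\<^sub>R G n (w n x)) \<longlonglongrightarrow> (1 + 0) *\<^sub>R g" by (rule tendsto_scaleR[rotated])
    then show ?thesis unfolding gr by simp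
  qed
  have "0 \<le> C" unfolding C_def using L(1) B(1) x0(1) by simp
  then show thesis using that tf close bound lim by blast
qed

text \<open>Uniform convergence of values and bounded convergence of gradients off a null set let
  the weak identity pass to the limit. The limit gradient so identified serves to evaluate the norm
  of the error, again by dominated convergence.\<close>

lemma H1_limit:
  fixes v :: "'a::euclidean_space \<Rightarrow> real"
  assumes U: "open U" "bounded U" and Z: "Z \<in> null_sets lborel"
    and cv: "continuous_on UNIV v" and v0: "\<And>x. x \<notin> U \<Longrightarrow> v x = 0"
    and \<phi>: "\<And>n. test_function U (\<phi> n)"
    and C: "\<And>n x. \<bar>\<phi> n x - v x\<bar> \<le> C * inverse (real (Suc n))"
    and B: "\<And>n x. norm (grad (\<phi> n) x) \<le> B"
    and lim: "\<And>x. x \<notin> Z \<Longrightarrow> (\<lambda>n. grad (\<phi> n) x) \<longlonglongrightarrow> g x"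
  shows "v \<in> H1 U" "(\<lambda>n. H1_norm U (\<lambda>x. \<phi> n x - v x)) \<longlonglongrightarrow> 0"
proof -
  \<comment> \<open>Nothing is known of \<open>g\<close> on \<open>Z\<close>. Setting it to zero
    there makes \<open>g'\<close> a limit of measurable functions at every point, hence
    measurable.\<close>
  define g' where "g' x = (if x \<in> Z then 0 else g x)" for x
  have Zm[measurable]: "Z \<in> sets borel" using Z by (auto simp: null_sets_def)
  have Um[measurable]: "U \<in> sets borel" using U by simp
  have vm[measurable]: "v \<in> borel_measurable borel" using cv by (rule borel_measurable_continuous_onI)
  have pm[measurable]: "\<phi> n \<in> borel_measurable borel" "grad (\<phi> n) \<in> borel_measurable borel" for n
    using borel_measurable_continuous_onI test_function_continuous[OF \<phi>] grad_continuous[OF \<phi>] by auto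
  have lim': "(\<lambda>n. if x \<in> Z then 0 else grad (\<phi> n) x) \<longlonglongrightarrow> g' x" for x
    using lim[of x] unfolding g'_def by auto
  have gm[measurable]: "g' \<in> borel_measurable borel"
    by (rule borel_measurable_LIMSEQ_metric[OF _ lim']) measurable
  have B0: "0 \<le> B" using order_trans[OF norm_ge_zero B] .
  have gB: "norm (g' x) \<le> B" for x
    by (rule LIMSEQ_le_const2[OF tendsto_norm[OF lim'[of x]]]) (use B B0 in auto)
  have AEZ: "AE x in lborel. x \<notin> Z" using Z by (rule AE_not_in)
  have finU: "emeasure lborel U < \<infinity>" using emeasure_bounded_finite[OF U(2)] .
  have iU: "integrable lborel (\<lambda>x. c * indicator U x)" for c :: real
    using finU by (intro integrable_mult_right integrable_real_indicator) auto
  have "bounded (v ` closure U)"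
    using U(2) by (intro compact_imp_bounded compact_continuous_image continuous_on_subset[OF cv]) auto
  then obtain V where V: "\<And>x. x \<in> closure U \<Longrightarrow> \<bar>v x\<bar> \<le> V" unfolding bounded_iff by auto
  have V': "\<bar>v x\<bar> \<le> max V 0" for x using V[of x] v0[of x] closure_subset[of U] by (cases "x \<in> U") auto
  have C0: "0 \<le> C" using order_trans[OF abs_ge_zero C[of 0]] by simp
  have inv1: "inverse (real (Suc n)) \<le> 1" for n by (simp add: field_simps)
  have CC: "\<bar>\<phi> n x - v x\<bar> \<le> C" for n x
    using order_trans[OF C[of n x] mult_left_mono[OF inv1 C0]] by simp
  have lim_phi: "(\<lambda>n. \<phi> n x) \<longlonglongrightarrow> v x" for x
  proof (rule LIM_zero_cancel, rule Lim_null_comparison)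
    show "\<forall>\<^sub>F n in sequentially. norm (\<phi> n x - v x) \<le> C * inverse (real (Suc n))"
      using C by auto
    show "(\<lambda>n. C * inverse (real (Suc n))) \<longlonglongrightarrow> 0"
      using tendsto_mult_right_zero[OF LIMSEQ_inverse_real_of_nat] .
  qed
  have sv: "square_integrable_on U v"
    by (rule square_integrable_on_continuous[OF U(1) cv]) (use U(2) v0 in \<open>auto intro: bounded_subset\<close>)
  have bsq: "integrable lborel (\<lambda>x. indicator U x *\<^sub>R f x)"
    if "f \<in> borel_measurable borel" "\<And>x. \<bar>f x\<bar> \<le> c" for f :: "'a \<Rightarrow> real" and c
    by (rule Bochner_Integration.integrable_bound[OF iU[of c]])
      (use that in \<open>auto simp: indicator_def intro: order_trans[OF _ abs_ge_self]\<close>)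
  have sg: "square_integrable_on U g'"
    unfolding square_integrable_on_def set_borel_measurable_def set_integrable_def
  proof
    show "integrable lborel (\<lambda>x. indicat_real U x *\<^sub>R (norm (g' x))\<^sup>2)"
      by (rule bsq[where c="B\<^sup>2"]) (use gB in \<open>auto intro!: power_mono\<close>)
  qed measurable
  have wg: "is_weak_gradient U v g'"
    unfolding is_weak_gradient_def
  proof (intro conjI allI impI ballI sg)
    fix \<psi> and e :: 'a assume \<psi>: "test_function U \<psi>" and e: "e \<in> Basis"
    have m[measurable]: "\<psi> \<in> borel_measurable borel" "grad \<psi> \<in> borel_measurable borel"
      using borel_measurable_continuous_onI test_function_continuous[OF \<psi>] grad_continuous[OF \<psi>] by auto
    have i: "integrable lborel \<psi>" "integrable lborel (grad \<psi>)"
      using integrable_compact_support test_function_continuous[OF \<psi>] grad_continuous[OF \<psi>]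
        test_function_bounded_support[OF \<psi>] grad_bounded_support[OF \<psi>] by blast+
    have 1: "(\<lambda>n. LINT x:U|lborel. \<phi> n x * (grad \<psi> x \<bullet> e)) \<longlonglongrightarrow> (LINT x:U|lborel. v x * (grad \<psi> x \<bullet> e))"
      unfolding set_lebesgue_integral_def
    proof (rule integral_dominated_convergence[where w="\<lambda>x. (C + max V 0) * norm (grad \<psi> x)"])
      show "integrable lborel (\<lambda>x. (C + max V 0) * norm (grad \<psi> x))" using i(2) by simp
      show "AE x in lborel. (\<lambda>n. indicat_real U x *\<^sub>R (\<phi> n x * (grad \<psi> x \<bullet> e)))
          \<longlonglongrightarrow> indicat_real U x *\<^sub>R (v x * (grad \<psi> x \<bullet> e))"
        by (intro AE_I2 tendsto_intros lim_phi)
      show "AE x in lborel. norm (indicat_real U x *\<^sub>R (\<phi> n x * (grad \<psi> x \<bullet> e))) \<le> (C + max V 0) * norm (grad \<psi> x)" for n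
      proof (rule AE_I2)
        fix x
        have "\<bar>\<phi> n x\<bar> \<le> C + max V 0" using CC[of n x] V'[of x] by linarith
        moreover have "\<bar>grad \<psi> x \<bullet> e\<bar> \<le> norm (grad \<psi> x)" using Basis_le_norm[OF e] .
        ultimately have "\<bar>\<phi> n x\<bar> * \<bar>grad \<psi> x \<bullet> e\<bar> \<le> (C + max V 0) * norm (grad \<psi> x)"
          by (intro mult_mono) (use C0 in auto)
        moreover have "0 \<le> (C + max V 0) * norm (grad \<psi> x)" using C0 by simp
        ultimately show "norm (indicat_real U x *\<^sub>R (\<phi> n x * (grad \<psi> x \<bullet> e))) \<le> (C + max V 0) * norm (grad \<psi> x)"
          by (simp add: indicator_def abs_mult)
      qed
    qed measurable
    have 2: "(\<lambda>n. LINT x:U|lborel. (grad (\<phi> n) x \<bullet> e) * \<psi> x) \<longlonglongrightarrow> (LINT x:U|lborel. (g' x \<bullet> e) * \<psi> x)"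
      unfolding set_lebesgue_integral_def
    proof (rule integral_dominated_convergence[where w="\<lambda>x. B * \<bar>\<psi> x\<bar>"])
      show "integrable lborel (\<lambda>x. B * \<bar>\<psi> x\<bar>)" using i(1) by simp
      show "AE x in lborel. (\<lambda>n. indicat_real U x *\<^sub>R ((grad (\<phi> n) x \<bullet> e) * \<psi> x))
          \<longlonglongrightarrow> indicat_real U x *\<^sub>R ((g' x \<bullet> e) * \<psi> x)"
        using AEZ
      proof eventually_elim
        case (elim x)
        then have "(\<lambda>n. grad (\<phi> n) x) \<longlonglongrightarrow> g' x" using lim unfolding g'_def by simp
        then show ?case by (intro tendsto_intros)
      qed
      show "AE x in lborel. norm (indicat_real U x *\<^sub>R ((grad (\<phi> n) x \<bullet> e) * \<psi> x)) \<le> B * \<bar>\<psi> x\<bar>" for n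
      proof (rule AE_I2)
        fix x
        have "\<bar>grad (\<phi> n) x \<bullet> e\<bar> \<le> B" using order_trans[OF Basis_le_norm[OF e] B] .
        then have "\<bar>grad (\<phi> n) x \<bullet> e\<bar> * \<bar>\<psi> x\<bar> \<le> B * \<bar>\<psi> x\<bar>" by (intro mult_right_mono) auto
        then show "norm (indicat_real U x *\<^sub>R ((grad (\<phi> n) x \<bullet> e) * \<psi> x)) \<le> B * \<bar>\<psi> x\<bar>"
          using B0 by (simp add: indicator_def abs_mult)
      qed
    qed measurable
    have "(LINT x:U|lborel. \<phi> n x * (grad \<psi> x \<bullet> e)) = - (LINT x:U|lborel. (grad (\<phi> n) x \<bullet> e) * \<psi> x)" for n
      using is_weak_gradient_test_function[OF U(1) \<phi>, of n] \<psi> e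
      unfolding is_weak_gradient_def test_function_frechet[OF \<psi>, symmetric] by blast
    then have "(LINT x:U|lborel. v x * (grad \<psi> x \<bullet> e)) = - (LINT x:U|lborel. (g' x \<bullet> e) * \<psi> x)"
      using LIMSEQ_unique[OF 1] tendsto_minus[OF 2] by simp
    then show "(LINT x:U|lborel. v x * frechet_derivative \<psi> (at x) e) = - (LINT x:U|lborel. (g' x \<bullet> e) * \<psi> x)"
      unfolding test_function_frechet[OF \<psi>] .
  qed
  show "v \<in> H1 U" using sv wg unfolding H1_def by blast
  have sq: "(H1_norm U (\<lambda>x. \<phi> n x - v x))\<^sup>2
      = (LINT x:U|lborel. (\<phi> n x - v x)\<^sup>2 + (norm (grad (\<phi> n) x - g' x))\<^sup>2)" for n
  proof -
    have s: "square_integrable_on U (\<phi> n)" by (rule test_function_square_integrable(1)[OF U(1) \<phi>])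
    have "square_integrable_on U (\<lambda>x. \<phi> n x - v x)" using square_integrable_on_lincomb[OF s sv, of 1 "-1"] by simp
    moreover have "is_weak_gradient U (\<lambda>x. \<phi> n x - v x) (\<lambda>x. grad (\<phi> n) x - g' x)"
      using is_weak_gradient_lincomb[OF U(1) s sv is_weak_gradient_test_function[OF U(1) \<phi>] wg, of 1 "-1"] by simp
    ultimately show ?thesis by (rule H1_norm_eq(1)[OF U])
  qed
  let ?q = "\<lambda>n x. (\<phi> n x - v x)\<^sup>2 + (norm (grad (\<phi> n) x - g' x))\<^sup>2"
  have "(\<lambda>n. LINT x:U|lborel. ?q n x)
      \<longlonglongrightarrow> (LINT x|(lborel :: 'a measure). (0::real))"
    unfolding set_lebesgue_integral_def
  \<comment> \<open>The error of the values is at most \<open>C\<close>, since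
    \<open>inverse (real (Suc n)) \<le> 1\<close>, and both gradients have norm at most
    \<open>B\<close>.\<close>
  proof (rule integral_dominated_convergence[where w="\<lambda>x. (C\<^sup>2 + (2 * B)\<^sup>2) * indicator U x"])
    show "AE x in lborel. (\<lambda>n. indicat_real U x *\<^sub>R (?q n x)) \<longlonglongrightarrow> 0"
      using AEZ
    proof eventually_elim
      case (elim x)
      then have l: "(\<lambda>n. grad (\<phi> n) x) \<longlonglongrightarrow> g' x" using lim unfolding g'_def by simp
      have "(\<lambda>n. indicat_real U x *\<^sub>R (?q n x))
          \<longlonglongrightarrow> indicat_real U x *\<^sub>R ((v x - v x)\<^sup>2 + (norm (g' x - g' x))\<^sup>2)"
        by (intro tendsto_intros l lim_phi)
      then show ?case by simp
    qed
    show "AE x in lborel. norm (indicat_real U x *\<^sub>R (?q n x))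
        \<le> (C\<^sup>2 + (2 * B)\<^sup>2) * indicator U x" for n
    proof (rule AE_I2)
      fix x
      have "(\<phi> n x - v x)\<^sup>2 \<le> C\<^sup>2" using power_mono[OF CC[of n x], of 2] by simp
      moreover have "norm (grad (\<phi> n) x - g' x) \<le> 2 * B"
        using norm_triangle_ineq4[of "grad (\<phi> n) x" "g' x"] B[of n x] gB[of x] by linarith
      then have "(norm (grad (\<phi> n) x - g' x))\<^sup>2 \<le> (2 * B)\<^sup>2" by (intro power_mono) auto
      ultimately show "norm (indicat_real U x *\<^sub>R (?q n x))
        \<le> (C\<^sup>2 + (2 * B)\<^sup>2) * indicator U x" by (simp add: indicator_def)
    qed
  qed (measurable, rule iU)
  then have "(\<lambda>n. (H1_norm U (\<lambda>x. \<phi> n x - v x))\<^sup>2) \<longlonglongrightarrow> 0" unfolding sq by simp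
  from tendsto_real_sqrt[OF this]
  show "(\<lambda>n. H1_norm U (\<lambda>x. \<phi> n x - v x)) \<longlonglongrightarrow> 0" by (simp add: H1_norm_nonneg)
qed

section \<open>Finite element functions\<close>

text \<open>A segment is covered by finitely many closed pieces, one for each tetrahedron and one
  for the complement of \<Omega>, on which \<open>v\<close> is polynomial or zero. The covering
  lemma on the parameter interval joins the local bounds.\<close>

lemma fe_space_lipschitz:
  assumes mesh: "tetrahedral_mesh \<Omega> \<T>" and v: "v \<in> fe_space k \<Omega> \<T>" and "open \<Omega>"
  obtains L where "0 \<le> L" "\<And>x y. \<bar>v x - v y\<bar> \<le> L * norm (x - y)"
proof -
  have T: "finite \<T>" "\<And>K. K \<in> \<T> \<Longrightarrow> 3 simplex K" "\<Union>\<T> = closure \<Omega>"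
    using mesh unfolding tetrahedral_mesh_def triangulation_def by auto
  have cv: "continuous_on UNIV v" and v0: "\<And>x. x \<notin> \<Omega> \<Longrightarrow> v x = 0"
    and vp: "\<And>K. K \<in> \<T> \<Longrightarrow> \<exists>p. polynomial3 k p \<and> (\<forall>x\<in>K. v x = p x)"
    using v unfolding fe_space_def by auto
  have "\<exists>l. \<forall>x\<in>K. \<forall>y\<in>K. \<bar>v x - v y\<bar> \<le> l * norm (x - y)" if K: "K \<in> \<T>" for K
  proof -
    obtain p where p: "polynomial3 k p" "\<And>x. x \<in> K \<Longrightarrow> v x = p x" using vp[OF K] by blast
    obtain G where "has_cont_grad p G" using polynomial3_has_cont_grad[OF p(1)] by blast
    from lipschitz_on_compact_convex[OF this convex_simplex[OF T(2)[OF K]] compact_simplex[OF T(2)[OF K]]]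
    obtain l where "\<And>x y. x \<in> K \<Longrightarrow> y \<in> K \<Longrightarrow> \<bar>p x - p y\<bar> \<le> l * norm (x - y)" by blast
    then show ?thesis using p(2) by auto
  qed
  then obtain l where l: "\<And>K x y. K \<in> \<T> \<Longrightarrow> x \<in> K \<Longrightarrow> y \<in> K \<Longrightarrow> \<bar>v x - v y\<bar> \<le> l K * norm (x - y)"
    by metis
  \<comment> \<open>The sum dominates every local constant; the absolute values are there because
    the local constants carry no sign.\<close>
  define L where "L = (\<Sum>K\<in>\<T>. \<bar>l K\<bar>)"
  have L0: "0 \<le> L" unfolding L_def by (simp add: sum_nonneg)
  have lL: "l K \<le> L" if "K \<in> \<T>" for K
    using member_le_sum[of K \<T> "\<lambda>K. \<bar>l K\<bar>"] that T(1) unfolding L_def by auto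
  have "\<bar>v x - v y\<bar> \<le> L * norm (x - y)" for x y
  proof -
    define \<gamma> where "\<gamma> t = y + t *\<^sub>R (x - y)" for t
    have cont: "continuous_on UNIV \<gamma>" unfolding \<gamma>_def by (intro continuous_intros)
    have d: "norm (\<gamma> s - \<gamma> t) = \<bar>s - t\<bar> * norm (x - y)" for s t
      unfolding \<gamma>_def by (simp add: scaleR_diff_left[symmetric])
    let ?C = "insert (\<gamma> -` (- \<Omega>)) ((\<lambda>K. \<gamma> -` K) ` \<T>)"
    have "\<bar>v (\<gamma> 1) - v (\<gamma> 0)\<bar> \<le> (L * norm (x - y)) * (1 - 0)"
    proof (rule lipschitz_of_finite_closed_cover[where \<C>="?C"])
      show "finite ?C" using T(1) by simp
      show "closed C" if "C \<in> ?C" for C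
        using that assms(3) closed_simplex[OF T(2)] cont
        by (auto intro!: closed_vimage simp: continuous_on_eq_continuous_at)
      have "\<exists>K\<in>\<T>. \<gamma> t \<in> K" if "\<gamma> t \<in> \<Omega>" for t
        using that T(3) closure_subset[of \<Omega>] by blast
      then show "{0..1} \<subseteq> \<Union>?C" by auto
      show "\<bar>v (\<gamma> s) - v (\<gamma> t)\<bar> \<le> L * norm (x - y) * \<bar>s - t\<bar>" if C: "C \<in> ?C" "s \<in> C" "t \<in> C" for C s t
      proof (cases "C = \<gamma> -` (- \<Omega>)")
        case True
        then have "v (\<gamma> s) = 0" "v (\<gamma> t) = 0" using C v0 by auto
        then show ?thesis using L0 by simp
      next
        case False
        then obtain K where K: "K \<in> \<T>" "\<gamma> s \<in> K" "\<gamma> t \<in> K" using C by auto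
        have "\<bar>v (\<gamma> s) - v (\<gamma> t)\<bar> \<le> l K * norm (\<gamma> s - \<gamma> t)" using l[OF K] .
        also have "\<dots> \<le> L * norm (\<gamma> s - \<gamma> t)" using lL[OF K(1)] by (intro mult_right_mono) auto
        finally show ?thesis by (simp add: d mult_ac)
      qed
    qed simp
    then show ?thesis unfolding \<gamma>_def by simp
  qed
  then show thesis using that L0 by blast
qed

lemma frontier_null_set:
  fixes C :: "'a::euclidean_space set"
  assumes "convex C"
  shows "frontier C \<in> null_sets lborel"
proof -
  have "frontier C \<in> null_sets (completion lborel)"
    using negligible_convex_frontier[OF assms] negligible_iff_null_sets by blast
  then show ?thesis by (subst (asm) null_sets_completion_iff) auto
qed

text \<open>The exceptional set consists of the boundaries of the tetrahedra, null as frontiers of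
  convex sets. Any other point of the closed domain is interior to a tetrahedron, and off the closed
  domain \<open>v\<close> is locally zero.\<close>

lemma fe_space_strict_grad:
  assumes mesh: "tetrahedral_mesh \<Omega> \<T>" and v: "v \<in> fe_space k \<Omega> \<T>" and "convex \<Omega>"
  obtains Z g where "Z \<in> null_sets lborel" "\<And>x. x \<notin> Z \<Longrightarrow> strict_grad v x (g x)"
proof -
  have T: "finite \<T>" "\<And>K. K \<in> \<T> \<Longrightarrow> 3 simplex K" "\<Union>\<T> = closure \<Omega>"
    using mesh unfolding tetrahedral_mesh_def triangulation_def by auto
  have v0: "\<And>x. x \<notin> \<Omega> \<Longrightarrow> v x = 0"
    and vp: "\<And>K. K \<in> \<T> \<Longrightarrow> \<exists>p. polynomial3 k p \<and> (\<forall>x\<in>K. v x = p x)"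
    using v unfolding fe_space_def by auto
  define Z where "Z = (\<Union>K\<in>\<T>. frontier K)"
  have "Z \<in> null_sets lborel"
    unfolding Z_def using T(1) frontier_null_set[OF convex_simplex[OF T(2)]]
    by (intro null_sets.finite_UN) auto
  moreover have "\<exists>g. strict_grad v x g" if x: "x \<notin> Z" for x
  proof (cases "x \<in> closure \<Omega>")
    case True
    then obtain K where K: "K \<in> \<T>" "x \<in> K" using T(3) by blast
    have "closed K" using closed_simplex T(2) K(1) by blast
    then have int: "x \<in> interior K" using x K unfolding Z_def frontier_def by (auto simp: closure_closed)
    obtain p where p: "polynomial3 k p" "\<And>x. x \<in> K \<Longrightarrow> v x = p x" using vp[OF K(1)] by blast
    obtain G where "has_cont_grad p G" using polynomial3_has_cont_grad[OF p(1)] by blast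
    from strict_grad_of_has_cont_grad[OF this open_interior int] p(2) interior_subset[of K]
    show ?thesis by blast
  next
    case False
    have "strict_grad v x 0"
      by (rule strict_grad_of_has_cont_grad[OF has_cont_grad_const[of 0], where V="- closure \<Omega>"])
        (use False v0 closure_subset[of \<Omega>] in auto)
    then show ?thesis by blast
  qed
  ultimately show thesis using that by metis
qed

text \<open>Uniform convergence is recorded beside H^1 convergence because the trace of
  \<open>v\<close> will be read off from it on the surface, where volume integrals see
  nothing.\<close>

lemma fe_space_approximation:
  assumes \<Omega>: "open \<Omega>" "convex \<Omega>" "bounded \<Omega>" "\<Omega> \<noteq> {}"
    and mesh: "tetrahedral_mesh \<Omega> \<T>" and v: "v \<in> fe_space k \<Omega> \<T>"
  obtains \<phi> C where "\<And>n. test_function \<Omega> (\<phi> n)" "0 \<le> C"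
    "\<And>n x. \<bar>\<phi> n x - v x\<bar> \<le> C * inverse (real (Suc n))"
    "v \<in> H1 \<Omega>" "(\<lambda>n. H1_norm \<Omega> (\<lambda>x. \<phi> n x - v x)) \<longlonglongrightarrow> 0"
proof -
  have cv: "continuous_on UNIV v" and v0: "\<And>x. x \<notin> \<Omega> \<Longrightarrow> v x = 0"
    using v unfolding fe_space_def by auto
  obtain L where L: "0 \<le> L" "\<And>x y. \<bar>v x - v y\<bar> \<le> L * norm (x - y)"
    using fe_space_lipschitz[OF mesh v \<Omega>(1)] by blast
  obtain Z g where Z: "Z \<in> null_sets lborel" "\<And>x. x \<notin> Z \<Longrightarrow> strict_grad v x (g x)"
    using fe_space_strict_grad[OF mesh v \<Omega>(2)] by blast
  obtain \<phi> C where \<phi>: "\<And>n. test_function \<Omega> (\<phi> n)"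
    "0 \<le> C" "\<And>n x. \<bar>\<phi> n x - v x\<bar> \<le> C * inverse (real (Suc n))"
    "\<And>n x. norm (grad (\<phi> n) x) \<le> 2 * L"
    "\<And>x g. strict_grad v x g \<Longrightarrow> (\<lambda>n. grad (\<phi> n) x) \<longlonglongrightarrow> g"
    using smooth_approximation[OF \<Omega> L v0] by blast
  note lim = H1_limit[OF \<Omega>(1,3) Z(1) cv v0 \<phi>(1,3,4) \<phi>(5)[OF Z(2)]]
  show thesis using that[OF \<phi>(1,2,3) lim] .
qed

lemma fe_space_H1:
  assumes \<Omega>: "open \<Omega>" "convex \<Omega>" "bounded \<Omega>" "\<Omega> \<noteq> {}"
    and mesh: "tetrahedral_mesh \<Omega> \<T>" and v: "v \<in> fe_space k \<Omega> \<T>"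
  shows "v \<in> H1 \<Omega>" "v \<in> H1_0 \<Omega>"
proof -
  obtain \<phi> where \<phi>: "\<And>n. test_function \<Omega> (\<phi> n)" "v \<in> H1 \<Omega>"
    "(\<lambda>n. H1_norm \<Omega> (\<lambda>x. \<phi> n x - v x)) \<longlonglongrightarrow> 0"
    using fe_space_approximation[OF \<Omega> mesh v] by metis
  show "v \<in> H1 \<Omega>" by (rule \<phi>(2))
  show "v \<in> H1_0 \<Omega>" unfolding H1_0_def using \<phi> by blast
qed

text \<open>Uniform convergence against a finite measure is convergence in L^2, so one sequence of
  test functions has both limits that \<open>has_trace\<close> demands.\<close>

lemma fe_space_has_trace:
  assumes \<Omega>: "open \<Omega>" "convex \<Omega>" "bounded \<Omega>" "\<Omega> \<noteq> {}"
    and mesh: "tetrahedral_mesh \<Omega> \<T>" and v: "v \<in> fe_space k \<Omega> \<T>"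
    and M: "sets M = sets borel" "emeasure M UNIV < \<infinity>"
  shows "has_trace \<Omega> M v v"
proof -
  obtain \<phi> C where \<phi>: "\<And>n. test_function \<Omega> (\<phi> n)" "0 \<le> C"
    "\<And>n x. \<bar>\<phi> n x - v x\<bar> \<le> C * inverse (real (Suc n))"
    "v \<in> H1 \<Omega>" "(\<lambda>n. H1_norm \<Omega> (\<lambda>x. \<phi> n x - v x)) \<longlonglongrightarrow> 0"
    using fe_space_approximation[OF \<Omega> mesh v] by blast
  have cv: "continuous_on UNIV v" using v unfolding fe_space_def by auto
  have sp: "space M = UNIV" using sets_eq_imp_space_eq[OF M(1)] by simp
  have vm: "v \<in> borel_measurable M"
    using borel_measurable_continuous_onI[OF cv] measurable_cong_sets[OF M(1) refl] by blast
  define m where "m = enn2real (emeasure M UNIV)"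
  have m: "emeasure M UNIV = ennreal m" unfolding m_def using M(2) by (simp add: less_top)
  have "(\<lambda>n. \<integral>\<^sup>+x. ennreal ((\<phi> n x - v x)\<^sup>2) \<partial>M) \<longlonglongrightarrow> 0"
  proof (rule tendsto_sandwich[of "\<lambda>_. 0" _ _ "\<lambda>n. ennreal ((C * inverse (real (Suc n)))\<^sup>2 * m)"])
    show "\<forall>\<^sub>F n in sequentially. (\<integral>\<^sup>+x. ennreal ((\<phi> n x - v x)\<^sup>2) \<partial>M) \<le> ennreal ((C * inverse (real (Suc n)))\<^sup>2 * m)"
    proof (intro always_eventually allI)
      fix n
      have "(\<integral>\<^sup>+x. ennreal ((\<phi> n x - v x)\<^sup>2) \<partial>M) \<le> (\<integral>\<^sup>+x. ennreal ((C * inverse (real (Suc n)))\<^sup>2) \<partial>M)"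
      proof (intro nn_integral_mono ennreal_leI)
        show "(\<phi> n x - v x)\<^sup>2 \<le> (C * inverse (real (Suc n)))\<^sup>2" for x
          using power_mono[OF \<phi>(3)[of n x], of 2] by simp
      qed
      then show "(\<integral>\<^sup>+x. ennreal ((\<phi> n x - v x)\<^sup>2) \<partial>M) \<le> ennreal ((C * inverse (real (Suc n)))\<^sup>2 * m)"
        by (simp add: sp m ennreal_mult')
    qed
    have "(\<lambda>n. (C * inverse (real (Suc n)))\<^sup>2 * m) \<longlonglongrightarrow> (C * 0)\<^sup>2 * m"
      by (intro tendsto_intros LIMSEQ_inverse_real_of_nat)
    then show "(\<lambda>n. ennreal ((C * inverse (real (Suc n)))\<^sup>2 * m)) \<longlonglongrightarrow> 0"
      using tendsto_ennrealI by fastforce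
  qed auto
  then show ?thesis unfolding has_trace_def using vm \<phi>(1,5) by blast
qed

section \<open>Traces of differences\<close>

lemma nn_integral_square_sum_le:
  fixes f g :: "'a \<Rightarrow> real"
  assumes [measurable]: "f \<in> borel_measurable M" "g \<in> borel_measurable M"
  shows "(\<integral>\<^sup>+x. ennreal ((f x + g x)\<^sup>2) \<partial>M)
    \<le> 2 * (\<integral>\<^sup>+x. ennreal ((f x)\<^sup>2) \<partial>M) + 2 * (\<integral>\<^sup>+x. ennreal ((g x)\<^sup>2) \<partial>M)"
proof -
  have "(\<integral>\<^sup>+x. ennreal ((f x + g x)\<^sup>2) \<partial>M) \<le> (\<integral>\<^sup>+x. 2 * ennreal ((f x)\<^sup>2) + 2 * ennreal ((g x)\<^sup>2) \<partial>M)"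
  proof (rule nn_integral_mono)
    fix x
    have "ennreal ((f x + g x)\<^sup>2) \<le> ennreal (2 * (f x)\<^sup>2 + 2 * (g x)\<^sup>2)"
      using sum_squares_bound[of "f x" "g x"] by (intro ennreal_leI) (simp add: power2_sum)
    then show "ennreal ((f x + g x)\<^sup>2) \<le> 2 * ennreal ((f x)\<^sup>2) + 2 * ennreal ((g x)\<^sup>2)"
      by (simp add: ennreal_mult'')
  qed
  also have "\<dots> = 2 * (\<integral>\<^sup>+x. ennreal ((f x)\<^sup>2) \<partial>M) + 2 * (\<integral>\<^sup>+x. ennreal ((g x)\<^sup>2) \<partial>M)"
    by (simp add: nn_integral_add nn_integral_cmult)
  finally show ?thesis .
qed

text \<open>The differences of the approximating sequences converge by the quadratic bounds, in H^1
  and on the surface. This reduces uniqueness of traces to the zero function.\<close>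

lemma has_trace_diff:
  assumes U: "open U" "bounded U" and M: "sets M = sets borel"
    and v: "v \<in> H1 U" "has_trace U M v g" and w: "w \<in> H1 U" "has_trace U M w h"
  shows "has_trace U M (\<lambda>x. v x - w x) (\<lambda>x. g x - h x)"
proof -
  obtain \<phi> where \<phi>: "\<And>n. test_function U (\<phi> n)" "(\<lambda>n. H1_norm U (\<lambda>x. \<phi> n x - v x)) \<longlonglongrightarrow> 0"
    "(\<lambda>n. \<integral>\<^sup>+x. ennreal ((\<phi> n x - g x)\<^sup>2) \<partial>M) \<longlonglongrightarrow> 0" and gm[measurable]: "g \<in> borel_measurable M"
    using v(2) unfolding has_trace_def by blast
  obtain \<psi> where \<psi>: "\<And>n. test_function U (\<psi> n)" "(\<lambda>n. H1_norm U (\<lambda>x. \<psi> n x - w x)) \<longlonglongrightarrow> 0"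
    "(\<lambda>n. \<integral>\<^sup>+x. ennreal ((\<psi> n x - h x)\<^sup>2) \<partial>M) \<longlonglongrightarrow> 0" and hm[measurable]: "h \<in> borel_measurable M"
    using w(2) unfolding has_trace_def by blast
  have pm[measurable]: "\<phi> n \<in> borel_measurable M" "\<psi> n \<in> borel_measurable M" for n
    using borel_measurable_continuous_onI test_function_continuous[OF \<phi>(1)] test_function_continuous[OF \<psi>(1)]
      measurable_cong_sets[OF M refl] by blast+
  have tf: "test_function U (\<lambda>x. \<phi> n x - \<psi> n x)" for n
  proof (rule test_functionI_compact)
    show "has_cont_grad (\<lambda>x. \<phi> n x - \<psi> n x) (\<lambda>x. grad (\<phi> n) x - grad (\<psi> n) x)"
      using \<phi>(1) \<psi>(1) test_function_iff has_cont_grad_diff by blast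
    show "{x. \<phi> n x - \<psi> n x \<noteq> 0} \<subseteq> closure {x. \<phi> n x \<noteq> 0} \<union> closure {x. \<psi> n x \<noteq> 0}"
      by (rule order_trans[OF _ Un_mono[OF closure_subset closure_subset]]) auto
  qed (use \<phi>(1)[of n] \<psi>(1)[of n] in \<open>auto simp: test_function_def\<close>)
  have d: "(\<lambda>x. \<phi> n x - v x) \<in> H1 U" "(\<lambda>x. \<psi> n x - w x) \<in> H1 U" for n
    using H1_lincomb(1)[OF U test_function_H1[OF U(1) \<phi>(1)] v(1), of 1 _ "-1"]
      H1_lincomb(1)[OF U test_function_H1[OF U(1) \<psi>(1)] w(1), of 1 _ "-1"] by simp_all
  let ?F = "\<lambda>n. H1_norm U (\<lambda>x. \<phi> n x - v x)" and ?G = "\<lambda>n. H1_norm U (\<lambda>x. \<psi> n x - w x)"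
  let ?H = "\<lambda>n. H1_norm U (\<lambda>x. \<phi> n x - \<psi> n x - (v x - w x))"
  let ?f = "\<lambda>n. \<integral>\<^sup>+x. ennreal ((\<phi> n x - g x)\<^sup>2) \<partial>M" and ?g = "\<lambda>n. \<integral>\<^sup>+x. ennreal ((\<psi> n x - h x)\<^sup>2) \<partial>M"
  have "(\<lambda>n. (?H n)\<^sup>2) \<longlonglongrightarrow> 0"
  proof (rule Lim_null_comparison)
    show "\<forall>\<^sub>F n in sequentially. norm ((?H n)\<^sup>2)
        \<le> 2 * (?F n)\<^sup>2 + 2 * (?G n)\<^sup>2"
    proof (intro always_eventually allI)
      fix n
      have "(\<lambda>x. 1 * (\<phi> n x - v x) + (-1) * (\<psi> n x - w x)) = (\<lambda>x. \<phi> n x - \<psi> n x - (v x - w x))"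
        by (simp add: algebra_simps)
      then show "norm ((?H n)\<^sup>2)
        \<le> 2 * (?F n)\<^sup>2 + 2 * (?G n)\<^sup>2"
        using H1_lincomb(2)[OF U d(1)[of n] d(2)[of n], of 1 "-1"] by simp
    qed
    have "(\<lambda>n. 2 * (?F n)\<^sup>2 + 2 * (?G n)\<^sup>2)
      \<longlonglongrightarrow> 2 * 0\<^sup>2 + 2 * 0\<^sup>2" by (intro tendsto_intros \<phi>(2) \<psi>(2))
    then show "(\<lambda>n. 2 * (?F n)\<^sup>2 + 2 * (?G n)\<^sup>2)
      \<longlonglongrightarrow> 0" by simp
  qed
  from tendsto_real_sqrt[OF this]
  have 1: "(\<lambda>n. ?H n) \<longlonglongrightarrow> 0" by (simp add: H1_norm_nonneg)
  have 2: "(\<lambda>n. \<integral>\<^sup>+x. ennreal ((\<phi> n x - \<psi> n x - (g x - h x))\<^sup>2) \<partial>M) \<longlonglongrightarrow> 0"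
  proof (rule tendsto_sandwich[of "\<lambda>_. 0"])
    show "\<forall>\<^sub>F n in sequentially. (\<integral>\<^sup>+x. ennreal ((\<phi> n x - \<psi> n x - (g x - h x))\<^sup>2) \<partial>M)
        \<le> 2 * ?f n + 2 * ?g n"
    proof (intro always_eventually allI)
      fix n
      have eq: "\<phi> n x - \<psi> n x - (g x - h x) = (\<phi> n x - g x) + (h x - \<psi> n x)" for x by simp
      have sw: "(\<psi> n x - h x)\<^sup>2 = (h x - \<psi> n x)\<^sup>2" for x by (rule power2_commute)
      show "(\<integral>\<^sup>+x. ennreal ((\<phi> n x - \<psi> n x - (g x - h x))\<^sup>2) \<partial>M)
        \<le> 2 * ?f n + 2 * ?g n"
        unfolding eq sw by (rule nn_integral_square_sum_le) measurable
    qed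
    have "(\<lambda>n. 2 * ?f n + 2 * ?g n)
        \<longlonglongrightarrow> 2 * 0 + 2 * 0"
      by (intro tendsto_add tendsto_mult_ennreal tendsto_const \<phi>(3) \<psi>(3)) auto
    then show "(\<lambda>n. 2 * ?f n + 2 * ?g n)
        \<longlonglongrightarrow> 0" by simp
  qed auto
  have "(\<lambda>x. g x - h x) \<in> borel_measurable M" by measurable
  then show ?thesis unfolding has_trace_def using tf 1 2 by (intro conjI exI[of _ "\<lambda>n x. \<phi> n x - \<psi> n x"]) auto
qed

section \<open>Orthonormal systems\<close>

text \<open>The form is only semidefinite, because the surface product does not see discrete
  functions that vanish on the surface. Vectors are functions rather than classes modulo null
  functions, so that their volume norms remain defined.\<close>

definition semi_inner :: "('a \<Rightarrow> real) set \<Rightarrow> (('a \<Rightarrow> real) \<Rightarrow> ('a \<Rightarrow> real) \<Rightarrow> real) \<Rightarrow> bool" where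
  "semi_inner W B \<longleftrightarrow>
     (\<forall>u\<in>W. \<forall>v\<in>W. \<forall>a b. (\<lambda>x. a * u x + b * v x) \<in> W) \<and>
     (\<forall>u\<in>W. \<forall>v\<in>W. \<forall>w\<in>W. \<forall>a b. B (\<lambda>x. a * u x + b * v x) w = a * B u w + b * B v w) \<and>
     (\<forall>u\<in>W. \<forall>v\<in>W. B u v = B v u) \<and> (\<forall>u\<in>W. 0 \<le> B u u)"

lemma semi_innerD:
  assumes "semi_inner W B"
  shows "\<And>u v a b. u \<in> W \<Longrightarrow> v \<in> W \<Longrightarrow> (\<lambda>x. a * u x + b * v x) \<in> W"
    "\<And>u v w a b. u \<in> W \<Longrightarrow> v \<in> W \<Longrightarrow> w \<in> W \<Longrightarrow> B (\<lambda>x. a * u x + b * v x) w = a * B u w + b * B v w"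
    "\<And>u v. u \<in> W \<Longrightarrow> v \<in> W \<Longrightarrow> B u v = B v u" "\<And>u. u \<in> W \<Longrightarrow> 0 \<le> B u u"
  using assms unfolding semi_inner_def by blast+

lemma semi_inner_lincomb_square:
  assumes "semi_inner W B" "u \<in> W" "v \<in> W"
  shows "B (\<lambda>x. a * u x + b * v x) (\<lambda>x. a * u x + b * v x) = a\<^sup>2 * B u u + 2 * a * b * B u v + b\<^sup>2 * B v v"
proof -
  note S = semi_innerD[OF assms(1)]
  let ?w = "\<lambda>x. a * u x + b * v x"
  have w: "?w \<in> W" using S(1) assms(2,3) by blast
  have "B ?w ?w = a * B u ?w + b * B v ?w" using S(2) assms(2,3) w by blast
  also have "B u ?w = a * B u u + b * B v u"
    using S(3)[OF assms(2) w] S(2)[OF assms(2,3) assms(2)] by simp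
  also have "B v ?w = a * B u v + b * B v v"
    using S(3)[OF assms(3) w] S(2)[OF assms(2,3) assms(3)] by simp
  finally show ?thesis using S(3)[OF assms(2,3)] by (simp add: power2_eq_square algebra_simps)
qed

text \<open>The usual discriminant argument. If \<open>B v v = 0\<close>, the quadratic degenerates
  to an affine function of \<open>b\<close>, which can stay nonnegative only with slope
  zero.\<close>

lemma semi_inner_Cauchy_Schwarz:
  assumes "semi_inner W B" "u \<in> W" "v \<in> W"
  shows "(B u v)\<^sup>2 \<le> B u u * B v v"
proof -
  note S = semi_innerD[OF assms(1)]
  have q: "0 \<le> a\<^sup>2 * B u u + 2 * a * b * B u v + b\<^sup>2 * B v v" for a b
    using S(4)[OF S(1)[OF assms(2,3)], of a b] semi_inner_lincomb_square[OF assms] by simp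
  show ?thesis
  proof (cases "B v v = 0")
    case False
    then have "0 < B v v" using S(4)[OF assms(3)] by simp
    moreover have "0 \<le> B v v * (B u u * B v v - (B u v)\<^sup>2)"
      using q[of "B v v" "- B u v"] by (simp add: power2_eq_square algebra_simps)
    ultimately show ?thesis by (simp add: zero_le_mult_iff)
  next
    case True
    have "B u v = 0"
    proof (rule ccontr)
      assume ne: "B u v \<noteq> 0"
      \<comment> \<open>The witness for \<open>b\<close> makes the affine function equal to
        -1.\<close>
      have "0 \<le> B u u + 2 * (- (B u u + 1) / (2 * B u v)) * B u v"
        using q[of 1 "- (B u u + 1) / (2 * B u v)"] True by simp
      also have "\<dots> = -1" using ne by (simp add: field_simps)
      finally show False by simp
    qed
    then show ?thesis using True by simp
  qed
qed

text \<open>The term \<open>c * u\<close> makes residuals (\<open>c = 1\<close>) and plain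
  combinations (\<open>c = 0\<close>) instances of one statement, and supplies an element of
  \<open>W\<close> when \<open>E\<close> is empty.\<close>

lemma semi_inner_sum:
  assumes "semi_inner W B" "finite E" "E \<subseteq> W" "u \<in> W"
  shows "(\<lambda>x. c * u x + (\<Sum>e\<in>E. a e * e x)) \<in> W"
    "\<And>w. w \<in> W \<Longrightarrow> B (\<lambda>x. c * u x + (\<Sum>e\<in>E. a e * e x)) w = c * B u w + (\<Sum>e\<in>E. a e * B e w)"
proof -
  note S = semi_innerD[OF assms(1)]
  have "(\<lambda>x. c * u x + (\<Sum>e\<in>E. a e * e x)) \<in> W \<and>
    (\<forall>w\<in>W. B (\<lambda>x. c * u x + (\<Sum>e\<in>E. a e * e x)) w = c * B u w + (\<Sum>e\<in>E. a e * B e w))"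
    using assms(2,3)
  proof (induction E rule: finite_induct)
    case empty
    then show ?case using S(1)[OF assms(4,4), of c 0] S(2)[OF assms(4,4), of _ c 0] by simp
  next
    case (insert e E)
    then have ih: "(\<lambda>x. c * u x + (\<Sum>e\<in>E. a e * e x)) \<in> W"
      "\<And>w. w \<in> W \<Longrightarrow> B (\<lambda>x. c * u x + (\<Sum>e\<in>E. a e * e x)) w = c * B u w + (\<Sum>e\<in>E. a e * B e w)"
      and e: "e \<in> W" by auto
    have eq: "(\<lambda>x. c * u x + (\<Sum>e\<in>insert e E. a e * e x))
      = (\<lambda>x. 1 * (c * u x + (\<Sum>e\<in>E. a e * e x)) + a e * e x)"
      using insert.hyps by (simp add: algebra_simps)
    show ?case unfolding eq
      using S(1)[OF ih(1) e, of 1 "a e"] S(2)[OF ih(1) e, of _ 1 "a e"] ih(2) insert.hyps by simp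
  qed
  then show "(\<lambda>x. c * u x + (\<Sum>e\<in>E. a e * e x)) \<in> W"
    "\<And>w. w \<in> W \<Longrightarrow> B (\<lambda>x. c * u x + (\<Sum>e\<in>E. a e * e x)) w = c * B u w + (\<Sum>e\<in>E. a e * B e w)"
    by blast+
qed

text \<open>For orthonormal \<open>E\<close>, this is \<open>w\<close> minus its orthogonal
  projection onto the span of \<open>E\<close>.\<close>

definition residual :: "(('a \<Rightarrow> real) \<Rightarrow> ('a \<Rightarrow> real) \<Rightarrow> real) \<Rightarrow> ('a \<Rightarrow> real) set \<Rightarrow> ('a \<Rightarrow> real) \<Rightarrow> 'a \<Rightarrow> real" where
  "residual B E w = (\<lambda>x. w x - (\<Sum>e\<in>E. B w e * e x))"

definition orthonormal :: "(('a \<Rightarrow> real) \<Rightarrow> ('a \<Rightarrow> real) \<Rightarrow> real) \<Rightarrow> ('a \<Rightarrow> real) set \<Rightarrow> bool" where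
  "orthonormal B E \<longleftrightarrow> (\<forall>e\<in>E. \<forall>f\<in>E. B e f = (if e = f then 1 else 0))"

lemma residual_in:
  assumes "semi_inner W B" "finite E" "E \<subseteq> W" "w \<in> W"
  shows "residual B E w \<in> W"
    "\<And>u. u \<in> W \<Longrightarrow> B (residual B E w) u = B w u - (\<Sum>e\<in>E. B w e * B e u)"
  using semi_inner_sum[OF assms, where c=1 and a="\<lambda>e. - B w e"] unfolding residual_def
  by (simp_all add: sum_negf)

lemma residual_orthogonal:
  assumes "semi_inner W B" "finite E" "E \<subseteq> W" "w \<in> W" "orthonormal B E" "f \<in> E"
  shows "B (residual B E w) f = 0"
proof -
  have "B e f = (if e = f then 1 else 0)" if "e \<in> E" for e
    using assms(5,6) that unfolding orthonormal_def by blast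
  then have "(\<Sum>e\<in>E. B w e * B e f) = (\<Sum>e\<in>E. if e = f then B w e else 0)"
    by (intro sum.cong refl) simp
  then have "B (residual B E w) f = B w f - (\<Sum>e\<in>E. if e = f then B w e else 0)"
    using residual_in(2)[OF assms(1-4), of f] assms(3,6) by auto
  also have "\<dots> = 0" using assms(2,6) by simp
  finally show ?thesis .
qed

text \<open>One Gram-Schmidt step that tolerates null vectors: if the residual of \<open>f\<close>
  is null, \<open>E\<close> already suffices, otherwise the normalised residual joins it. The last
  assumption says that \<open>E\<close> captures every element of \<open>W\<close> up to a multiple
  of \<open>f\<close> and a null vector.\<close>

lemma orthonormal_extension:
  assumes SI: "semi_inner W B" and E: "finite E" "E \<subseteq> W" "orthonormal B E" and f: "f \<in> W"
    and split: "\<And>w. w \<in> W \<Longrightarrow> \<exists>t. B (residual B E (\<lambda>x. w x - t * f x)) (residual B E (\<lambda>x. w x - t * f x)) = 0"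
  shows "\<exists>E'. finite E' \<and> E' \<subseteq> W \<and> orthonormal B E' \<and> (\<forall>w\<in>W. B (residual B E' w) (residual B E' w) = 0)"
proof -
  note S = semi_innerD[OF SI]
  define r where "r = residual B E f"
  have r: "r \<in> W" unfolding r_def using residual_in[OF SI E(1,2) f] by blast
  have sub: "(\<lambda>x. w x - t * f x) \<in> W" if "w \<in> W" for w t using S(1)[OF that f, of 1 "-t"] by simp
  \<comment> \<open>Linearity of the residual, with \<open>w\<close> split into
    \<open>w - t * f\<close> and \<open>t * f\<close>.\<close>
  have res_sub: "residual B E w = (\<lambda>x. 1 * residual B E (\<lambda>x. w x - t * f x) x + t * r x)" if w: "w \<in> W" for w t
  proof
    fix x
    have Bd: "B (\<lambda>x. w x - t * f x) e = B w e - t * B f e" if "e \<in> E" for e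
      using S(2)[OF w f, of e 1 "-t"] that E(2) by auto
    then have "(\<Sum>e\<in>E. B (\<lambda>x. w x - t * f x) e * e x) = (\<Sum>e\<in>E. B w e * e x - t * (B f e * e x))"
      by (intro sum.cong refl) (simp add: Bd left_diff_distrib)
    then show "residual B E w x = 1 * residual B E (\<lambda>x. w x - t * f x) x + t * r x"
      unfolding r_def residual_def by (simp add: sum_subtractf sum_distrib_left[symmetric] algebra_simps)
  qed
  show ?thesis
  proof (cases "B r r = 0")
    case True
    have "B (residual B E w) (residual B E w) = 0" if w: "w \<in> W" for w
    proof -
      obtain t where t: "B (residual B E (\<lambda>x. w x - t * f x)) (residual B E (\<lambda>x. w x - t * f x)) = 0"
        using split[OF w] by blast
      let ?n = "residual B E (\<lambda>x. w x - t * f x)"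
      have n: "?n \<in> W" using residual_in(1)[OF SI E(1,2) sub[OF w]] .
      \<comment> \<open>By Cauchy-Schwarz a null vector is orthogonal to everything, so the cross
        term disappears.\<close>
      have "(B ?n r)\<^sup>2 \<le> 0" using semi_inner_Cauchy_Schwarz[OF SI n r] t by simp
      then show ?thesis
        unfolding res_sub[OF w, of t] semi_inner_lincomb_square[OF SI n r] using t True by simp
    qed
    then show ?thesis using E by blast
  next
    case False
    then have pos: "0 < B r r" using S(4)[OF r] by simp
    define s where "s = sqrt (B r r)"
    have s: "0 < s" "s * s = B r r" unfolding s_def using pos by auto
    \<comment> \<open>The zero summand puts the scaled vector into the shape of the closure rule for
      combinations.\<close>
    define g where "g = (\<lambda>x. (1 / s) * r x + 0 * r x)"
    have g: "g \<in> W" unfolding g_def using S(1)[OF r r] .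
    have Bg: "B g w = B r w / s" if "w \<in> W" for w
      unfolding g_def using S(2)[OF r r that, of "1 / s" 0] by simp
    have gE: "B g e = 0" if "e \<in> E" for e
    proof -
      have "B r e = 0" unfolding r_def by (rule residual_orthogonal[OF SI E(1,2) f E(3) that])
      then show ?thesis using Bg[of e] that E(2) by auto
    qed
    have gr: "B g r = s" using Bg[OF r] s(1) unfolding s(2)[symmetric] by simp
    have gg: "B g g = 1" using Bg[OF g] S(3)[OF r g] gr s by simp
    have gnE: "g \<notin> E" using gE[of g] gg by auto
    have orth: "orthonormal B (insert g E)"
      unfolding orthonormal_def
    proof (intro ballI)
      fix e e' assume e: "e \<in> insert g E" "e' \<in> insert g E"
      have "B e g = 0" if "e \<in> E" for e using gE[OF that] S(3)[OF g, of e] that E(2) by auto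
      then show "B e e' = (if e = e' then 1 else 0)"
        using e gg gE gnE E(3) unfolding orthonormal_def by auto
    qed
    have "B (residual B (insert g E) w) (residual B (insert g E) w) = 0" if w: "w \<in> W" for w
    proof -
      obtain t where t: "B (residual B E (\<lambda>x. w x - t * f x)) (residual B E (\<lambda>x. w x - t * f x)) = 0"
        using split[OF w] by blast
      let ?n = "residual B E (\<lambda>x. w x - t * f x)"
      have n: "?n \<in> W" using residual_in(1)[OF SI E(1,2) sub[OF w]] .
      have "(B ?n g)\<^sup>2 \<le> 0" using semi_inner_Cauchy_Schwarz[OF SI n g] t by simp
      then have ng: "B ?n g = 0" by simp
      have "B (residual B E w) g = B w g - (\<Sum>e\<in>E. B w e * B e g)"
        by (rule residual_in(2)[OF SI E(1,2) w g])
      also have "(\<Sum>e\<in>E. B w e * B e g) = 0"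
        using gE S(3)[OF g] E(2) by (intro sum.neutral) (metis mult_zero_right subsetD)
      finally have "B w g = B (\<lambda>x. 1 * ?n x + t * r x) g" using res_sub[OF w, of t] by simp
      also have "\<dots> = t * s" using S(2)[OF n r g, of 1 t] ng gr S(3)[OF g r] by simp
      finally have wg: "B w g = t * s" .
      \<comment> \<open>Since \<open>r = s * g\<close>, the new coefficient \<open>t * s\<close>
        removes exactly \<open>t * r\<close>, and the null vector \<open>?n\<close> is left.\<close>
      have "residual B (insert g E) w = (\<lambda>x. residual B E w x - t * s * g x)"
        unfolding residual_def using E(1) gnE by (auto simp: wg fun_eq_iff)
      also have "\<dots> = ?n" unfolding res_sub[OF w, of t] g_def using s(1) by (simp add: fun_eq_iff)
      finally show ?thesis using t by simp
    qed
    then show ?thesis using E(1,2) g orth by (intro exI[of _ "insert g E"]) auto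
  qed
qed

text \<open>The spanning functions \<open>f j\<close> may lie outside \<open>W\<close>, so
  Gram-Schmidt cannot be run on them. Instead the induction removes one of them: the elements of
  \<open>W\<close> expressible without it form a subspace of codimension at most one, and any
  \<open>g\<close> outside it serves as the new vector.\<close>

lemma finite_orthonormal_system:
  assumes "finite J" "semi_inner W B" "\<And>w. w \<in> W \<Longrightarrow> \<exists>c. \<forall>x. w x = (\<Sum>j\<in>J. c j * f j x)"
  shows "\<exists>E. finite E \<and> E \<subseteq> W \<and> orthonormal B E \<and> (\<forall>w\<in>W. B (residual B E w) (residual B E w) = 0)"
  using assms
proof (induction J arbitrary: W rule: finite_induct)
  case empty
  note S = semi_innerD[OF empty.prems(1)]
  have "B w w = 0" if w: "w \<in> W" for w
  proof -
    have "w = (\<lambda>x. 0)" using empty.prems(2)[OF w] by auto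
    then have "(\<lambda>x. 0 * w x + 0 * w x) = w" by simp
    then show ?thesis using S(2)[OF w w w, of 0 0] by simp
  qed
  then show ?case by (intro exI[of _ "{}"]) (simp add: orthonormal_def residual_def)
next
  case (insert j J)
  note S = semi_innerD[OF insert.prems(1)]
  define W' where "W' = {w \<in> W. \<exists>c. \<forall>x. w x = (\<Sum>j\<in>J. c j * f j x)}"
  have cl: "(\<lambda>x. a * u x + b * v x) \<in> W'" if uv: "u \<in> W'" "v \<in> W'" for u v a b
  proof -
    obtain c d where cd: "\<And>x. u x = (\<Sum>j\<in>J. c j * f j x)" "\<And>x. v x = (\<Sum>j\<in>J. d j * f j x)"
      using uv unfolding W'_def by blast
    have "a * u x + b * v x = (\<Sum>j\<in>J. (a * c j + b * d j) * f j x)" for x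
      unfolding cd by (simp add: sum_distrib_left sum.distrib[symmetric] algebra_simps)
    then have "\<exists>c. \<forall>x. a * u x + b * v x = (\<Sum>j\<in>J. c j * f j x)"
      by (intro exI[of _ "\<lambda>j. a * c j + b * d j"]) simp
    moreover have "(\<lambda>x. a * u x + b * v x) \<in> W" using S(1) uv unfolding W'_def by blast
    ultimately show ?thesis unfolding W'_def by simp
  qed
  have SI': "semi_inner W' B"
    using cl S(2,3,4) unfolding semi_inner_def W'_def by auto
  obtain E where E: "finite E" "E \<subseteq> W'" "orthonormal B E" "\<And>w. w \<in> W' \<Longrightarrow> B (residual B E w) (residual B E w) = 0"
    using insert.IH[OF SI'] unfolding W'_def by auto
  have EW: "E \<subseteq> W" using E(2) unfolding W'_def by blast
  show ?case
  proof (cases "W \<subseteq> W'")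
    case True
    then show ?thesis using E EW by blast
  next
    case False
    then obtain g where g: "g \<in> W" "g \<notin> W'" by blast
    obtain c where c: "\<And>x. g x = c j * f j x + (\<Sum>i\<in>J. c i * f i x)"
      using insert.prems(2)[OF g(1)] insert.hyps by auto
    have cj: "c j \<noteq> 0" using g c unfolding W'_def by auto
    show ?thesis
    proof (rule orthonormal_extension[OF insert.prems(1) E(1) EW E(3) g(1)])
      fix w assume w: "w \<in> W"
      obtain d where d: "\<And>x. w x = d j * f j x + (\<Sum>i\<in>J. d i * f i x)"
        using insert.prems(2)[OF w] insert.hyps by auto
      \<comment> \<open>Chosen to cancel the coefficient of \<open>f j\<close> in
        \<open>w - t * g\<close>.\<close>
      define t where "t = d j / c j"
      have eq: "w x - t * g x = (\<Sum>i\<in>J. (d i - t * c i) * f i x)" for x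
      proof -
        have "w x - t * g x = (d j - t * c j) * f j x + ((\<Sum>i\<in>J. d i * f i x) - t * (\<Sum>i\<in>J. c i * f i x))"
          unfolding c d by (simp add: algebra_simps)
        also have "d j - t * c j = 0" unfolding t_def using cj by simp
        finally show ?thesis by (simp add: sum_distrib_left sum_subtractf[symmetric] algebra_simps)
      qed
      have "(\<lambda>x. w x - t * g x) \<in> W" using S(1)[OF w g(1), of 1 "-t"] by simp
      then have "(\<lambda>x. w x - t * g x) \<in> W'"
        unfolding W'_def using eq by (intro CollectI conjI exI[of _ "\<lambda>i. d i - t * c i"]) auto
      then show "\<exists>t. B (residual B E (\<lambda>x. w x - t * g x)) (residual B E (\<lambda>x. w x - t * g x)) = 0"
        using E(4) by blast
    qed
  qed
qed

section \<open>The L^2 product of a measure\<close>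

definition L2_inner :: "'a measure \<Rightarrow> ('a \<Rightarrow> real) \<Rightarrow> ('a \<Rightarrow> real) \<Rightarrow> real" where
  "L2_inner M u v = (LINT x|M. u x * v x)"

lemma semi_inner_L2: "semi_inner (L2_functions M) (L2_inner M)"
  unfolding semi_inner_def
proof (intro conjI ballI allI)
  fix u v assume uv: "u \<in> L2_functions M" "v \<in> L2_functions M"
  show "L2_inner M u v = L2_inner M v u" unfolding L2_inner_def by (simp add: mult.commute)
  show "0 \<le> L2_inner M u u" unfolding L2_inner_def by simp
  fix a b
  have i: "integrable M (\<lambda>x. (u x)\<^sup>2)" "integrable M (\<lambda>x. (v x)\<^sup>2)" "integrable M (\<lambda>x. u x * v x)"
    and m: "u \<in> borel_measurable M" "v \<in> borel_measurable M"
    using uv L2_mult_integrable unfolding L2_functions_def by auto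
  have "integrable M (\<lambda>x. a\<^sup>2 * (u x)\<^sup>2 + 2 * a * b * (u x * v x) + b\<^sup>2 * (v x)\<^sup>2)" using i by simp
  moreover have "(\<lambda>x. a\<^sup>2 * (u x)\<^sup>2 + 2 * a * b * (u x * v x) + b\<^sup>2 * (v x)\<^sup>2) = (\<lambda>x. (a * u x + b * v x)\<^sup>2)"
    by (simp add: power2_eq_square algebra_simps fun_eq_iff)
  ultimately show "(\<lambda>x. a * u x + b * v x) \<in> L2_functions M" unfolding L2_functions_def using m by simp
  fix w assume w: "w \<in> L2_functions M"
  have "L2_inner M (\<lambda>x. a * u x + b * v x) w = (LINT x|M. a * (u x * w x) + b * (v x * w x))"
    unfolding L2_inner_def by (simp add: algebra_simps)
  also have "\<dots> = a * L2_inner M u w + b * L2_inner M v w"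
    using L2_mult_integrable[OF uv(1) w] L2_mult_integrable[OF uv(2) w] unfolding L2_inner_def by simp
  finally show "L2_inner M (\<lambda>x. a * u x + b * v x) w = a * L2_inner M u w + b * L2_inner M v w" .
qed

lemma semi_inner_subspace:
  assumes "semi_inner W B" "V \<subseteq> W" "\<And>u v a b. u \<in> V \<Longrightarrow> v \<in> V \<Longrightarrow> (\<lambda>x. a * u x + b * v x) \<in> V"
  shows "semi_inner V B"
  using semi_innerD(2,3,4)[OF assms(1)] assms(2,3) unfolding semi_inner_def by (meson subsetD)

lemma L2_null_AE:
  assumes "u \<in> L2_functions M" "L2_inner M u u = 0"
  shows "AE x in M. u x = 0"
proof -
  have "integrable M (\<lambda>x. u x * u x)" using L2_mult_integrable[OF assms(1,1)] .
  then have "AE x in M. u x * u x = 0"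
    using assms(2) unfolding L2_inner_def by (subst (asm) integral_nonneg_eq_0_iff_AE) auto
  then show ?thesis by eventually_elim simp
qed

text \<open>Allows traces, known only almost everywhere, to be exchanged for the discrete functions
  themselves.\<close>

lemma L2_inner_cong_AE:
  assumes "u \<in> borel_measurable M" "v \<in> borel_measurable M" "u' \<in> borel_measurable M" "v' \<in> borel_measurable M"
    "AE x in M. u x = u' x" "AE x in M. v x = v' x"
  shows "L2_inner M u v = L2_inner M u' v'"
  unfolding L2_inner_def
proof (rule integral_cong_AE)
  show "AE x in M. u x * v x = u' x * v' x" using assms(5,6) by eventually_elim simp
qed (use assms(1-4) in auto)

section \<open>Finite dimension of the discrete space\<close>

lemma finite_exponents: "finite {(i, j, l). i + j + l \<le> (k::nat)}"
  by (rule finite_subset[of _ "{..k} \<times> {..k} \<times> {..k}"]) auto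

lemma polynomial3_lincomb:
  assumes "polynomial3 k p" "polynomial3 k q"
  shows "polynomial3 k (\<lambda>x. a * p x + b * q x)"
proof -
  obtain c d where c: "\<And>x. p x = (\<Sum>(i, j, l)\<in>{(i, j, l). i + j + l \<le> k}. c i j l * (x$1)^i * (x$2)^j * (x$3)^l)"
    and d: "\<And>x. q x = (\<Sum>(i, j, l)\<in>{(i, j, l). i + j + l \<le> k}. d i j l * (x$1)^i * (x$2)^j * (x$3)^l)"
    using assms unfolding polynomial3_def by blast
  have "a * p x + b * q x
    = (\<Sum>(i, j, l)\<in>{(i, j, l). i + j + l \<le> k}. (a * c i j l + b * d i j l) * (x$1)^i * (x$2)^j * (x$3)^l)" for x
    unfolding c d sum_distrib_left sum.distrib[symmetric] by (rule sum.cong) (auto simp: algebra_simps)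
  then show ?thesis unfolding polynomial3_def by (intro exI[of _ "\<lambda>i j l. a * c i j l + b * d i j l"]) simp
qed

lemma fe_space_lincomb:
  assumes "u \<in> fe_space k \<Omega> \<T>" "v \<in> fe_space k \<Omega> \<T>"
  shows "(\<lambda>x. a * u x + b * v x) \<in> fe_space k \<Omega> \<T>"
  unfolding fe_space_def
proof (intro CollectI conjI ballI allI impI)
  show "continuous_on UNIV (\<lambda>x. a * u x + b * v x)"
    using assms unfolding fe_space_def by (auto intro!: continuous_intros)
  show "a * u x + b * v x = 0" if "x \<notin> \<Omega>" for x using assms that unfolding fe_space_def by simp
  fix K assume K: "K \<in> \<T>"
  obtain p where p: "polynomial3 k p" "\<And>x. x \<in> K \<Longrightarrow> u x = p x"
    using assms(1) K unfolding fe_space_def by blast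
  obtain q where q: "polynomial3 k q" "\<And>x. x \<in> K \<Longrightarrow> v x = q x"
    using assms(2) K unfolding fe_space_def by blast
  show "\<exists>p. polynomial3 k p \<and> (\<forall>x\<in>K. a * u x + b * v x = p x)"
    using polynomial3_lincomb[OF p(1) q(1), of a b] p(2) q(2) by (intro exI[of _ "\<lambda>x. a * p x + b * q x"]) simp
qed

text \<open>Monomials cut off to single tetrahedra span the space. The cut-offs are discontinuous in
  general and need not lie in it, which the orthonormalisation allows for.\<close>

lemma fe_space_spanned:
  assumes "tetrahedral_mesh \<Omega> \<T>"
  obtains J :: "((real^3) set \<times> nat \<times> nat \<times> nat) set" and f
  where "finite J" "\<And>v. v \<in> fe_space k \<Omega> \<T> \<Longrightarrow> \<exists>c. \<forall>x. v x = (\<Sum>j\<in>J. c j * f j x)"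
proof -
  have T: "finite \<T>" "\<Union>\<T> = closure \<Omega>"
    using assms unfolding tetrahedral_mesh_def triangulation_def by auto
  let ?I = "{(i, j, l). i + j + l \<le> k}"
  \<comment> \<open>Neighbouring tetrahedra share faces. Assigning each point to one of them makes
    the pieces disjoint, so that no point is counted twice.\<close>
  define \<kappa> where "\<kappa> x = (SOME K. K \<in> \<T> \<and> x \<in> K)" for x
  have \<kappa>: "\<kappa> x \<in> \<T> \<and> x \<in> \<kappa> x" if "x \<in> \<Omega>" for x
  proof -
    have "\<exists>K. K \<in> \<T> \<and> x \<in> K" using that T(2) closure_subset[of \<Omega>] by blast
    then show ?thesis unfolding \<kappa>_def by (rule someI_ex)
  qed
  define h where "h t x = (case t of (i, j, l) \<Rightarrow> (x$1)^i * (x$2)^j * (x$3)^l)" for t and x :: "real^3"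
  define f where "f j x = (case j of (K, t) \<Rightarrow> if x \<in> \<Omega> \<and> \<kappa> x = K then h t x else 0)" for j x
  have "\<exists>c. \<forall>x. v x = (\<Sum>j\<in>\<T> \<times> ?I. c j * f j x)" if v: "v \<in> fe_space k \<Omega> \<T>" for v
  proof -
    have "\<exists>c. \<forall>x\<in>K. v x = (\<Sum>t\<in>?I. c t * h t x)" if K: "K \<in> \<T>" for K
    proof -
      obtain p where p: "polynomial3 k p" "\<And>x. x \<in> K \<Longrightarrow> v x = p x"
        using v K unfolding fe_space_def by blast
      obtain c where c: "\<And>x. p x = (\<Sum>(i, j, l)\<in>?I. c i j l * (x$1)^i * (x$2)^j * (x$3)^l)"
        using p(1) unfolding polynomial3_def by blast
      have "p x = (\<Sum>t\<in>?I. (case t of (i, j, l) \<Rightarrow> c i j l) * h t x)" for x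
        unfolding c by (rule sum.cong) (auto simp: h_def mult.assoc)
      then show ?thesis
        using p(2) by (intro exI[of _ "\<lambda>t. case t of (i, j, l) \<Rightarrow> c i j l"]) simp
    qed
    then have "\<exists>c. \<forall>K\<in>\<T>. \<forall>x\<in>K. v x = (\<Sum>t\<in>?I. c K t * h t x)" by (intro bchoice) blast
    then obtain c where c: "\<And>K x. K \<in> \<T> \<Longrightarrow> x \<in> K \<Longrightarrow> v x = (\<Sum>t\<in>?I. c K t * h t x)" by blast
    have "v x = (\<Sum>j\<in>\<T> \<times> ?I. (case j of (K, t) \<Rightarrow> c K t) * f j x)" for x
    proof (cases "x \<in> \<Omega>")
      case False
      then have "v x = 0" using v unfolding fe_space_def by blast
      then show ?thesis using False by (simp add: f_def split_beta)
    next
      case True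
      have "(\<Sum>j\<in>\<T> \<times> ?I. (case j of (K, t) \<Rightarrow> c K t) * f j x) = (\<Sum>K\<in>\<T>. \<Sum>t\<in>?I. c K t * f (K, t) x)"
        by (simp add: sum.cartesian_product split_beta)
      also have "\<dots> = (\<Sum>K\<in>\<T>. if \<kappa> x = K then \<Sum>t\<in>?I. c K t * h t x else 0)"
        using True by (intro sum.cong) (auto simp: f_def)
      also have "\<dots> = v x" using T(1) \<kappa>[OF True] c[of "\<kappa> x" x] by simp
      finally show ?thesis by simp
    qed
    then show ?thesis by blast
  qed
  moreover have "finite (\<T> \<times> ?I)" using T(1) finite_exponents by blast
  ultimately show thesis using that by blast
qed

text \<open>On a finite system the H^1 norm is controlled by the largest coefficient, by repeated
  use of the quadratic bound. \<open>C\<close> depends on \<open>E\<close>; this is where the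
  discrete space enters the final constant.\<close>

lemma H1_norm_sum_bound:
  assumes U: "open U" "bounded U" and "finite E" "E \<subseteq> H1 U"
  shows "\<exists>C\<ge>0. \<forall>a m. (\<forall>e\<in>E. \<bar>a e\<bar> \<le> m) \<longrightarrow>
    (\<lambda>x. \<Sum>e\<in>E. a e * e x) \<in> H1 U \<and> (H1_norm U (\<lambda>x. \<Sum>e\<in>E. a e * e x))\<^sup>2 \<le> C * m\<^sup>2"
  using assms(3,4)
proof (induction E rule: finite_induct)
  case empty
  have t: "test_function U (\<lambda>x. 0)"
    by (rule test_functionI[OF has_cont_grad_const]) auto
  have z: "(\<lambda>x. 0) \<in> H1 U" using test_function_H1[OF U(1) t] .
  have "(H1_norm U (\<lambda>x. 0))\<^sup>2 \<le> 0" using H1_lincomb(2)[OF U z z, of 0 0] by simp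
  then show ?case using z by (intro exI[of _ 0]) auto
next
  case (insert e E)
  then obtain C where C: "C \<ge> 0" "\<And>a m. \<forall>e\<in>E. \<bar>a e\<bar> \<le> m \<Longrightarrow>
    (\<lambda>x. \<Sum>e\<in>E. a e * e x) \<in> H1 U \<and> (H1_norm U (\<lambda>x. \<Sum>e\<in>E. a e * e x))\<^sup>2 \<le> C * m\<^sup>2" by auto
  have e: "e \<in> H1 U" using insert.prems by simp
  show ?case
  proof (intro exI[of _ "2 * (H1_norm U e)\<^sup>2 + 2 * C"] conjI allI impI)
    show "0 \<le> 2 * (H1_norm U e)\<^sup>2 + 2 * C" using C(1) by simp
    fix a and m :: real assume a: "\<forall>e\<in>insert e E. \<bar>a e\<bar> \<le> m"
    have ih: "(\<lambda>x. \<Sum>e\<in>E. a e * e x) \<in> H1 U" "(H1_norm U (\<lambda>x. \<Sum>e\<in>E. a e * e x))\<^sup>2 \<le> C * m\<^sup>2"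
      using C(2)[of a m] a by auto
    have eq: "(\<lambda>x. \<Sum>e\<in>insert e E. a e * e x) = (\<lambda>x. a e * e x + 1 * (\<Sum>e\<in>E. a e * e x))"
      using insert.hyps by simp
    show "(\<lambda>x. \<Sum>e\<in>insert e E. a e * e x) \<in> H1 U"
      unfolding eq by (rule H1_lincomb(1)[OF U e ih(1)])
    have "(H1_norm U (\<lambda>x. \<Sum>e\<in>insert e E. a e * e x))\<^sup>2 \<le> 2 * (a e)\<^sup>2 * (H1_norm U e)\<^sup>2 + 2 * (C * m\<^sup>2)"
      unfolding eq using H1_lincomb(2)[OF U e ih(1), of "a e" 1] ih(2) by simp
    also have "\<dots> \<le> 2 * m\<^sup>2 * (H1_norm U e)\<^sup>2 + 2 * (C * m\<^sup>2)"
    proof -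
      have "(a e)\<^sup>2 \<le> m\<^sup>2" using power_mono[of "\<bar>a e\<bar>" m 2] a by simp
      then show ?thesis by (simp add: mult_right_mono)
    qed
    finally show "(H1_norm U (\<lambda>x. \<Sum>e\<in>insert e E. a e * e x))\<^sup>2 \<le> (2 * (H1_norm U e)\<^sup>2 + 2 * C) * m\<^sup>2"
      by (simp add: algebra_simps)
  qed
qed

text \<open>The chosen weak gradient of the zero function is known to vanish only almost everywhere
  on the interval, so even this value rests on uniqueness.\<close>

lemma weighted_H1_norm_line_zero: "weighted_H1_norm_line S D (\<lambda>s. 0) = 0"
proof -
  let ?U = "{0<..<S}"
  have "test_function ?U (\<lambda>s. 0)" by (rule test_functionI[OF has_cont_grad_const]) auto
  then have w: "is_weak_gradient ?U (\<lambda>s. 0) (grad (\<lambda>s. 0))" by (intro is_weak_gradient_test_function) auto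
  have "grad (\<lambda>s::real. 0::real) = (\<lambda>s. 0)" using has_cont_grad_grad[OF has_cont_grad_const] .
  then have "AE s in lborel. s \<in> ?U \<longrightarrow> weak_gradient ?U (\<lambda>s. 0) s = 0"
    using weak_gradient_unique[OF _ _ is_weak_gradient_weak_gradient[OF w] w] by simp
  then have "AE s in lborel. indicator ?U s *\<^sub>R
      (planar_area (D s) * (0\<^sup>2 + (weak_gradient ?U (\<lambda>s. 0) s)\<^sup>2)) = (0::real)"
    by eventually_elim (auto simp: indicator_def)
  then have "(LINT s:?U|lborel. planar_area (D s) * (0\<^sup>2 + (weak_gradient ?U (\<lambda>s. 0) s)\<^sup>2)) = 0"
    unfolding set_lebesgue_integral_def by (rule integral_eq_zero_AE)
  then show ?thesis unfolding weighted_H1_norm_line_def by simp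
qed

text \<open>A facet of a tetrahedron has affine dimension 2 and so lies in a plane; the rescaled
  normal of that plane is the witness behind \<open>unit_normal\<close>.\<close>

lemma surface_faces_flat:
  assumes "tetrahedral_mesh \<Omega> \<T>"
  shows "finite (surface_faces \<T> \<Gamma>)" "\<forall>F\<in>surface_faces \<T> \<Gamma>. flat F"
proof -
  have T: "finite \<T>" "\<And>K. K \<in> \<T> \<Longrightarrow> 3 simplex K"
    using assms unfolding tetrahedral_mesh_def triangulation_def by auto
  have "finite (\<Union>K\<in>\<T>. {F. F facet_of K})"
    using T finite_polytope_facets simplex_imp_polytope by blast
  then show "finite (surface_faces \<T> \<Gamma>)"
    by (rule rev_finite_subset) (auto simp: surface_faces_def)
  show "\<forall>F\<in>surface_faces \<T> \<Gamma>. flat F"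
  proof
    fix F assume "F \<in> surface_faces \<T> \<Gamma>"
    then obtain K where K: "K \<in> \<T>" "F facet_of K" unfolding surface_faces_def by blast
    have face: "F face_of K" and dim: "aff_dim F = 2"
      using K(2) aff_dim_simplex[OF T(2)[OF K(1)]] unfolding facet_of_def by auto
    have "compact F"
      using face_of_imp_compact[OF convex_simplex[OF T(2)[OF K(1)]] compact_simplex[OF T(2)[OF K(1)]] face] .
    moreover have "aff_dim F < int (DIM(real^3))" using dim by simp
    then obtain a b where ab: "a \<noteq> 0" "F \<subseteq> {x. a \<bullet> x = b}" using aff_lowdim_subset_hyperplane by blast
    define n where "n = (1 / norm a) *\<^sub>R a"
    have "norm n = 1 \<and> (\<forall>x\<in>F. \<forall>y\<in>F. (x - y) \<bullet> n = 0)"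
    proof (intro conjI ballI)
      show "norm n = 1" unfolding n_def using ab(1) by simp
      fix x y assume "x \<in> F" "y \<in> F"
      then have "a \<bullet> x = b" "a \<bullet> y = b" using ab(2) by auto
      then show "(x - y) \<bullet> n = 0" unfolding n_def by (simp add: inner_commute[of _ a] inner_diff_right)
    qed
    then have "norm (unit_normal F) = 1 \<and> (\<forall>x\<in>F. \<forall>y\<in>F. (x - y) \<bullet> unit_normal F = 0)"
      unfolding unit_normal_def by (rule someI[where P="\<lambda>n. norm n = 1 \<and> (\<forall>x\<in>F. \<forall>y\<in>F. (x - y) \<bullet> n = 0)"])
    ultimately show "flat F" unfolding flat_def by blast
  qed
qed

section \<open>The inf-sup condition\<close>

context
  fixes \<F> :: "(real^3) set set" and M :: "(real^3) measure" and U :: "(real^3) set"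
  assumes finite_faces: "finite \<F>" and flat_faces: "\<forall>F\<in>\<F>. flat F"
    and M: "M = polyhedral_surface_measure \<F>" and U: "open U" "bounded U"
begin

lemma sets_M: "sets M = sets borel"
  unfolding M by (rule sets_surface_measure[OF finite_faces flat_faces])

text \<open>The inequality for test functions passes to the limit. The factor 4 is
  \<open>2 * 2\<close>: one from comparing \<open>q\<close> with \<open>\<phi> n\<close> on the
  surface, one from comparing \<open>\<phi> n\<close> with \<open>v\<close> in H^1.\<close>

lemma trace_bound:
  assumes v: "v \<in> H1 U" and q: "has_trace U M v q"
  shows "(\<integral>\<^sup>+x. ennreal ((q x)\<^sup>2) \<partial>M) \<le> ennreal (4 * card \<F> * (H1_norm U v)\<^sup>2)"
proof -
  obtain \<phi> where \<phi>: "\<And>n. test_function U (\<phi> n)" "(\<lambda>n. H1_norm U (\<lambda>x. \<phi> n x - v x)) \<longlonglongrightarrow> 0"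
    "(\<lambda>n. \<integral>\<^sup>+x. ennreal ((\<phi> n x - q x)\<^sup>2) \<partial>M) \<longlonglongrightarrow> 0" and qm[measurable]: "q \<in> borel_measurable M"
    using q unfolding has_trace_def by blast
  have pm[measurable]: "\<phi> n \<in> borel_measurable M" for n
    using borel_measurable_continuous_onI test_function_continuous[OF \<phi>(1)]
      measurable_cong_sets[OF sets_M refl] by blast
  let ?b = "\<lambda>n. real (card \<F>) * (2 * (H1_norm U (\<lambda>x. \<phi> n x - v x))\<^sup>2 + 2 * (H1_norm U v)\<^sup>2)"
  have le: "(\<integral>\<^sup>+x. ennreal ((q x)\<^sup>2) \<partial>M) \<le> 2 * (\<integral>\<^sup>+x. ennreal ((\<phi> n x - q x)\<^sup>2) \<partial>M) + 2 * ennreal (?b n)" for n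
  proof -
    have d: "(\<lambda>x. \<phi> n x - v x) \<in> H1 U"
      using H1_lincomb(1)[OF U test_function_H1[OF U(1) \<phi>(1)] v, of 1 _ "-1"] by simp
    have H: "(H1_norm U (\<phi> n))\<^sup>2 \<le> 2 * (H1_norm U (\<lambda>x. \<phi> n x - v x))\<^sup>2 + 2 * (H1_norm U v)\<^sup>2"
      using H1_lincomb(2)[OF U d v, of 1 1] by simp
    have "(\<integral>\<^sup>+x. ennreal ((q x)\<^sup>2) \<partial>M) = (\<integral>\<^sup>+x. ennreal (((q x - \<phi> n x) + \<phi> n x)\<^sup>2) \<partial>M)" by simp
    also have "\<dots> \<le> 2 * (\<integral>\<^sup>+x. ennreal ((q x - \<phi> n x)\<^sup>2) \<partial>M) + 2 * (\<integral>\<^sup>+x. ennreal ((\<phi> n x)\<^sup>2) \<partial>M)"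
      by (rule nn_integral_square_sum_le) measurable
    also have "(\<integral>\<^sup>+x. ennreal ((\<phi> n x)\<^sup>2) \<partial>M) \<le> ennreal (card \<F> * (H1_norm U (\<phi> n))\<^sup>2)"
      unfolding M by (rule trace_inequality[OF finite_faces flat_faces U \<phi>(1)])
    also have "\<dots> \<le> ennreal (?b n)" using H by (intro ennreal_leI mult_left_mono) auto
    finally show ?thesis by (simp add: power2_commute add_left_mono mult_left_mono)
  qed
  have "?b \<longlonglongrightarrow> real (card \<F>) * (2 * 0\<^sup>2 + 2 * (H1_norm U v)\<^sup>2)" by (intro tendsto_intros \<phi>(2))
  then have b: "(\<lambda>n. ennreal (?b n)) \<longlonglongrightarrow> ennreal (real (card \<F>) * (2 * 0\<^sup>2 + 2 * (H1_norm U v)\<^sup>2))"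
    by (rule tendsto_ennrealI)
  have "(\<lambda>n. 2 * (\<integral>\<^sup>+x. ennreal ((\<phi> n x - q x)\<^sup>2) \<partial>M) + 2 * ennreal (?b n))
      \<longlonglongrightarrow> 2 * 0 + 2 * ennreal (real (card \<F>) * (2 * 0\<^sup>2 + 2 * (H1_norm U v)\<^sup>2))"
    by (intro tendsto_add tendsto_mult_ennreal tendsto_const \<phi>(3) b) auto
  from LIMSEQ_le_const[OF this] le
  have "(\<integral>\<^sup>+x. ennreal ((q x)\<^sup>2) \<partial>M) \<le> 2 * 0 + 2 * ennreal (real (card \<F>) * (2 * 0\<^sup>2 + 2 * (H1_norm U v)\<^sup>2))"
    by blast
  also have "\<dots> = ennreal (2 * (real (card \<F>) * (2 * 0\<^sup>2 + 2 * (H1_norm U v)\<^sup>2)))" by (subst ennreal_mult') auto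
  also have "\<dots> = ennreal (4 * card \<F> * (H1_norm U v)\<^sup>2)" by (simp add: mult_ac)
  finally show ?thesis .
qed

text \<open>The difference of two traces of \<open>v\<close> is a trace of the zero function, and
  the trace bound makes it null. Hence \<open>trace_op\<close> is determined almost everywhere
  despite the \<open>SOME\<close>.\<close>

lemma trace_unique:
  assumes v: "v \<in> H1 U" and g: "has_trace U M v g" "has_trace U M v h"
  shows "AE x in M. g x = h x"
proof -
  have t: "has_trace U M (\<lambda>x. v x - v x) (\<lambda>x. g x - h x)" by (rule has_trace_diff[OF U sets_M v g(1) v g(2)])
  \<comment> \<open>The combination with both coefficients zero is the zero function, to which the
    quadratic bound assigns norm zero.\<close>
  have z: "(\<lambda>x. v x - v x) \<in> H1 U" "(H1_norm U (\<lambda>x. v x - v x))\<^sup>2 \<le> 0"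
    using H1_lincomb[OF U v v, of 0 0] by simp_all
  have "(\<integral>\<^sup>+x. ennreal ((g x - h x)\<^sup>2) \<partial>M) \<le> ennreal (4 * card \<F> * (H1_norm U (\<lambda>x. v x - v x))\<^sup>2)"
    by (rule trace_bound[OF z(1) t])
  also have "\<dots> = 0" using z(2) by simp
  finally have "(\<integral>\<^sup>+x. ennreal ((g x - h x)\<^sup>2) \<partial>M) = 0" by simp
  moreover have [measurable]: "g \<in> borel_measurable M" "h \<in> borel_measurable M"
    using g unfolding has_trace_def by blast+
  ultimately have "AE x in M. ennreal ((g x - h x)\<^sup>2) = 0" by (subst (asm) nn_integral_0_iff_AE) auto
  then show ?thesis by eventually_elim simp
qed

lemma trace_L2:
  assumes v: "v \<in> H1 U" and q: "has_trace U M v q"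
  shows "q \<in> L2_functions M" "L2_inner M q q \<le> 4 * card \<F> * (H1_norm U v)\<^sup>2"
proof -
  have qm: "q \<in> borel_measurable M" using q unfolding has_trace_def by blast
  note b = trace_bound[OF v q]
  have "(\<integral>\<^sup>+x. ennreal (norm ((q x)\<^sup>2)) \<partial>M) < \<infinity>"
    using le_less_trans[OF b ennreal_less_top] by simp
  then have i: "integrable M (\<lambda>x. (q x)\<^sup>2)" using qm by (intro integrableI_bounded) auto
  then show "q \<in> L2_functions M" unfolding L2_functions_def using qm by blast
  have "ennreal (LINT x|M. (q x)\<^sup>2) \<le> ennreal (4 * card \<F> * (H1_norm U v)\<^sup>2)"
    using b i by (subst (asm) nn_integral_eq_integral) auto
  then have "(LINT x|M. (q x)\<^sup>2) \<le> 4 * card \<F> * (H1_norm U v)\<^sup>2"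
    by (subst (asm) ennreal_le_iff) auto
  then show "L2_inner M q q \<le> 4 * card \<F> * (H1_norm U v)\<^sup>2"
    unfolding L2_inner_def by (simp add: power2_eq_square)
qed

text \<open>Every lift of \<open>q\<close> satisfies the trace bound, hence so does the infimum over
  lifts. The \<open>+ 1\<close> keeps the constant positive even for an empty family of
  faces.\<close>

lemma H_half_00_norm_ge:
  assumes q: "q \<in> H_half_00 U M"
  shows "q \<in> L2_functions M" "sqrt (L2_inner M q q) \<le> (2 * sqrt (card \<F>) + 1) * H_half_00_norm U M q"
proof -
  let ?K = "2 * sqrt (card \<F>) + 1"
  have K: "0 < ?K" by (simp add: add_nonneg_pos)
  obtain v0 where v0: "v0 \<in> H1_0 U" "has_trace U M v0 q" using q unfolding H_half_00_def by blast
  show "q \<in> L2_functions M" using trace_L2(1)[OF _ v0(2)] v0(1) unfolding H1_0_def by blast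
  have "sqrt (L2_inner M q q) / ?K \<le> H_half_00_norm U M q"
    unfolding H_half_00_norm_def
  proof (rule cInf_greatest)
    show "{H1_norm U v |v. v \<in> H1_0 U \<and> has_trace U M v q} \<noteq> {}" using v0 by blast
    fix y assume "y \<in> {H1_norm U v |v. v \<in> H1_0 U \<and> has_trace U M v q}"
    then obtain v where v: "y = H1_norm U v" "v \<in> H1 U" "has_trace U M v q" unfolding H1_0_def by blast
    have "sqrt (L2_inner M q q) \<le> sqrt (4 * card \<F> * (H1_norm U v)\<^sup>2)"
      using trace_L2(2)[OF v(2,3)] by (rule real_sqrt_le_mono)
    also have "\<dots> = 2 * sqrt (card \<F>) * H1_norm U v"
      by (simp add: real_sqrt_mult H1_norm_nonneg)
    also have "\<dots> \<le> ?K * y" unfolding v(1) by (intro mult_right_mono) (auto simp: H1_norm_nonneg)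
    finally show "sqrt (L2_inner M q q) / ?K \<le> y" using K by (simp add: pos_divide_le_eq mult.commute)
  qed
  then show "sqrt (L2_inner M q q) \<le> ?K * H_half_00_norm U M q"
    using K by (simp add: pos_divide_le_eq mult.commute)
qed

text \<open>Cauchy-Schwarz on the surface, then the bound of the surface norm by the quotient norm.
  If \<open>q\<close> is not null, its L^2 norm and hence its quotient norm are positive, which
  justifies clearing the denominator.\<close>

lemma H_minus_half_norm_le:
  assumes \<mu>: "\<mu> \<in> L2_functions M"
  shows "H_minus_half_norm U M (pivot_functional M \<mu>) \<le> ereal ((2 * sqrt (card \<F>) + 1) * sqrt (L2_inner M \<mu> \<mu>))"
  unfolding H_minus_half_norm_def
proof (rule SUP_least)
  let ?K = "2 * sqrt (card \<F>) + 1"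
  fix q assume "q \<in> {q \<in> H_half_00 U M. \<not> (AE x in M. q x = 0)}"
  then have q: "q \<in> H_half_00 U M" "\<not> (AE x in M. q x = 0)" by auto
  have qL: "q \<in> L2_functions M" and le: "sqrt (L2_inner M q q) \<le> ?K * H_half_00_norm U M q"
    using H_half_00_norm_ge[OF q(1)] by auto
  have "L2_inner M q q \<noteq> 0" using L2_null_AE[OF qL] q(2) by blast
  then have pos: "0 < sqrt (L2_inner M q q)" using semi_innerD(4)[OF semi_inner_L2 qL] by simp
  have K: "0 < ?K" by (simp add: add_nonneg_pos)
  have H: "0 < H_half_00_norm U M q" using less_le_trans[OF pos le] K by (simp add: zero_less_mult_iff)
  have "\<bar>pivot_functional M \<mu> q\<bar> = sqrt ((L2_inner M q \<mu>)\<^sup>2)"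
    unfolding pivot_functional_def L2_inner_def by simp
  also have "\<dots> \<le> sqrt (L2_inner M q q * L2_inner M \<mu> \<mu>)"
    by (rule real_sqrt_le_mono[OF semi_inner_Cauchy_Schwarz[OF semi_inner_L2 qL \<mu>]])
  also have "\<dots> = sqrt (L2_inner M q q) * sqrt (L2_inner M \<mu> \<mu>)" by (rule real_sqrt_mult)
  also have "\<dots> \<le> (?K * H_half_00_norm U M q) * sqrt (L2_inner M \<mu> \<mu>)"
    using le semi_innerD(4)[OF semi_inner_L2 \<mu>] by (intro mult_right_mono) auto
  finally show "ereal (\<bar>pivot_functional M \<mu> q\<bar> / H_half_00_norm U M q) \<le> ereal (?K * sqrt (L2_inner M \<mu> \<mu>))"
    using H by (simp add: pos_divide_le_eq mult_ac)
qed

end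

theorem theorem4p4:
  fixes \<Omega> :: "(real^3) set" and S :: real and \<gamma> :: "real \<Rightarrow> real^3"
    and D :: "real \<Rightarrow> (real^3) set" and \<Gamma> :: "(real^3) set"
    and \<T> :: "(real^3) set set" and N :: "real set" and \<sigma> :: real and k :: nat
    and M :: "(real^3) measure"
  assumes "open \<Omega>" and "convex \<Omega>" and "bounded \<Omega>" and "\<Omega> \<noteq> {}"
    and "piecewise_linear_arclength_curve S \<gamma>"
    and "\<gamma> ` {0<..<S} \<subseteq> \<Omega>" and "\<gamma> 0 \<in> frontier \<Omega>" and "\<gamma> S \<in> frontier \<Omega>"
    and "generalized_cylinder \<Omega> S \<gamma> D"
    and "\<Gamma> = lateral_surface S D"
    and "tetrahedral_mesh \<Omega> \<T>" and "shape_regular \<sigma> \<T>"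
    and "is_partition S N"
    and "conforming S \<gamma> \<Gamma> \<T> N"
    and "M = surface_measure \<T> \<Gamma>"
    and "k \<ge> 1"
  shows "\<exists>\<beta>>0. ereal \<beta> \<le>
    (INF \<mu>\<in>{\<mu> \<in> fe_space_surface k \<Omega> \<T> \<Gamma>. \<not> (AE x in M. \<mu> x = 0)}.
     SUP (v, w)\<in>{(v, w). v \<in> fe_space k \<Omega> \<T> \<and> w \<in> fe_space_line k S N \<and>
                          (v, w) \<noteq> ((\<lambda>x. 0), (\<lambda>s. 0))}.
       ereal (pivot_functional M \<mu> (\<lambda>x. trace_op \<Omega> M v x - extension_op S D w x))
         / (ereal (pair_norm \<Omega> S D v w) * H_minus_half_norm \<Omega> M (pivot_functional M \<mu>)))"
proof -
  note \<Omega> = assms(1-4) and \<Omega>ob = assms(1,3) and mesh = assms(11)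
  define \<F> where "\<F> = surface_faces \<T> \<Gamma>"
  have \<F>: "finite \<F>" "\<forall>F\<in>\<F>. flat F" and M: "M = polyhedral_surface_measure \<F>"
    unfolding \<F>_def using surface_faces_flat[OF mesh] assms(15) by (auto simp: surface_measure_def)
  have sets_eq: "sets M = sets borel" and fin: "emeasure M UNIV < \<infinity>"
    unfolding M using sets_surface_measure[OF \<F>] emeasure_surface_measure_finite[OF \<F>] by auto
  let ?V = "fe_space k \<Omega> \<T>" and ?B = "L2_inner M"
  have tr: "has_trace \<Omega> M v v" if "v \<in> ?V" for v
    using fe_space_has_trace[OF \<Omega> mesh that sets_eq fin] .
  have H1: "v \<in> H1 \<Omega>" if "v \<in> ?V" for v using fe_space_H1(1)[OF \<Omega> mesh that] .
  \<comment> \<open>The choice in \<open>trace_op\<close> has a witness, namely \<open>v\<close>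
    itself.\<close>
  have tr_op: "has_trace \<Omega> M v (trace_op \<Omega> M v)" if "v \<in> ?V" for v
    unfolding trace_op_def using tr[OF that] by (rule someI[where P="has_trace \<Omega> M v"])
  have tr_AE: "AE x in M. trace_op \<Omega> M v x = v x" if "v \<in> ?V" for v
    by (rule trace_unique[OF \<F> M \<Omega>ob H1[OF that] tr_op[OF that] tr[OF that]])
  have L2: "v \<in> L2_functions M" if "v \<in> ?V" for v
    using trace_L2(1)[OF \<F> M \<Omega>ob H1[OF that] tr[OF that]] .
  have SI: "semi_inner ?V ?B"
    by (rule semi_inner_subspace[OF semi_inner_L2]) (use L2 fe_space_lincomb in auto)
  obtain J :: "((real^3) set \<times> nat \<times> nat \<times> nat) set" and f
    where J: "finite J" "\<And>v. v \<in> ?V \<Longrightarrow> \<exists>c. \<forall>x. v x = (\<Sum>j\<in>J. c j * f j x)"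
    using fe_space_spanned[OF mesh] by metis
  obtain E where E: "finite E" "E \<subseteq> ?V" "orthonormal ?B E"
    "\<And>v. v \<in> ?V \<Longrightarrow> ?B (residual ?B E v) (residual ?B E v) = 0"
    using finite_orthonormal_system[OF J(1) SI J(2)] by metis
  obtain C where C: "C \<ge> 0" "\<And>a m. \<forall>e\<in>E. \<bar>a e\<bar> \<le> m \<Longrightarrow>
      (H1_norm \<Omega> (\<lambda>x. \<Sum>e\<in>E. a e * e x))\<^sup>2 \<le> C * m\<^sup>2"
  proof -
    have "E \<subseteq> H1 \<Omega>" using E(2) H1 by auto
    from H1_norm_sum_bound[OF \<Omega>ob E(1) this] show thesis using that by blast
  qed
  \<comment> \<open>Bounds the dual norm of \<mu> by \<open>K\<close> times its surface
    norm.\<close>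
  define K where "K = 2 * sqrt (card \<F>) + 1"
  have K: "0 < K" unfolding K_def by (simp add: add_nonneg_pos)
  \<comment> \<open>Will bound the H^1 norm of the lift by \<open>c\<close> times the surface norm;
    the added 1 secures positivity when \<open>C = 0\<close>.\<close>
  define c where "c = sqrt C + 1"
  have c: "0 < c" unfolding c_def using C(1) by (simp add: add_nonneg_pos)
  let ?Q = "\<lambda>\<mu> v w. ereal (pivot_functional M \<mu> (\<lambda>x. trace_op \<Omega> M v x - extension_op S D w x))
         / (ereal (pair_norm \<Omega> S D v w) * H_minus_half_norm \<Omega> M (pivot_functional M \<mu>))"
  have main: "\<exists>v\<in>?V. v \<noteq> (\<lambda>x. 0) \<and> ereal (1 / (c * K)) \<le> ?Q \<mu> v (\<lambda>s. 0)"
    if \<mu>: "\<mu> \<in> fe_space_surface k \<Omega> \<T> \<Gamma>" "\<not> (AE x in M. \<mu> x = 0)" for \<mu>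
  proof -
    obtain u where u: "u \<in> ?V" "\<mu> = trace_op \<Omega> M u"
      using \<mu>(1) assms(15) unfolding fe_space_surface_def by blast
    have \<mu>_tr: "has_trace \<Omega> M u \<mu>" and \<mu>_u: "AE x in M. \<mu> x = u x"
      unfolding u(2) using tr_op[OF u(1)] tr_AE[OF u(1)] by auto
    have \<mu>L: "\<mu> \<in> L2_functions M" using trace_L2(1)[OF \<F> M \<Omega>ob H1[OF u(1)] \<mu>_tr] .
    have meas: "q \<in> borel_measurable M" if "q \<in> L2_functions M" for q
      using that unfolding L2_functions_def by blast
    define m where "m = sqrt (?B \<mu> \<mu>)"
    have "?B \<mu> \<mu> \<noteq> 0" using L2_null_AE[OF \<mu>L] \<mu>(2) by blast
    then have B\<mu>: "0 < ?B \<mu> \<mu>" using semi_innerD(4)[OF semi_inner_L2 \<mu>L] by simp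
    then have m: "0 < m" "?B \<mu> \<mu> = m * m" unfolding m_def by auto
    have Bu: "?B u u = m * m"
      using L2_inner_cong_AE[OF meas[OF \<mu>L] meas[OF \<mu>L] meas[OF L2[OF u(1)]] meas[OF L2[OF u(1)]] \<mu>_u \<mu>_u] m(2) by simp
    \<comment> \<open>The projection of \<open>u\<close> onto \<open>E\<close>. It agrees with
      \<open>u\<close> almost everywhere on the surface, while the residual, null there but possibly
      large in H^1, is dropped.\<close>
    define v where "v = (\<lambda>x. \<Sum>e\<in>E. ?B u e * e x)"
    have vV: "v \<in> ?V"
      using semi_inner_sum(1)[OF SI E(1,2) u(1), of 0 "\<lambda>e. ?B u e"] unfolding v_def by simp
    have resV: "residual ?B E u \<in> ?V" using residual_in(1)[OF SI E(1,2) u(1)] .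
    have "AE x in M. residual ?B E u x = 0" using L2_null_AE[OF L2[OF resV] E(4)[OF u(1)]] .
    then have v_\<mu>: "AE x in M. trace_op \<Omega> M v x = \<mu> x"
      using tr_AE[OF vV] \<mu>_u by eventually_elim (simp add: residual_def v_def)
    \<comment> \<open>The coefficients are at most the surface norm \<open>m\<close>, so the bound
      with \<open>C\<close> applies with this very \<open>m\<close>.\<close>
    have "\<bar>?B u e\<bar> \<le> m" if e: "e \<in> E" for e
    proof -
      have "?B e e = 1" using E(3) e unfolding orthonormal_def by simp
      then have "(?B u e)\<^sup>2 \<le> m\<^sup>2"
        using semi_inner_Cauchy_Schwarz[OF SI u(1), of e] e E(2) Bu by (auto simp: power2_eq_square)
      then show ?thesis using m(1) by (metis abs_le_square_iff abs_of_pos)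
    qed
    then have "(H1_norm \<Omega> v)\<^sup>2 \<le> C * m\<^sup>2" unfolding v_def by (intro C(2)) blast
    then have "H1_norm \<Omega> v \<le> sqrt (C * m\<^sup>2)" by (rule real_le_rsqrt)
    also have "\<dots> \<le> c * m" unfolding c_def using m(1) by (simp add: real_sqrt_mult distrib_right)
    finally have H1_le: "H1_norm \<Omega> v \<le> c * m" .
    have tvL: "trace_op \<Omega> M v \<in> L2_functions M" using trace_L2(1)[OF \<F> M \<Omega>ob H1[OF vV] tr_op[OF vV]] .
    have Bv: "?B (trace_op \<Omega> M v) (trace_op \<Omega> M v) = m * m" "?B (trace_op \<Omega> M v) \<mu> = m * m"
      using L2_inner_cong_AE[OF meas[OF tvL] meas[OF tvL] meas[OF \<mu>L] meas[OF \<mu>L] v_\<mu> v_\<mu>]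
        L2_inner_cong_AE[OF meas[OF tvL] meas[OF \<mu>L] meas[OF \<mu>L] meas[OF \<mu>L] v_\<mu>] m(2) by simp_all
    \<comment> \<open>By the trace bound, a function of zero H^1 norm would have a null
      trace.\<close>
    have "H1_norm \<Omega> v \<noteq> 0"
      using trace_L2(2)[OF \<F> M \<Omega>ob H1[OF vV] tr_op[OF vV]] Bv(1) mult_pos_pos[OF m(1) m(1)] by auto
    then have H1_pos: "0 < H1_norm \<Omega> v" using H1_norm_nonneg[of \<Omega> v] by simp
    have v_ne: "v \<noteq> (\<lambda>x. 0)"
    proof
      assume "v = (\<lambda>x. 0)"
      then have "AE x in M. trace_op \<Omega> M v x = 0" using tr_AE[OF vV] by simp
      then have "AE x in M. \<mu> x = 0" using v_\<mu> by eventually_elim simp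
      then show False using \<mu>(2) by blast
    qed
    have pn: "pair_norm \<Omega> S D v (\<lambda>s. 0) = H1_norm \<Omega> v"
      unfolding pair_norm_def weighted_H1_norm_line_zero using H1_pos by simp
    \<comment> \<open>For the zero function on the line the extension is zero at every point,
      whatever \<open>THE\<close> selects there.\<close>
    have pv: "pivot_functional M \<mu> (\<lambda>x. trace_op \<Omega> M v x - extension_op S D (\<lambda>s. 0) x) = m * m"
      using Bv(2) unfolding pivot_functional_def extension_op_def L2_inner_def by simp
    have \<mu>H: "\<mu> \<in> H_half_00 \<Omega> M"
      unfolding H_half_00_def using \<mu>_tr fe_space_H1(2)[OF \<Omega> mesh u(1)] by blast
    have "m \<le> K * H_half_00_norm \<Omega> M \<mu>"
      unfolding K_def m_def by (rule H_half_00_norm_ge(2)[OF \<F> M \<Omega>ob \<mu>H])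
    then have "0 < K * H_half_00_norm \<Omega> M \<mu>" using m(1) by linarith
    then have half: "0 < H_half_00_norm \<Omega> M \<mu>" using K by (simp add: zero_less_mult_iff)
    let ?H = "H_minus_half_norm \<Omega> M (pivot_functional M \<mu>)"
    have H_le: "?H \<le> ereal (K * m)"
      unfolding K_def m_def by (rule H_minus_half_norm_le[OF \<F> M \<Omega>ob \<mu>L])
    \<comment> \<open>The dual norm is tested with \<mu> itself. Together with the upper bound this
      places it strictly between zero and infinity, so that the quotient in \<open>ereal\<close> is
      an ordinary real quotient.\<close>
    have "0 < ereal (\<bar>pivot_functional M \<mu> \<mu>\<bar> / H_half_00_norm \<Omega> M \<mu>)"
      using B\<mu> half unfolding pivot_functional_def L2_inner_def by simp
    also have "\<dots> \<le> ?H" unfolding H_minus_half_norm_def by (rule SUP_upper) (use \<mu>H \<mu>(2) in simp)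
    finally have H_pos: "0 < ?H" .
    obtain h where h: "?H = ereal h" using H_le H_pos by (cases ?H) auto
    have h': "0 < h" "h \<le> K * m" using H_le H_pos unfolding h by auto
    have "H1_norm \<Omega> v * h \<le> (c * m) * (K * m)"
      using H1_le h' H1_pos c m(1) by (intro mult_mono) auto
    then have "(m * m) / ((c * m) * (K * m)) \<le> m * m / (H1_norm \<Omega> v * h)"
      using H1_pos h'(1) c K m(1) by (intro divide_left_mono mult_pos_pos) auto
    \<comment> \<open>The scale \<open>m\<close> cancels, which leaves a constant independent of
      \<mu>.\<close>
    moreover have "(m * m) / ((c * m) * (K * m)) = 1 / (c * K)" using m(1) by simp
    ultimately have "1 / (c * K) \<le> m * m / (H1_norm \<Omega> v * h)" by simp
    then have "ereal (1 / (c * K)) \<le> ereal (m * m) / (ereal (H1_norm \<Omega> v) * ereal h)"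
      using H1_pos h'(1) by simp
    then show ?thesis
      by (intro bexI[OF _ vV] conjI v_ne) (simp only: pn pv h)
  qed
  have zero: "(\<lambda>s. 0) \<in> fe_space_line k S N"
  proof -
    have "\<exists>p. degree p \<le> k \<and> (\<forall>s\<in>I. (0::real) = poly p s)" for I
      by (rule exI[of _ 0]) simp
    then show ?thesis unfolding fe_space_line_def by simp
  qed
  show ?thesis
  proof (intro exI[of _ "1 / (c * K)"] conjI INF_greatest)
    show "0 < 1 / (c * K)" using c K by simp
    fix \<mu> assume "\<mu> \<in> {\<mu> \<in> fe_space_surface k \<Omega> \<T> \<Gamma>. \<not> (AE x in M. \<mu> x = 0)}"
    then obtain v where v: "v \<in> ?V" "v \<noteq> (\<lambda>x. 0)" "ereal (1 / (c * K)) \<le> ?Q \<mu> v (\<lambda>s. 0)"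
      using main[of \<mu>] by blast
    show "ereal (1 / (c * K)) \<le> (SUP (v, w)\<in>{(v, w). v \<in> fe_space k \<Omega> \<T> \<and> w \<in> fe_space_line k S N \<and>
                          (v, w) \<noteq> ((\<lambda>x. 0), (\<lambda>s. 0))}.
       ?Q \<mu> v w)"
    \<comment> \<open>The pair with zero second component is admissible because \<open>v\<close> is
      not the zero function.\<close>
    proof (rule SUP_upper2[of "(v, \<lambda>s. 0)"])
      show "(v, \<lambda>s. 0) \<in> {(v, w). v \<in> fe_space k \<Omega> \<T> \<and> w \<in> fe_space_line k S N \<and>
                          (v, w) \<noteq> ((\<lambda>x. 0), (\<lambda>s. 0))}" using v(1,2) zero by simp
    qed (use v(3) in simp)
  qed
qed

end
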